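(* Let $\varphi$ be a growth function on $\mathbb{R}^n\times[0,\infty)$ and let $\psi_0\in\mathcal{D}(\mathbb{R}^n)$ satisfy $\int_{\mathbb{R}^n}\psi_0(x)\,dx\ne0$. Then the following are equivalent: (i) $f\in H^\varphi(\mathbb{R}^n)$; (ii) $f\in\mathcal{S}'(\mathbb{R}^n)$ and $\psi_0^+(f)\in L^\varphi(\mathbb{R}^n)$; (iii) $f\in\mathcal{S}'(\mathbb{R}^n)$ and $(\psi_0)^*_{\triangledown}(f)\in L^\varphi(\mathbb{R}^n)$. Moreover, for all $f\in H^\varphi(\mathbb{R}^n)$, $$\|f\|_{H^\varphi(\mathbb{R}^n)}\sim\|\psi_0^+(f)\|_{L^\varphi(\mathbb{R}^n)}\sim\|(\psi_0)^*_{\triangledown}(f)\|_{L^\varphi(\mathbb{R}^n)},$$ where the implicit constants are independent of $f$.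
   Context: Growth functions. An Orlicz function is a nondecreasing $\Phi:[0,\infty)\to[0,\infty)$ with $\Phi(0)=0$, $\Phi(t)>0$ for $t>0$ and $\lim_{t\to\infty}\Phi(t)=\infty$. A function $\varphi:\mathbb{R}^n\times[0,\infty)\to[0,\infty)$ is of uniformly upper (resp. lower) type $p$ if there is $C>0$ such that $\varphi(x,st)\le Cs^p\varphi(x,t)$ for all $x\in\mathbb{R}^n$, $t\in[0,\infty)$ and $s\in[1,\infty)$ (resp. $s\in[0,1]$). $\varphi\in\mathbb{A}_q(\mathbb{R}^n)$, $q\in[1,\infty)$, means that $\int_K\sup_{t\in(0,\infty)}\{\varphi(x,t)[\int_K\varphi(y,t)\,dy]^{-1}\}\,dx<\infty$ for all compact $K$, and that, when $q>1$ with $1/q+1/q'=1$, $\sup_{t\in(0,\infty)}\sup_B|B|^{-q}\int_B\varphi(x,t)\,dx\{\int_B[\varphi(y,t)]^{-q'/q}\,dy\}^{q/q'}<\infty$, or, when $q=1$, $\sup_{t\in(0,\infty)}\sup_B|B|^{-1}\int_B\varphi(x,t)\,dx\ \operatorname{ess\,sup}_{y\in B}[\varphi(y,t)]^{-1}<\infty$, with $B$ ranging over all balls. $\mathbb{A}_\infty(\mathbb{R}^n):=\bigcup_{q\in[1,\infty)}\mathbb{A}_q(\mathbb{R}^n)$. A growth function is a $\varphi$ such that: $\varphi(x,\cdot)$ is an Orlicz function for all $x$ and $\varphi(\cdot,t)$ is measurable for all $t$; $\varphi\in\mathbb{A}_\infty(\mathbb{R}^n)$; $\varphi$ is of uniformly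 lower type $p$ for some $p\in(0,1]$ and of uniformly upper type $1$. Set $q(\varphi):=\inf\{q\in[1,\infty):\varphi\in\mathbb{A}_q(\mathbb{R}^n)\}$, $i(\varphi):=\sup\{p\in(0,\infty):\varphi\text{ is of uniformly lower type }p\}$ and $m(\varphi):=\lfloor n[q(\varphi)/i(\varphi)-1]\rfloor$. Spaces. $L^\varphi(\mathbb{R}^n)$ is the space of measurable $f$ with $\int_{\mathbb{R}^n}\varphi(x,|f(x)|)\,dx<\infty$, with $\|f\|_{L^\varphi(\mathbb{R}^n)}:=\inf\{\lambda\in(0,\infty):\int_{\mathbb{R}^n}\varphi(x,|f(x)|/\lambda)\,dx\le1\}$. $\mathcal{D}(\mathbb{R}^n)$ is the space of $C^\infty$ functions with compact support, $\mathcal{S}(\mathbb{R}^n)$ the Schwartz space, $\mathcal{S}'(\mathbb{R}^n)$ its dual. For $t\in(0,\infty)$, $\psi_t(x):=t^{-n}\psi(x/t)$. For $m\in\mathbb{Z}_+:=\{0,1,2,\dots\}$, $\mathcal{S}_m(\mathbb{R}^n):=\{\psi\in\mathcal{S}(\mathbb{R}^n):\sup_{x\in\mathbb{R}^n}\sup_{\beta\in\mathbb{Z}_+^n,|\beta|\le m+1}(1+|x|)^{(m+2)(n+1)}|\partial_x^\beta\psi(x)|\le1\}$, $f^*_m(x):=\sup_{\psi\in\mathcal{S}_m(\mathbb{R}^n)}\sup_{|y-x|<t,\,t\in(0,\infty)}|f*\psi_t(y)|$, and $f^*:=f^*_{m(\varphi)}$. The Musielak-Orlicz Hardy space $H^\varphi(\mathbb{R}^n)$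 is the space of all $f\in\mathcal{S}'(\mathbb{R}^n)$ with $f^*\in L^\varphi(\mathbb{R}^n)$, with quasi-norm $\|f\|_{H^\varphi(\mathbb{R}^n)}:=\|f^*\|_{L^\varphi(\mathbb{R}^n)}$. Maximal functions. With $(\psi_0)_j(x):=2^{jn}\psi_0(2^jx)$ for $j\in\mathbb{Z}$ and $(\psi_0)_t(x):=t^{-n}\psi_0(x/t)$ for $t\in(0,\infty)$, $$\psi_0^+(f)(x):=\sup_{j\in\mathbb{Z}}|(\psi_0)_j*f(x)|,\qquad(\psi_0)^*_{\triangledown}(f)(x):=\sup_{|x-y|<t,\,t\in(0,\infty)}|(\psi_0)_t*f(y)|.$$ $a\sim b$ means that each is bounded by a positive constant times the other. *)

theory Defs
  imports "HOL-Analysis.Analysis" "HOL-Probability.Essential_Supremum"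
begin

section \<open>Growth functions\<close>

text \<open>
  A function on \<open>\<real>\<^sup>n \<times> [0,\<infinity>)\<close> has the type \<^typ>\<open>real^'n \<Rightarrow> real \<Rightarrow> real\<close>; its values at negative
  second arguments never matter.  All integrals are \<^typ>\<open>ennreal\<close>-valued.
\<close>

definition orlicz_function :: "(real \<Rightarrow> real) \<Rightarrow> bool" where
  "orlicz_function \<Phi> \<longleftrightarrow>
     mono_on {0..} \<Phi> \<and> \<Phi> 0 = 0 \<and> (\<forall>t>0. \<Phi> t > 0) \<and> filterlim \<Phi> at_top at_top"

definition uniformly_upper_type :: "real \<Rightarrow> (real^'n \<Rightarrow> real \<Rightarrow> real) \<Rightarrow> bool" where
  "uniformly_upper_type p \<phi> \<longleftrightarrow>
     (\<exists>C>0. \<forall>x. \<forall>t\<ge>0. \<forall>s\<ge>1. \<phi> x (s * t) \<le> C * s powr p * \<phi> x t)"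

definition uniformly_lower_type :: "real \<Rightarrow> (real^'n \<Rightarrow> real \<Rightarrow> real) \<Rightarrow> bool" where
  "uniformly_lower_type p \<phi> \<longleftrightarrow>
     (\<exists>C>0. \<forall>x. \<forall>t\<ge>0. \<forall>s\<in>{0..1}. \<phi> x (s * t) \<le> C * s powr p * \<phi> x t)"

text \<open>Power with a positive exponent, extended by \<open>\<infinity>\<^sup>p = \<infinity>\<close>.\<close>

definition ennreal_power :: "ennreal \<Rightarrow> real \<Rightarrow> ennreal" where
  "ennreal_power a p = (if a = \<infinity> then \<infinity> else ennreal (enn2real a powr p))"

text \<open>
  In \<open>Aq_constant q \<phi> t c r\<close> the ball is \<open>ball c r\<close> and \<open>q'\<close> is the conjugate exponent.  For an
  Orlicz function and \<open>t > 0\<close> no product below is of the form \<open>0 \<cdot> \<infinity>\<close>, so a finite value forces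
  each factor to be finite.
\<close>

definition Aq_constant :: "real \<Rightarrow> (real^'n \<Rightarrow> real \<Rightarrow> real) \<Rightarrow> real \<Rightarrow> real^'n \<Rightarrow> real \<Rightarrow> ennreal" where
  "Aq_constant q \<phi> t c r =
     (let B = ball c r; q' = q / (q - 1) in
      ennreal (measure lebesgue B powr (- q)) * (\<integral>\<^sup>+x\<in>B. ennreal (\<phi> x t) \<partial>lebesgue) *
      (if q > 1
       then ennreal_power (\<integral>\<^sup>+y\<in>B. ennreal (\<phi> y t powr (- (q' / q))) \<partial>lebesgue) (q / q')
       else esssup (restrict_space lebesgue B) (\<lambda>y. inverse (ennreal (\<phi> y t)))))"

definition muckenhoupt :: "real \<Rightarrow> (real^'n \<Rightarrow> real \<Rightarrow> real) \<Rightarrow> bool" where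
  "muckenhoupt q \<phi> \<longleftrightarrow>
     1 \<le> q \<and>
     (\<forall>K. compact K \<longrightarrow>
        (\<integral>\<^sup>+x\<in>K. (SUP t\<in>{0<..}. ennreal (\<phi> x t) / (\<integral>\<^sup>+y\<in>K. ennreal (\<phi> y t) \<partial>lebesgue)) \<partial>lebesgue) < \<infinity>) \<and>
     (SUP t\<in>{0<..}. SUP c. SUP r\<in>{0<..}. Aq_constant q \<phi> t c r) < \<infinity>"

definition growth_function :: "(real^'n \<Rightarrow> real \<Rightarrow> real) \<Rightarrow> bool" where
  "growth_function \<phi> \<longleftrightarrow>
     (\<forall>x. orlicz_function (\<phi> x)) \<and>
     (\<forall>t\<ge>0. (\<lambda>x. \<phi> x t) \<in> borel_measurable lebesgue) \<and>
     (\<exists>q\<ge>1. muckenhoupt q \<phi>) \<and>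
     (\<exists>p. 0 < p \<and> p \<le> 1 \<and> uniformly_lower_type p \<phi>) \<and>
     uniformly_upper_type 1 \<phi>"

definition critical_weight_index :: "(real^'n \<Rightarrow> real \<Rightarrow> real) \<Rightarrow> real" where
  "critical_weight_index \<phi> = Inf {q. 1 \<le> q \<and> muckenhoupt q \<phi>}"

definition critical_lower_type :: "(real^'n \<Rightarrow> real \<Rightarrow> real) \<Rightarrow> real" where
  "critical_lower_type \<phi> = Sup {p. 0 < p \<and> uniformly_lower_type p \<phi>}"

definition critical_order :: "(real^'n \<Rightarrow> real \<Rightarrow> real) \<Rightarrow> nat" where
  "critical_order \<phi> =
     nat \<lfloor>real CARD('n) * (critical_weight_index \<phi> / critical_lower_type \<phi> - 1)\<rfloor>"


section \<open>Musielak--Orlicz spaces\<close>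

text \<open>
  Maximal functions may take the value \<open>\<infinity>\<close>, so the space is one of nonnegative extended-valued
  functions, with \<open>\<phi>(x,\<infinity>) = lim\<^sub>t\<^sub>\<rightarrow>\<^sub>\<infinity> \<phi>(x,t) = \<infinity>\<close>.  A member is then finite almost everywhere.

  The composition \<open>x \<mapsto> \<phi>(x,g(x))\<close> need not be measurable, since \<open>\<phi>(x,\<cdot>)\<close> may be discontinuous;
  \<^const>\<open>nn_integral\<close> then is the lower integral.
\<close>

definition musielak_modular :: "(real^'n \<Rightarrow> real \<Rightarrow> real) \<Rightarrow> (real^'n \<Rightarrow> ennreal) \<Rightarrow> ennreal" where
  "musielak_modular \<phi> g =
     (\<integral>\<^sup>+x. (if g x = \<infinity> then \<infinity> else ennreal (\<phi> x (enn2real (g x)))) \<partial>lebesgue)"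

definition musielak_space :: "(real^'n \<Rightarrow> real \<Rightarrow> real) \<Rightarrow> (real^'n \<Rightarrow> ennreal) set" where
  "musielak_space \<phi> = {g \<in> borel_measurable lebesgue. musielak_modular \<phi> g < \<infinity>}"

definition musielak_norm :: "(real^'n \<Rightarrow> real \<Rightarrow> real) \<Rightarrow> (real^'n \<Rightarrow> ennreal) \<Rightarrow> ennreal" where
  "musielak_norm \<phi> g =
     Inf {ennreal l | l. 0 < l \<and> musielak_modular \<phi> (\<lambda>x. g x / ennreal l) \<le> 1}"


section \<open>Test functions and tempered distributions\<close>

definition partial_deriv :: "'n \<Rightarrow> (real^'n \<Rightarrow> complex) \<Rightarrow> real^'n \<Rightarrow> complex" where
  "partial_deriv i \<psi> x = vector_derivative (\<lambda>h. \<psi> (x + h *\<^sub>R axis i 1)) (at 0)"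

text \<open>
  \<open>C\<^sup>\<infinity>\<close>: all iterated partial derivatives, in any order, exist and are (Frechet) differentiable.
\<close>

definition smooth :: "(real^'n \<Rightarrow> complex) \<Rightarrow> bool" where
  "smooth \<psi> \<longleftrightarrow> (\<forall>is. foldr partial_deriv is \<psi> differentiable_on UNIV)"

text \<open>
  \<open>multi_deriv \<beta>\<close> is \<open>\<partial>\<^sup>\<beta>\<close>.  The coordinates are processed in some fixed order; for smooth functions
  the choice of the order is irrelevant.
\<close>

definition multi_deriv :: "nat^'n \<Rightarrow> (real^'n \<Rightarrow> complex) \<Rightarrow> real^'n \<Rightarrow> complex" where
  "multi_deriv \<beta> =
     foldr (\<lambda>i. partial_deriv i ^^ (\<beta> $ i)) (SOME is. distinct is \<and> set is = UNIV)"

definition multi_order :: "nat^'n \<Rightarrow> nat" where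
  "multi_order \<beta> = (\<Sum>i\<in>UNIV. \<beta> $ i)"

definition test_functions :: "(real^'n \<Rightarrow> complex) set" where
  "test_functions = {\<psi>. smooth \<psi> \<and> compact (closure {x. \<psi> x \<noteq> 0})}"

definition schwartz_seminorm :: "nat \<Rightarrow> nat^'n \<Rightarrow> (real^'n \<Rightarrow> complex) \<Rightarrow> ennreal" where
  "schwartz_seminorm k \<beta> \<psi> = (SUP x. ennreal ((1 + norm x) ^ k * norm (multi_deriv \<beta> \<psi> x)))"

definition schwartz_space :: "(real^'n \<Rightarrow> complex) set" where
  "schwartz_space = {\<psi>. smooth \<psi> \<and> (\<forall>k \<beta>. schwartz_seminorm k \<beta> \<psi> < \<infinity>)}"

definition schwartz_topology :: "(real^'n \<Rightarrow> complex) topology" where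
  "schwartz_topology = topology_generated_by
     {{\<eta> \<in> schwartz_space. schwartz_seminorm k \<beta> (\<lambda>x. \<eta> x - \<psi> x) < ennreal \<epsilon>} | k \<beta> \<psi> \<epsilon>.
        \<psi> \<in> schwartz_space \<and> 0 < \<epsilon>}"

text \<open>
  A distribution is represented by a function on all of \<^typ>\<open>real^'n \<Rightarrow> complex\<close>; only its values on
  the Schwartz space are constrained and used.
\<close>

definition tempered_distributions :: "((real^'n \<Rightarrow> complex) \<Rightarrow> complex) set" where
  "tempered_distributions =
     {f. (\<forall>\<psi>\<in>schwartz_space. \<forall>\<eta>\<in>schwartz_space. \<forall>a b.
            f (\<lambda>x. a * \<psi> x + b * \<eta> x) = a * f \<psi> + b * f \<eta>) \<and>
         continuous_map schwartz_topology euclidean f}"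

definition distr_conv ::
    "((real^'n \<Rightarrow> complex) \<Rightarrow> complex) \<Rightarrow> (real^'n \<Rightarrow> complex) \<Rightarrow> real^'n \<Rightarrow> complex" where
  "distr_conv f \<psi> x = f (\<lambda>z. \<psi> (x - z))"

definition dilate :: "real \<Rightarrow> (real^'n \<Rightarrow> complex) \<Rightarrow> real^'n \<Rightarrow> complex" where
  "dilate t \<psi> x = complex_of_real (1 / t ^ CARD('n)) * \<psi> (x /\<^sub>R t)"

definition dyadic_dilate :: "int \<Rightarrow> (real^'n \<Rightarrow> complex) \<Rightarrow> real^'n \<Rightarrow> complex" where
  "dyadic_dilate j \<psi> x = complex_of_real (2 powi (j * int CARD('n))) * \<psi> ((2 powi j) *\<^sub>R x)"


section \<open>Maximal functions and the Musielak--Orlicz Hardy space\<close>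

definition normalized_schwartz :: "nat \<Rightarrow> (real^'n \<Rightarrow> complex) set" where
  "normalized_schwartz m =
     {\<psi> \<in> schwartz_space.
        (SUP x. SUP \<beta>\<in>{\<beta>. multi_order \<beta> \<le> m + 1}.
           ennreal ((1 + norm x) ^ ((m + 2) * (CARD('n) + 1)) * norm (multi_deriv \<beta> \<psi> x))) \<le> 1}"

definition nontangential_max ::
    "(real^'n \<Rightarrow> complex) \<Rightarrow> ((real^'n \<Rightarrow> complex) \<Rightarrow> complex) \<Rightarrow> real^'n \<Rightarrow> ennreal" where
  "nontangential_max \<psi> f x =
     (SUP (y, t)\<in>{(y, t). 0 < t \<and> dist x y < t}. ennreal (norm (distr_conv f (dilate t \<psi>) y)))"

definition dyadic_radial_max ::
    "(real^'n \<Rightarrow> complex) \<Rightarrow> ((real^'n \<Rightarrow> complex) \<Rightarrow> complex) \<Rightarrow> real^'n \<Rightarrow> ennreal" where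
  "dyadic_radial_max \<psi> f x = (SUP j. ennreal (norm (distr_conv f (dyadic_dilate j \<psi>) x)))"

definition grand_max ::
    "nat \<Rightarrow> ((real^'n \<Rightarrow> complex) \<Rightarrow> complex) \<Rightarrow> real^'n \<Rightarrow> ennreal" where
  "grand_max m f x = (SUP \<psi>\<in>normalized_schwartz m. nontangential_max \<psi> f x)"

definition musielak_hardy ::
    "(real^'n \<Rightarrow> real \<Rightarrow> real) \<Rightarrow> ((real^'n \<Rightarrow> complex) \<Rightarrow> complex) set" where
  "musielak_hardy \<phi> =
     {f \<in> tempered_distributions. grand_max (critical_order \<phi>) f \<in> musielak_space \<phi>}"

definition musielak_hardy_norm ::
    "(real^'n \<Rightarrow> real \<Rightarrow> real) \<Rightarrow> ((real^'n \<Rightarrow> complex) \<Rightarrow> complex) \<Rightarrow> ennreal" where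
  "musielak_hardy_norm \<phi> f = musielak_norm \<phi> (grand_max (critical_order \<phi>) f)"

definition comparable_on :: "'a set \<Rightarrow> ('a \<Rightarrow> ennreal) \<Rightarrow> ('a \<Rightarrow> ennreal) \<Rightarrow> bool" where
  "comparable_on S a b \<longleftrightarrow>
     (\<exists>C>0. \<forall>f\<in>S. a f \<le> ennreal C * b f \<and> b f \<le> ennreal C * a f)"

end

theory Submission
  imports Defs
begin

text \<open>
  Write \<open>f\<^sup>*\<close> for the grand maximal function of order \<open>m = m(\<phi>)\<close> and \<open>\<psi>\<^sub>0\<^sup>+(f)\<close> for the dyadic radial one.
  Pointwise, \<open>\<psi>\<^sub>0\<^sup>+(f)\<close> is at most the nontangential maximal function, which is at most a constant
  times \<open>f\<^sup>*\<close>, because a multiple of \<open>\<psi>\<^sub>0\<close> is one of the test functions in \<open>f\<^sup>*\<close>.  So everything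
  follows from a bound of the modular of \<open>f\<^sup>*\<close> by the modular of \<open>\<psi>\<^sub>0\<^sup>+(f)\<close>.  This bound is the
  composition of a pointwise inequality and an inequality for the Hardy-Littlewood maximal function \<open>M\<close>.

  The pointwise inequality is
    \<open>f\<^sup>*(x) \<le> C (M (\<psi>\<^sub>0\<^sup>+(f)\<^sup>r)(x)) powr (1/r)\<close>  whenever  \<open>n / (n + m + 1) < r < 1\<close>
  (\<open>grand_max_le_maximal_function\<close>).  Let \<open>\<Phi>\<close> be \<open>\<psi>\<^sub>0\<close>, \<open>a = 1 / \<integral>\<Phi>\<close>, and let \<open>u\<^sub>l = f * \<Phi>\<^sub>t\<close> with
  \<open>t = 1 / 2 ^ l\<close> be the layers of \<open>f\<close>.  Starting with a test function \<open>\<psi>\<close>, subtract from it its own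
  convolution with \<open>a \<Phi>\<close> at scale 1, from the remainder its convolution with \<open>a \<Phi>\<close> at scale
  \<open>1 / 2 ^ \<sigma>\<close>, and so on.  The sum of what is subtracted telescopes to \<open>\<psi>\<close>, so \<open>f * \<psi>\<close> is a sum of
  integrals of layers against the remainders.  Each subtraction at scale \<open>s\<close> trades one derivative
  of the remainder for a factor \<open>s\<close>, at the price of a fixed constant, which is negligible against
  the powers of \<open>1 / 2 ^ \<sigma>\<close> when the spacing \<open>\<sigma>\<close> is large.  Hence, for any \<open>\<delta> < m + 1\<close>, the layer of
  index \<open>l\<close> enters with a factor \<open>2 powr (- \<delta> l)\<close> only (\<open>reproducing_bound\<close>).

  On the other hand each layer satisfies a sub-mean-value property with exponent \<open>r\<close>: the power
  \<open>|u\<^sub>l|\<^sup>r\<close> is at most an average of \<open>\<psi>\<^sub>0\<^sup>+(f)\<^sup>r\<close> at the scale \<open>1 / 2 ^ l\<close> (\<open>pointwise_sub_mean_value\<close>).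
  This is the argument of Stroemberg and Torchinsky: the reproducing formula applied to \<open>\<psi> = \<Phi>\<close> bounds
  the layers by integrals of finer layers, and a factor \<open>|u\<^sub>l| powr (1 - r)\<close> is absorbed into a weighted
  supremum, which has to be shown finite beforehand.  Integrating a layer at the coarse scale 1 then
  costs a factor \<open>2 powr (n (1/r - 1) l)\<close> in comparison with \<open>M (\<psi>\<^sub>0\<^sup>+(f)\<^sup>r)\<close>, as in the embedding of
  \<open>\<ell>\<^sup>r\<close> into \<open>\<ell>\<^sup>1\<close>, and this is compensated exactly if \<open>n (1/r - 1) < m + 1\<close>.

  The inequality for \<open>M\<close> (\<open>musielak_modular_le_of_maximal\<close>) bounds the modular of \<open>(M (g\<^sup>r)) powr (1/r)\<close>
  by that of \<open>g\<close> if \<open>\<phi>\<close> is of lower type \<open>p\<close>, in the class \<open>A\<^sub>q\<close>, and \<open>r q < p\<close>.  The weights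
  \<open>\<phi>(\<cdot>,t)\<close> satisfy a weak type \<open>(q,q)\<close> inequality uniformly in \<open>t\<close>, by a covering argument; it is used
  with \<open>t = 2 ^ k\<close> on the level set \<open>M (g\<^sup>r) > 2 powr (k r)\<close>, and summing over all integers \<open>k\<close> gives a
  geometric series because of \<open>r q < p\<close>.

  The definition of \<open>m(\<phi>)\<close> is what makes both conditions on \<open>r\<close> compatible
  (\<open>growth_function_exponents\<close>): it says \<open>n q(\<phi>) / i(\<phi>) < n + m + 1\<close>.
\<close>


section \<open>Muckenhoupt weights and the maximal function\<close>

lemma ball_sets_lebesgue: "ball (c :: 'a::euclidean_space) r \<in> sets lebesgue"
  using lmeasurable_ball by (rule fmeasurableD)

lemma open_sets_lebesgue: "open (S :: 'a::euclidean_space set) \<Longrightarrow> S \<in> sets lebesgue"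
  by (intro sets_completionI_sets) (simp add: borel_open)

lemma indicator_ball_lebesgue [measurable, simp]:
  "(indicator (ball (c :: 'a::euclidean_space) r) :: 'a \<Rightarrow> ennreal) \<in> borel_measurable lebesgue"
  by (intro borel_measurable_indicator ball_sets_lebesgue)

text \<open>
  The testing form of the \<open>A\<^sub>q\<close> condition: an average of \<open>h\<close> above \<open>s\<close> forces the weight of the ball to
  be small compared with the integral of \<open>h\<^sup>q w\<close>.  It is Hoelder's inequality for
  \<open>h = (h w\<^sup>1\<^sup>/\<^sup>q) w\<^sup>-\<^sup>1\<^sup>/\<^sup>q\<close>, carried out as Young's inequality with an optimal parameter.
\<close>

lemma Aq_testing:
  fixes w :: "real^'n \<Rightarrow> real" and h :: "real^'n \<Rightarrow> real"
  assumes q: "q > 1" and w: "w \<in> borel_measurable lebesgue" "\<And>x. w x > 0"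
    and h: "h \<in> borel_measurable lebesgue" "\<And>x. h x \<ge> 0"
    and r: "r > 0" and s: "s > 0" and C: "C > 0"
    and Aq: "ennreal (measure lebesgue (ball c r) powr (- q)) * (\<integral>\<^sup>+x\<in>ball c r. ennreal (w x) \<partial>lebesgue) *
       ennreal_power (\<integral>\<^sup>+y\<in>ball c r. ennreal (w y powr (- (q / (q - 1) / q))) \<partial>lebesgue) (q / (q / (q - 1))) \<le> ennreal C"
    and big: "ennreal (s * measure lebesgue (ball c r)) < (\<integral>\<^sup>+y\<in>ball c r. ennreal (h y) \<partial>lebesgue)"
  shows "ennreal (s powr q) * (\<integral>\<^sup>+x\<in>ball c r. ennreal (w x) \<partial>lebesgue)
     \<le> ennreal C * (\<integral>\<^sup>+x\<in>ball c r. ennreal (h x powr q * w x) \<partial>lebesgue)"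
proof -
  let ?B = "ball c r"
  define m where "m = measure lebesgue ?B"
  define W where "W = (\<integral>\<^sup>+x\<in>?B. ennreal (w x) \<partial>lebesgue)"
  define X where "X = (\<integral>\<^sup>+y\<in>?B. ennreal (w y powr (- (1 / (q - 1)))) \<partial>lebesgue)"
  define Y where "Y = (\<integral>\<^sup>+x\<in>?B. ennreal (h x powr q * w x) \<partial>lebesgue)"
  have m0: "m > 0" using r by (simp add: m_def content_ball_pos)
  have pos: "(\<integral>\<^sup>+x\<in>?B. ennreal (v x) \<partial>lebesgue) \<noteq> 0"
    if v: "v \<in> borel_measurable lebesgue" "\<And>x. v x > 0" for v :: "real^'n \<Rightarrow> real"
  proof
    assume "(\<integral>\<^sup>+x\<in>?B. ennreal (v x) \<partial>lebesgue) = 0"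
    then have "AE x in lebesgue. ennreal (v x) * indicator ?B x = 0"
      using v(1) by (subst (asm) nn_integral_0_iff_AE) auto
    then have "AE x in lebesgue. x \<notin> ?B"
    proof eventually_elim
      case (elim x)
      then show ?case using v(2)[of x] by (auto simp: indicator_def split: if_splits)
    qed
    then have "emeasure lebesgue ?B = 0"
      by (subst (asm) AE_iff_measurable[of ?B]) auto
    then show False using m0 unfolding m_def by (simp add: measure_def)
  qed
  have e1: "q / (q - 1) / q = 1 / (q - 1)" and e2: "q / (q / (q - 1)) = q - 1" using q by auto
  have Aq': "ennreal (m powr (- q)) * W * ennreal_power X (q - 1) \<le> ennreal C"
    using Aq unfolding e1 e2 W_def X_def m_def .
  have W0: "W \<noteq> 0" unfolding W_def by (rule pos) (use w in auto)
  have X0: "X \<noteq> 0" unfolding X_def by (rule pos) (use w in \<open>auto simp: less_imp_neq[symmetric]\<close>)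
  have Xfin: "X \<noteq> \<infinity>"
  proof
    assume "X = \<infinity>"
    then have "ennreal (m powr (- q)) * W * ennreal_power X (q - 1) = \<infinity>"
      using W0 m0 by (auto simp: ennreal_power_def ennreal_mult_top ennreal_mult_eq_top_iff)
    then show False using Aq' by (auto simp: top_unique)
  qed
  define X' where "X' = enn2real X"
  have X': "X = ennreal X'" "X' > 0" using X0 Xfin unfolding X'_def
    by (auto simp: enn2real_positive_iff less_top zero_less_iff_neq_zero)
  show ?thesis
  proof (cases "Y = \<infinity>")
    case True
    then show ?thesis using C by (simp add: Y_def ennreal_mult_top)
  next
    case False
    define Y' where "Y' = enn2real Y"
    have Y': "Y = ennreal Y'" "Y' \<ge> 0" using False unfolding Y'_def by (auto simp: less_top)
    define b where "b = s * m"
    have b: "b > 0" using s m0 by (simp add: b_def)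
    define q' where "q' = q / (q - 1)"
    have q': "q' > 1" "1 / q + 1 / q' = 1" using q by (auto simp: q'_def field_simps)
    \<comment> \<open>this value makes the second term of Young's inequality equal to \<open>b / q'\<close>, which is then absorbed on the left\<close>
    define \<theta> where "\<theta> = (X' / b) powr (1 / q')"
    have th: "\<theta> > 0" using X' b by (simp add: \<theta>_def)
    have young: "h x \<le> (\<theta> powr q / q) * (h x powr q * w x) + (\<theta> powr (- q') / q') * w x powr (- (1 / (q - 1)))" for x
    proof -
      have eq: "h x = (\<theta> * h x * w x powr (1/q)) * (inverse \<theta> * w x powr (- (1 / q)))"
        using th w(2)[of x] by (simp add: powr_minus field_simps)
      have "(\<theta> * h x * w x powr (1/q)) * (inverse \<theta> * w x powr (- (1 / q)))
         \<le> (\<theta> * h x * w x powr (1/q)) powr q / q + (inverse \<theta> * w x powr (- (1 / q))) powr q' / q'"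
        using q q' th h(2)[of x] by (intro Youngs_inequality) auto
      also have "(\<theta> * h x * w x powr (1/q)) powr q = \<theta> powr q * (h x powr q * w x)"
        using th h(2)[of x] w(2)[of x] q by (simp add: powr_mult powr_powr)
      also have "(inverse \<theta> * w x powr (- (1 / q))) powr q' = \<theta> powr (- q') * w x powr (- (1 / (q - 1)))"
      proof -
        have "(inverse \<theta> * w x powr (- (1 / q))) powr q' = (\<theta> powr (- 1) * w x powr (- (1 / q))) powr q'"
          using th by (simp add: powr_minus)
        also have "\<dots> = \<theta> powr (- 1 * q') * w x powr (- (1 / q) * q')"
          using th by (subst powr_mult) (auto simp only: powr_powr powr_ge_zero)
        also have "- (1 / q) * q' = - (1 / (q - 1))" using q by (simp add: q'_def)
        finally show ?thesis by simp
      qed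
      finally show ?thesis using eq by simp
    qed
    have "ennreal b < (\<integral>\<^sup>+y\<in>?B. ennreal (h y) \<partial>lebesgue)" using big by (simp add: b_def m_def)
    also have "\<dots> \<le> (\<integral>\<^sup>+y. ennreal (\<theta> powr q / q) * (ennreal (h y powr q * w y) * indicator ?B y)
       + ennreal (\<theta> powr (- q') / q') * (ennreal (w y powr (- (1 / (q - 1)))) * indicator ?B y) \<partial>lebesgue)"
    proof (rule nn_integral_mono)
      fix x
      have "ennreal (h x) \<le> ennreal (\<theta> powr q / q) * ennreal (h x powr q * w x)
       + ennreal (\<theta> powr (- q') / q') * ennreal (w x powr (- (1 / (q - 1))))"
        using young[of x] q q' w(2)[of x]
        by (simp flip: ennreal_mult' ennreal_plus)
      then show "ennreal (h x) * indicator ?B x \<le> ennreal (\<theta> powr q / q) * (ennreal (h x powr q * w x) * indicator ?B x)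
       + ennreal (\<theta> powr (- q') / q') * (ennreal (w x powr (- (1 / (q - 1)))) * indicator ?B x)"
        by (auto simp: indicator_def)
    qed
    also have "\<dots> = ennreal (\<theta> powr q / q) * Y + ennreal (\<theta> powr (- q') / q') * X"
      unfolding X_def Y_def using w h by (subst nn_integral_add) (auto simp: nn_integral_cmult)
    also have "\<dots> = ennreal (\<theta> powr q / q * Y' + \<theta> powr (- q') / q' * X')"
      using X' Y' q q' by (simp flip: ennreal_mult' ennreal_plus)
    finally have "b < \<theta> powr q / q * Y' + \<theta> powr (- q') / q' * X'"
      using b by (simp add: ennreal_less_iff)
    also have "\<theta> powr (- q') = b / X'"
      using X' b q' by (simp add: \<theta>_def powr_powr powr_minus)
    also have "\<theta> powr q = (X' / b) powr (q - 1)"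
      using q by (simp add: \<theta>_def powr_powr q'_def)
    finally have "b < (X' / b) powr (q - 1) / q * Y' + b / q'" using X' by simp
    then have "b * (1 - 1 / q') < (X' / b) powr (q - 1) / q * Y'" by (simp add: algebra_simps)
    moreover have "1 - 1 / q' = 1 / q" using q'(2) by linarith
    ultimately have "b < (X' / b) powr (q - 1) * Y'" using q by (simp add: field_simps)
    then have "b * b powr (q - 1) \<le> X' powr (q - 1) * Y'"
      using b X' by (simp add: powr_divide field_simps)
    moreover have "b * b powr (q - 1) = b powr q" using b by (simp add: powr_diff)
    ultimately have main: "b powr q \<le> X' powr (q - 1) * Y'" by simp
    have "ennreal (s powr q) * W = ennreal (b powr q) * (ennreal (m powr (- q)) * W)"
    proof -
      have "s powr q = b powr q * m powr (- q)" using s m0 by (simp add: b_def powr_mult powr_minus)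
      then have "ennreal (s powr q) = ennreal (b powr q) * ennreal (m powr (- q))" by (simp flip: ennreal_mult')
      then show ?thesis by (simp add: mult.assoc)
    qed
    also have "\<dots> \<le> ennreal (X' powr (q - 1) * Y') * (ennreal (m powr (- q)) * W)"
      using main by (intro mult_right_mono ennreal_leI) auto
    also have "\<dots> = (ennreal (m powr (- q)) * W * ennreal_power X (q - 1)) * Y"
      using X' Y' by (simp add: ennreal_power_def ennreal_mult' mult_ac)
    also have "\<dots> \<le> ennreal C * Y" by (intro mult_right_mono Aq') auto
    finally show ?thesis by (simp add: W_def Y_def)
  qed
qed

text \<open>
  For \<open>q = 1\<close> the essential supremum gives \<open>1 \<le> E w\<close> almost everywhere on the ball, which takes the
  place of Hoelder's inequality.
\<close>

lemma A1_testing: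
  fixes w :: "real^'n \<Rightarrow> real" and h :: "real^'n \<Rightarrow> real"
  assumes w: "w \<in> borel_measurable lebesgue" "\<And>x. w x > 0"
    and h: "h \<in> borel_measurable lebesgue" "\<And>x. h x \<ge> 0"
    and r: "r > 0" and s: "s > 0" and C: "C > 0"
    and Aq: "ennreal (measure lebesgue (ball c r) powr (- 1)) * (\<integral>\<^sup>+x\<in>ball c r. ennreal (w x) \<partial>lebesgue) *
       esssup (restrict_space lebesgue (ball c r)) (\<lambda>y. inverse (ennreal (w y))) \<le> ennreal C"
    and big: "ennreal (s * measure lebesgue (ball c r)) < (\<integral>\<^sup>+y\<in>ball c r. ennreal (h y) \<partial>lebesgue)"
  shows "ennreal s * (\<integral>\<^sup>+x\<in>ball c r. ennreal (w x) \<partial>lebesgue)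
     \<le> ennreal C * (\<integral>\<^sup>+x\<in>ball c r. ennreal (h x * w x) \<partial>lebesgue)"
proof -
  let ?B = "ball c r"
  define m where "m = measure lebesgue ?B"
  define W where "W = (\<integral>\<^sup>+x\<in>?B. ennreal (w x) \<partial>lebesgue)"
  define E where "E = esssup (restrict_space lebesgue ?B) (\<lambda>y. inverse (ennreal (w y)))"
  define Y where "Y = (\<integral>\<^sup>+x\<in>?B. ennreal (h x * w x) \<partial>lebesgue)"
  have m0: "m > 0" using r by (simp add: m_def content_ball_pos)
  have "AE x in restrict_space lebesgue ?B. inverse (ennreal (w x)) \<le> E"
    unfolding E_def by (rule esssup_AE)
  then have "AE x in lebesgue. x \<in> ?B \<longrightarrow> inverse (ennreal (w x)) \<le> E"
    by (subst (asm) AE_restrict_space_iff) auto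
  then have "AE x in lebesgue. ennreal (h x) * indicator ?B x \<le> E * (ennreal (h x * w x) * indicator ?B x)"
  proof eventually_elim
    case (elim x)
    show ?case
    proof (cases "x \<in> ?B")
      case True
      have "1 = inverse (ennreal (w x)) * ennreal (w x)"
        using w(2)[of x] by (simp add: inverse_ennreal flip: ennreal_mult')
      also have "\<dots> \<le> E * ennreal (w x)" using elim True by (intro mult_right_mono) auto
      finally have "ennreal (h x) * 1 \<le> ennreal (h x) * (E * ennreal (w x))" by (intro mult_left_mono) auto
      then show ?thesis using True h(2)[of x] by (simp add: ennreal_mult' mult_ac)
    qed auto
  qed
  then have "(\<integral>\<^sup>+y\<in>?B. ennreal (h y) \<partial>lebesgue) \<le> (\<integral>\<^sup>+x. E * (ennreal (h x * w x) * indicator ?B x) \<partial>lebesgue)"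
    by (rule nn_integral_mono_AE)
  also have "\<dots> = E * Y" unfolding Y_def using w h by (subst nn_integral_cmult) auto
  finally have le: "ennreal (s * m) \<le> E * Y" using big by (simp add: m_def)
  have "ennreal s * W = ennreal (s * m) * (ennreal (m powr (- 1)) * W)"
  proof -
    have "s = (s * m) * m powr (- 1)" using m0 by (simp add: powr_minus field_simps)
    then have "ennreal s = ennreal (s * m) * ennreal (m powr (- 1))"
      using s m0 by (simp flip: ennreal_mult')
    then show ?thesis by (simp add: mult.assoc)
  qed
  also have "\<dots> \<le> (E * Y) * (ennreal (m powr (- 1)) * W)" using le by (intro mult_right_mono) auto
  also have "\<dots> = (ennreal (m powr (- 1)) * W * E) * Y" by (simp add: mult_ac)
  also have "\<dots> \<le> ennreal C * Y" using Aq by (intro mult_right_mono) (auto simp: m_def W_def E_def)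
  finally show ?thesis by (simp add: W_def Y_def)
qed

text \<open>
  The form in which the Muckenhoupt condition enters the covering argument.  It treats \<open>q = 1\<close> and
  \<open>q > 1\<close> alike and avoids powers of possibly infinite integrals.
\<close>

definition ball_testing :: "real \<Rightarrow> real \<Rightarrow> (real^'n \<Rightarrow> real) \<Rightarrow> bool" where
  "ball_testing q C w \<longleftrightarrow>
     (\<forall>c r s h. 0 < r \<and> 0 < s \<and> h \<in> borel_measurable lebesgue \<and> (\<forall>x. 0 \<le> h x) \<and>
        ennreal (s * measure lebesgue (ball c r)) < (\<integral>\<^sup>+y\<in>ball c r. ennreal (h y) \<partial>lebesgue) \<longrightarrow>
        ennreal (s powr q) * (\<integral>\<^sup>+x\<in>ball c r. ennreal (w x) \<partial>lebesgue)
          \<le> ennreal C * (\<integral>\<^sup>+x\<in>ball c r. ennreal (h x powr q * w x) \<partial>lebesgue))"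

lemma muckenhoupt_ball_testing:
  fixes \<phi> :: "real^'n \<Rightarrow> real \<Rightarrow> real"
  assumes mu: "muckenhoupt q \<phi>"
    and pos: "\<And>x t. t > 0 \<Longrightarrow> \<phi> x t > 0"
    and meas: "\<And>t. t > 0 \<Longrightarrow> (\<lambda>x. \<phi> x t) \<in> borel_measurable lebesgue"
  shows "\<exists>C>0. \<forall>t>0. ball_testing q C (\<lambda>x. \<phi> x t)"
proof -
  define S where "S = (SUP t\<in>{0<..}. SUP c. SUP r\<in>{0<..}. Aq_constant q \<phi> t c r)"
  have S: "S < \<infinity>" and q: "q \<ge> 1" using mu by (auto simp: muckenhoupt_def S_def)
  define C where "C = enn2real S + 1"
  have C: "C > 0" "S \<le> ennreal C" using S by (auto simp: C_def less_top add_nonneg_pos intro!: order_trans[OF _ ennreal_leI[of "enn2real S"]])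
  have bound: "Aq_constant q \<phi> t c r \<le> ennreal C" if "t > 0" "r > 0" for t c r
  proof -
    have "Aq_constant q \<phi> t c r \<le> (SUP r\<in>{0<..}. Aq_constant q \<phi> t c r)" using that by (intro SUP_upper) auto
    also have "\<dots> \<le> (SUP c. SUP r\<in>{0<..}. Aq_constant q \<phi> t c r)" by (rule SUP_upper) auto
    also have "\<dots> \<le> S" unfolding S_def using that by (intro SUP_upper[of t]) auto
    finally show ?thesis using C by order
  qed
  have "ball_testing q C (\<lambda>x. \<phi> x t)" if t: "t > 0" for t
    unfolding ball_testing_def
  proof (intro allI impI, elim conjE)
    fix c :: "real^'n" and r s :: real and h :: "real^'n \<Rightarrow> real"
    assume a: "0 < r" "0 < s" "h \<in> borel_measurable lebesgue" "\<forall>x. 0 \<le> h x"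
      and big: "ennreal (s * measure lebesgue (ball c r)) < (\<integral>\<^sup>+y\<in>ball c r. ennreal (h y) \<partial>lebesgue)"
    show "ennreal (s powr q) * (\<integral>\<^sup>+x\<in>ball c r. ennreal (\<phi> x t) \<partial>lebesgue)
          \<le> ennreal C * (\<integral>\<^sup>+x\<in>ball c r. ennreal (h x powr q * \<phi> x t) \<partial>lebesgue)"
    proof (cases "q = 1")
      case True
      have "ennreal s * (\<integral>\<^sup>+x\<in>ball c r. ennreal (\<phi> x t) \<partial>lebesgue)
        \<le> ennreal C * (\<integral>\<^sup>+x\<in>ball c r. ennreal (h x * \<phi> x t) \<partial>lebesgue)"
        using bound[OF t a(1), of c] True pos[OF t] meas[OF t] a C(1) big
        by (intro A1_testing) (auto simp: Aq_constant_def Let_def)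
      then show ?thesis using True a by simp
    next
      case False
      then show ?thesis
        using bound[OF t a(1), of c] q pos[OF t] meas[OF t] a C(1) big
        by (intro Aq_testing) (auto simp: Aq_constant_def Let_def)
    qed
  qed
  then show ?thesis using C(1) by blast
qed


text \<open>
  The uncentred maximal function over open balls: its superlevel sets are unions of open balls, hence
  open.
\<close>

definition maximal_function :: "('a::euclidean_space \<Rightarrow> ennreal) \<Rightarrow> 'a \<Rightarrow> ennreal" where
  "maximal_function U x =
     (SUP (c, r)\<in>{(c, r). x \<in> ball c r}.
        (\<integral>\<^sup>+y\<in>ball c r. U y \<partial>lborel) / ennreal (measure lborel (ball c r)))"

lemma ennreal_less_divide_iff:
  assumes "0 \<le> s" "0 < m"
  shows "ennreal s < I / ennreal m \<longleftrightarrow> ennreal (s * m) < I"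
proof (cases I)
  case (real i)
  then show ?thesis using assms by (simp add: divide_ennreal ennreal_less_iff pos_less_divide_eq)
next
  case top
  then show ?thesis using assms by (simp add: ennreal_top_divide)
qed

lemma less_maximal_function_iff:
  fixes x :: "'a::euclidean_space"
  assumes "0 \<le> s"
  shows "ennreal s < maximal_function U x \<longleftrightarrow>
    (\<exists>c r. x \<in> ball c r \<and> ennreal (s * measure lborel (ball c r)) < (\<integral>\<^sup>+y\<in>ball c r. U y \<partial>lborel))"
proof -
  have "ennreal s < (\<integral>\<^sup>+y\<in>ball c r. U y \<partial>lborel) / ennreal (measure lborel (ball c r)) \<longleftrightarrow>
     ennreal (s * measure lborel (ball c r)) < (\<integral>\<^sup>+y\<in>ball c r. U y \<partial>lborel)" if "x \<in> ball c r" for c r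
  proof -
    have "0 < r" using that by (metis ball_eq_empty empty_iff not_less)
    then show ?thesis using assms by (intro ennreal_less_divide_iff) (auto simp: content_ball_pos)
  qed
  note eq = this
  show ?thesis unfolding maximal_function_def less_SUP_iff
  proof
    assume "\<exists>i\<in>{(c, r). x \<in> ball c r}. ennreal s < (case i of (c, r) \<Rightarrow>
        (\<integral>\<^sup>+y\<in>ball c r. U y \<partial>lborel) / ennreal (measure lborel (ball c r)))"
    then obtain c r where cr: "x \<in> ball c r"
        "ennreal s < (\<integral>\<^sup>+y\<in>ball c r. U y \<partial>lborel) / ennreal (measure lborel (ball c r))"
      by (auto simp del: mem_ball)
    show "\<exists>c r. x \<in> ball c r \<and> ennreal (s * measure lborel (ball c r)) < (\<integral>\<^sup>+y\<in>ball c r. U y \<partial>lborel)"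
      by (rule exI[of _ c], rule exI[of _ r], rule conjI) (use cr eq[of c r] in simp_all)
  next
    assume "\<exists>c r. x \<in> ball c r \<and> ennreal (s * measure lborel (ball c r)) < (\<integral>\<^sup>+y\<in>ball c r. U y \<partial>lborel)"
    then obtain c r where cr: "x \<in> ball c r"
        "ennreal (s * measure lborel (ball c r)) < (\<integral>\<^sup>+y\<in>ball c r. U y \<partial>lborel)"
      by (elim exE conjE)
    show "\<exists>i\<in>{(c, r). x \<in> ball c r}. ennreal s < (case i of (c, r) \<Rightarrow>
        (\<integral>\<^sup>+y\<in>ball c r. U y \<partial>lborel) / ennreal (measure lborel (ball c r)))"
      by (rule bexI[of _ "(c, r)"]) (use cr eq[of c r] in simp_all)
  qed
qed

lemma open_less_maximal_function:
  assumes "0 \<le> s"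
  shows "open {x :: 'a::euclidean_space. ennreal s < maximal_function U x}"
proof -
  have "{x. ennreal s < maximal_function U x} =
    (\<Union>c. \<Union>r\<in>{r. ennreal (s * measure lborel (ball c r)) < (\<integral>\<^sup>+y\<in>ball c r. U y \<partial>lborel)}. ball c r)"
    unfolding less_maximal_function_iff[OF assms] by (simp add: set_eq_iff conj_commute)
  then show ?thesis by (simp add: open_UN)
qed

lemma integral_ball_le_maximal_function:
  assumes "x \<in> ball c r" "maximal_function U x \<le> ennreal M" "0 \<le> M"
  shows "(\<integral>\<^sup>+y\<in>ball c r. U y \<partial>lborel) \<le> ennreal (M * measure lborel (ball c r))"
  using assms less_maximal_function_iff[of M U x] by (meson leD not_le)

lemma measure_ball_5:
  fixes c :: "'a::euclidean_space"
  shows "0 < r \<Longrightarrow> measure lebesgue (ball c (5 * r)) = 5 ^ DIM('a) * measure lebesgue (ball c r)"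
  by (simp add: content_ball_conv_unit_ball[of "5 * r" c] content_ball_conv_unit_ball[of r c] power_mult_distrib)

text \<open>
  The balls on which the average of \<open>h\<close> exceeds \<open>s\<close> cover the superlevel set.  A Vitali selection gives
  disjoint balls whose fivefold enlargements still cover.  The testing inequality is applied on the
  enlarged ball to \<open>h\<close> cut off to the original ball, which includes the doubling property of \<open>w\<close>.  The selection requires bounded radii; the general case follows by monotone
  convergence.
\<close>

lemma maximal_function_weak_type:
  fixes w h :: "real^'n \<Rightarrow> real"
  assumes test: "ball_testing q C w" and C: "C > 0" and q: "q \<ge> 1" and s: "s > 0"
    and w: "w \<in> borel_measurable lebesgue" "\<And>x. w x \<ge> 0"
    and h: "h \<in> borel_measurable lebesgue" "\<And>x. h x \<ge> 0"
  shows "ennreal (s powr q) * (\<integral>\<^sup>+x\<in>{x. ennreal s < maximal_function (\<lambda>y. ennreal (h y)) x}. ennreal (w x) \<partial>lebesgue)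
    \<le> ennreal (C * (5 ^ CARD('n)) powr q) * (\<integral>\<^sup>+x. ennreal (h x powr q * w x) \<partial>lebesgue)"
proof -
  define D where "D = C * (5 ^ CARD('n)) powr q"
  have D: "D > 0" using C by (simp add: D_def)
  define K where "K R = {(c, r). 0 < r \<and> r \<le> R \<and>
      ennreal (s * measure lebesgue (ball c r)) < (\<integral>\<^sup>+y\<in>ball c r. ennreal (h y) \<partial>lebesgue)}" for R :: real
  define E where "E R = (\<Union>(c, r)\<in>K R. ball c r)" for R :: real
  define \<nu> where "\<nu> = density lebesgue (\<lambda>x. ennreal (h x powr q * w x))"
  have hw [measurable]: "(\<lambda>x. ennreal (h x powr q * w x)) \<in> borel_measurable lebesgue" using w h by measurable
  have wm [measurable]: "(\<lambda>x. ennreal (w x)) \<in> borel_measurable lebesgue" using w by measurable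
  have one: "ennreal (s powr q) * (\<integral>\<^sup>+x\<in>ball c (5 * r). ennreal (w x) \<partial>lebesgue) \<le> ennreal D * emeasure \<nu> (ball c r)"
    if "(c, r) \<in> K R" for c r R
  proof -
    have r: "r > 0" and big: "ennreal (s * measure lebesgue (ball c r)) < (\<integral>\<^sup>+y\<in>ball c r. ennreal (h y) \<partial>lebesgue)"
      using that by (auto simp: K_def)
    \<comment> \<open>the average over the ball of radius \<open>5 r\<close> of the cut-off function is \<open>1 / 5 ^ n\<close> of the average over the ball of radius \<open>r\<close>\<close>
    define s' where "s' = s / 5 ^ CARD('n)"
    define h' where "h' x = h x * indicator (ball c r) x" for x
    have ind: "(indicator (ball c r) :: real^'n \<Rightarrow> real) \<in> borel_measurable lebesgue"
      by (intro borel_measurable_indicator ball_sets_lebesgue)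
    have h': "h' \<in> borel_measurable lebesgue" "\<And>x. h' x \<ge> 0"
      unfolding h'_def using h ind by (auto simp del: indicator_ball_lebesgue simp: times_ennreal_def intro!: borel_measurable_times)
    have sub: "ball c r \<subseteq> ball c (5 * r)" using r by auto
    have "s' * measure lebesgue (ball c (5 * r)) = s * measure lebesgue (ball c r)"
      using measure_ball_5[OF r, of c] by (simp add: s'_def)
    moreover have "(\<integral>\<^sup>+y\<in>ball c r. ennreal (h y) \<partial>lebesgue) \<le> (\<integral>\<^sup>+y\<in>ball c (5 * r). ennreal (h' y) \<partial>lebesgue)"
      using sub by (intro nn_integral_mono) (auto simp: h'_def indicator_def)
    ultimately have "ennreal (s' * measure lebesgue (ball c (5 * r))) < (\<integral>\<^sup>+y\<in>ball c (5 * r). ennreal (h' y) \<partial>lebesgue)"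
      using big by simp
    then have "ennreal (s' powr q) * (\<integral>\<^sup>+x\<in>ball c (5 * r). ennreal (w x) \<partial>lebesgue)
          \<le> ennreal C * (\<integral>\<^sup>+x\<in>ball c (5 * r). ennreal (h' x powr q * w x) \<partial>lebesgue)"
      using test h' r s unfolding ball_testing_def by (auto simp: s'_def)
    also have "(\<integral>\<^sup>+x\<in>ball c (5 * r). ennreal (h' x powr q * w x) \<partial>lebesgue) = (\<integral>\<^sup>+x\<in>ball c r. ennreal (h x powr q * w x) \<partial>lebesgue)"
      using sub q by (intro nn_integral_cong) (auto simp: h'_def indicator_def)
    also have "\<dots> = emeasure \<nu> (ball c r)"
      unfolding \<nu>_def by (subst emeasure_density) (auto simp: ball_sets_lebesgue)
    finally have "ennreal ((5 ^ CARD('n)) powr q) * (ennreal (s' powr q) * (\<integral>\<^sup>+x\<in>ball c (5 * r). ennreal (w x) \<partial>lebesgue))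
        \<le> ennreal ((5 ^ CARD('n)) powr q) * (ennreal C * emeasure \<nu> (ball c r))"
      by (rule mult_left_mono) auto
    moreover have "ennreal ((5 ^ CARD('n)) powr q) * ennreal (s' powr q) = ennreal (s powr q)"
      using s by (simp add: s'_def powr_divide flip: ennreal_mult')
    ultimately have "ennreal (s powr q) * (\<integral>\<^sup>+x\<in>ball c (5 * r). ennreal (w x) \<partial>lebesgue)
        \<le> ennreal ((5 ^ CARD('n)) powr q) * (ennreal C * emeasure \<nu> (ball c r))"
      by (simp add: mult.assoc[symmetric])
    then show ?thesis using C by (simp add: D_def ennreal_mult mult_ac)
  qed
  have ER: "ennreal (s powr q) * (\<integral>\<^sup>+x\<in>E R. ennreal (w x) \<partial>lebesgue) \<le> ennreal D * (\<integral>\<^sup>+x. ennreal (h x powr q * w x) \<partial>lebesgue)" for R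
  proof -
    have radii: "\<And>i. i \<in> K R \<Longrightarrow> 0 < snd i \<and> snd i \<le> R" by (auto simp: K_def)
    obtain S where S: "countable S" "S \<subseteq> K R"
        "pairwise (\<lambda>i j. disjnt (cball (fst i) (snd i)) (cball (fst j) (snd j))) S"
        "\<And>i. i \<in> K R \<Longrightarrow> \<exists>j. j \<in> S \<and> \<not> disjnt (cball (fst i) (snd i)) (cball (fst j) (snd j)) \<and>
                        cball (fst i) (snd i) \<subseteq> ball (fst j) (5 * snd j)"
      by (rule Vitali_covering_lemma_cballs_balls[OF radii, where a = fst and K = "K R"]; (assumption | rule that)?)
    let ?I = "count_space S"
    have cover: "E R \<subseteq> (\<Union>i\<in>S. ball (fst i) (5 * snd i))"
    proof
      fix x assume "x \<in> E R"
      then obtain c r where cr: "(c, r) \<in> K R" "x \<in> ball c r" by (auto simp: E_def)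
      obtain j where "j \<in> S" "cball c r \<subseteq> ball (fst j) (5 * snd j)" using S(4)[OF cr(1)] by auto
      then have "j \<in> S" "x \<in> ball (fst j) (5 * snd j)" using cr(2) ball_subset_cball by blast+
      then show "x \<in> (\<Union>i\<in>S. ball (fst i) (5 * snd i))" by blast
    qed
    have "(\<integral>\<^sup>+x\<in>E R. ennreal (w x) \<partial>lebesgue) \<le>
       (\<integral>\<^sup>+x. (\<integral>\<^sup>+i. ennreal (w x) * indicator (ball (fst i) (5 * snd i)) x \<partial>?I) \<partial>lebesgue)"
    proof (rule nn_integral_mono)
      fix x
      show "ennreal (w x) * indicator (E R) x \<le> (\<integral>\<^sup>+i. ennreal (w x) * indicator (ball (fst i) (5 * snd i)) x \<partial>?I)"
      proof (cases "x \<in> E R")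
        case True
        then obtain i where i: "i \<in> S" "x \<in> ball (fst i) (5 * snd i)" using cover by auto
        have "ennreal (w x) * indicator (ball (fst i) (5 * snd i)) x \<le> (\<integral>\<^sup>+i. ennreal (w x) * indicator (ball (fst i) (5 * snd i)) x \<partial>?I)"
          using i(1) by (rule nn_integral_ge_point)
        then show ?thesis using i True by simp
      qed simp
    qed
    also have "\<dots> = (\<integral>\<^sup>+i. (\<integral>\<^sup>+x\<in>ball (fst i) (5 * snd i). ennreal (w x) \<partial>lebesgue) \<partial>?I)"
      by (rule nn_integral_count_space_nn_integral) (use S(1) in auto)
    finally have "ennreal (s powr q) * (\<integral>\<^sup>+x\<in>E R. ennreal (w x) \<partial>lebesgue) \<le>
      (\<integral>\<^sup>+i. ennreal (s powr q) * (\<integral>\<^sup>+x\<in>ball (fst i) (5 * snd i). ennreal (w x) \<partial>lebesgue) \<partial>?I)"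
      by (subst nn_integral_cmult) (auto intro: mult_left_mono)
    also have "\<dots> \<le> (\<integral>\<^sup>+i. ennreal D * emeasure \<nu> (ball (fst i) (snd i)) \<partial>?I)"
      using S(2) by (intro nn_integral_mono one[of _ _ R]) auto
    also have "\<dots> = ennreal D * (\<integral>\<^sup>+i. emeasure \<nu> (ball (fst i) (snd i)) \<partial>?I)"
      by (rule nn_integral_cmult) auto
    also have "(\<integral>\<^sup>+i. emeasure \<nu> (ball (fst i) (snd i)) \<partial>?I) = emeasure \<nu> (\<Union>i\<in>S. ball (fst i) (snd i))"
    proof (rule emeasure_UN_countable[symmetric])
      show "disjoint_family_on (\<lambda>i. ball (fst i) (snd i)) S"
        using S(3) unfolding disjoint_family_on_def pairwise_def disjnt_def
        by (meson ball_subset_cball disjoint_iff subset_iff)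
    qed (use S(1) in \<open>auto simp: \<nu>_def ball_sets_lebesgue\<close>)
    also have "\<dots> \<le> emeasure \<nu> UNIV"
      using emeasure_space[of \<nu>] by (auto simp: \<nu>_def)
    also have "emeasure \<nu> UNIV = (\<integral>\<^sup>+x. ennreal (h x powr q * w x) \<partial>lebesgue)"
      unfolding \<nu>_def using emeasure_density[OF hw, of UNIV] by simp
    finally show ?thesis by (simp add: mult_left_mono)
  qed
  have EU: "{x. ennreal s < maximal_function (\<lambda>y. ennreal (h y)) x} = (\<Union>i::nat. E (real i))"
  proof -
    have "x \<in> ball c r \<Longrightarrow> 0 < r" for x c :: "real^'n" and r
      by (metis ball_eq_empty empty_iff not_less)
    moreover have "\<exists>i::nat. r \<le> real i" for r by (rule real_arch_simple)
    ultimately show ?thesis using s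
      by (auto simp: less_maximal_function_iff E_def K_def nn_integral_completion) blast+
  qed
  have mE: "E R \<in> sets lebesgue" for R
    by (rule open_sets_lebesgue) (auto simp: E_def)
  have inc: "incseq (\<lambda>i::nat. E (real i))"
    by (rule incseq_SucI) (fastforce simp: E_def K_def)
  define \<mu> where "\<mu> = density lebesgue (\<lambda>x. ennreal (w x))"
  have mu: "emeasure \<mu> A = (\<integral>\<^sup>+x\<in>A. ennreal (w x) \<partial>lebesgue)" if "A \<in> sets lebesgue" for A
    unfolding \<mu>_def by (rule emeasure_density) (use that in auto)
  have "emeasure \<mu> (\<Union>i::nat. E (real i)) = (SUP i. emeasure \<mu> (E (real i)))"
    by (rule SUP_emeasure_incseq[symmetric]) (use mE inc in \<open>auto simp: \<mu>_def\<close>)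
  then have "ennreal (s powr q) * emeasure \<mu> (\<Union>i::nat. E (real i)) = (SUP i. ennreal (s powr q) * emeasure \<mu> (E (real i)))"
    by (simp add: SUP_mult_left_ennreal)
  also have "\<dots> \<le> ennreal D * (\<integral>\<^sup>+x. ennreal (h x powr q * w x) \<partial>lebesgue)"
    using ER by (intro SUP_least) (simp add: mu mE)
  finally show ?thesis unfolding EU D_def using mE by (subst (asm) mu) auto
qed


text \<open>
  The lower integral is a supremum over simple functions, and these are rescaled one by one.  This covers
  the modular, whose integrand may be nonmeasurable.
\<close>

lemma nn_integral_cmult_le:
  assumes c: "c > 0"
  shows "(\<integral>\<^sup>+x. ennreal c * f x \<partial>M) \<le> ennreal c * (\<integral>\<^sup>+x. f x \<partial>M)"
proof -
  have inv: "ennreal (1 / c) * ennreal c = 1" using c by (simp flip: ennreal_mult')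
  have "(\<integral>\<^sup>+x. ennreal c * f x \<partial>M) = (SUP g \<in> {g. simple_function M g \<and> g \<le> (\<lambda>x. ennreal c * f x)}. integral\<^sup>S M g)"
    by (simp add: nn_integral_def)
  also have "\<dots> \<le> ennreal c * (\<integral>\<^sup>+x. f x \<partial>M)"
  proof (rule SUP_least, clarify)
    fix g assume g: "simple_function M g" "g \<le> (\<lambda>x. ennreal c * f x)"
    then have gm: "g \<in> borel_measurable M" by (simp add: borel_measurable_simple_function)
    have "integral\<^sup>S M g = (\<integral>\<^sup>+x. g x \<partial>M)" using g(1) by (simp add: nn_integral_eq_simple_integral)
    also have "\<dots> = (ennreal c * ennreal (1 / c)) * (\<integral>\<^sup>+x. g x \<partial>M)" using inv by (simp add: mult.commute)
    also have "\<dots> = ennreal c * (\<integral>\<^sup>+x. ennreal (1 / c) * g x \<partial>M)"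
      using gm by (subst nn_integral_cmult) (auto simp: mult_ac)
    also have "\<dots> \<le> ennreal c * (\<integral>\<^sup>+x. f x \<partial>M)"
    proof (intro mult_left_mono nn_integral_mono)
      fix x
      have "ennreal (1 / c) * g x \<le> ennreal (1 / c) * (ennreal c * f x)"
        using g(2) by (intro mult_left_mono) (auto simp: le_fun_def)
      also have "\<dots> = f x" using inv by (simp add: mult.assoc[symmetric])
      finally show "ennreal (1 / c) * g x \<le> f x" .
    qed simp
    finally show "integral\<^sup>S M g \<le> ennreal c * (\<integral>\<^sup>+x. f x \<partial>M)" .
  qed
  finally show ?thesis .
qed

lemma dyadic_geometric_sum_le:
  assumes A: "A > 0" and e: "e > 0"
  shows "(\<integral>\<^sup>+k. ennreal (if 2 powr real_of_int k < A then (2 powr real_of_int k / A) powr e else 0) \<partial>count_space UNIV)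
    \<le> ennreal (1 / (1 - 2 powr (- e)))"
proof -
  define k0 where "k0 = \<lceil>log 2 A\<rceil> - 1"
  have iff: "2 powr real_of_int k < A \<longleftrightarrow> k \<in> {..k0}" for k
  proof -
    have "2 powr real_of_int k < A \<longleftrightarrow> real_of_int k < log 2 A" using A by (simp add: less_log_iff)
    then show ?thesis unfolding k0_def by (simp add: less_ceiling_iff flip: zle_diff1_eq) linarith
  qed
  let ?f = "\<lambda>k::int. ennreal ((2 powr real_of_int k / A) powr e)"
  have "(\<integral>\<^sup>+k. ennreal (if 2 powr real_of_int k < A then (2 powr real_of_int k / A) powr e else 0) \<partial>count_space UNIV)
    = (\<integral>\<^sup>+k. ?f k * indicator {..k0} k \<partial>count_space UNIV)"
    by (intro nn_integral_cong) (auto simp: iff indicator_def)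
  also have "\<dots> = (\<integral>\<^sup>+k. ?f k \<partial>count_space {..k0})"
    by (simp add: nn_integral_count_space_indicator)
  also have "\<dots> = (\<integral>\<^sup>+i. ?f (k0 - int i) \<partial>count_space UNIV)"
  proof (rule nn_integral_bij_count_space[symmetric])
    show "bij_betw (\<lambda>i. k0 - int i) UNIV {..k0}"
    proof (rule bij_betwI[where g = "\<lambda>k. nat (k0 - k)"]) qed auto
  qed
  also have "\<dots> = (\<Sum>i. ?f (k0 - int i))" by (rule nn_integral_count_space_nat)
  also have "\<dots> \<le> (\<Sum>i. ennreal ((2 powr (- e)) ^ i))"
  proof (intro suminf_le)
    fix i
    have "2 powr real_of_int k0 < A" using iff[of k0] by simp
    have "(2 powr real_of_int (k0 - int i) / A) powr e = ((2 powr real_of_int k0 / A) * 2 powr (- real i)) powr e"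
      by (simp add: powr_diff powr_minus field_simps)
    also have "\<dots> \<le> (1 * 2 powr (- real i)) powr e"
      using \<open>2 powr real_of_int k0 < A\<close> A e by (intro powr_mono2 mult_right_mono) auto
    also have "\<dots> = (2 powr (- e)) ^ i" by (simp add: powr_powr powr_realpow[symmetric] mult_ac)
    finally show "?f (k0 - int i) \<le> ennreal ((2 powr (- e)) ^ i)" by (rule ennreal_leI)
  qed auto
  also have "\<dots> = ennreal (1 / (1 - 2 powr (- e)))"
    using e by (subst suminf_ennreal_eq[OF _ geometric_sums]) (auto simp: powr_less_one)
  finally show ?thesis .
qed

definition extended_value :: "(real \<Rightarrow> real) \<Rightarrow> ennreal \<Rightarrow> ennreal" where
  "extended_value \<Phi> a = (if a = \<infinity> then \<infinity> else ennreal (\<Phi> (enn2real a)))"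

lemma musielak_modular_eq: "musielak_modular \<phi> g = (\<integral>\<^sup>+x. extended_value (\<phi> x) (g x) \<partial>lebesgue)"
  by (simp add: musielak_modular_def extended_value_def)

text \<open>
  A value \<open>a \<le> C3 M powr (1/r)\<close> is compared with a sum over all dyadic levels below \<open>M\<close>; one term, for the
  largest such level, already suffices.  The sum form has the advantage that it is measurable in \<open>x\<close>
  later, and that it is infinite when \<open>M\<close> is.
\<close>

lemma level_sum_ge:
  fixes M :: ennreal
  assumes orl: "orlicz_function \<Phi>" and r: "r > 0" and C2: "C2 > 0" and C3: "C3 \<ge> 1"
    and up: "\<And>t s. t \<ge> 0 \<Longrightarrow> s \<ge> 1 \<Longrightarrow> \<Phi> (s * t) \<le> C2 * s * \<Phi> t"
    and G: "\<And>m. 0 \<le> m \<Longrightarrow> M \<le> ennreal m \<Longrightarrow> a \<le> ennreal (C3 * m powr (1 / r))"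
  shows "extended_value \<Phi> a \<le>
    (\<integral>\<^sup>+k. (if ennreal (2 powr (real_of_int k * r)) < M then ennreal (2 * C2 * C3 * \<Phi> (2 powr real_of_int k)) else 0) \<partial>count_space UNIV)"
    (is "_ \<le> ?R")
proof (cases M)
  case top
  have mono: "mono_on {0..} \<Phi>" and pos: "\<And>t. t > 0 \<Longrightarrow> \<Phi> t > 0" using orl by (auto simp: orlicz_function_def)
  let ?c = "ennreal (2 * C2 * C3 * \<Phi> 1)"
  have "?c \<noteq> 0" using C2 C3 pos[of 1] by auto
  have "infinite {0::int..}" using infinite_Ici by blast
  then have "\<infinity> = ?c * emeasure (count_space UNIV) {0::int..}"
    using \<open>?c \<noteq> 0\<close> by (simp add: ennreal_mult_top)
  also have "\<dots> = (\<integral>\<^sup>+k. ?c * indicator {0::int..} k \<partial>count_space UNIV)" by (simp add: nn_integral_cmult_indicator)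
  also have "\<dots> \<le> ?R"
  proof (intro nn_integral_mono)
    fix k :: int
    have "\<Phi> 1 \<le> \<Phi> (2 powr real_of_int k)" if "k \<ge> 0"
      using that by (intro mono_onD[OF mono]) (auto intro: ge_one_powr_ge_zero)
    then show "?c * indicator {0..} k \<le> (if ennreal (2 powr (real_of_int k * r)) < M then ennreal (2 * C2 * C3 * \<Phi> (2 powr real_of_int k)) else 0)"
      using top C2 C3 by (auto simp: indicator_def intro!: ennreal_leI mult_left_mono)
  qed
  finally show ?thesis by (simp add: top_unique)
next
  case (real m)
  have mono: "mono_on {0..} \<Phi>" and pos: "\<And>t. t > 0 \<Longrightarrow> \<Phi> t > 0" and z: "\<Phi> 0 = 0" using orl by (auto simp: orlicz_function_def)
  have a: "a \<le> ennreal (C3 * m powr (1 / r))" using G real by auto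
  have afin: "a \<noteq> \<infinity>" using a by (auto simp: top_unique)
  show ?thesis
  proof (cases "m = 0")
    case True
    then have "a = 0" using a by simp
    then show ?thesis by (simp add: extended_value_def z)
  next
    case False
    then have m: "m > 0" using real by simp
    define k where "k = \<lceil>log 2 m / r\<rceil> - 1"
    have k: "real_of_int k * r < log 2 m" "log 2 m \<le> (real_of_int k + 1) * r"
    proof -
      have "real_of_int k < log 2 m / r" "log 2 m / r \<le> real_of_int k + 1" unfolding k_def by linarith+
      then show "real_of_int k * r < log 2 m" "log 2 m \<le> (real_of_int k + 1) * r" using r by (simp_all add: field_simps)
    qed
    have lt: "2 powr (real_of_int k * r) < m" using k(1) m by (simp add: less_log_iff)
    have "m \<le> 2 powr ((real_of_int k + 1) * r)" using k(2) m by (simp add: log_le_iff)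
    then have "m powr (1 / r) \<le> (2 powr ((real_of_int k + 1) * r)) powr (1 / r)" using m r by (intro powr_mono2) auto
    also have "\<dots> = 2 * 2 powr real_of_int k" using r by (simp add: powr_powr powr_add)
    finally have "C3 * m powr (1 / r) \<le> C3 * (2 * 2 powr real_of_int k)" using C3 by (intro mult_left_mono) auto
    then have "a \<le> ennreal (2 * C3 * 2 powr real_of_int k)" using a by (auto intro: order_trans ennreal_leI simp: mult_ac)
    then have "enn2real a \<le> 2 * C3 * 2 powr real_of_int k" using C3 by (intro enn2real_leI) auto
    then have "\<Phi> (enn2real a) \<le> \<Phi> (2 * C3 * 2 powr real_of_int k)" using C3 by (intro mono_onD[OF mono]) auto
    also have "\<dots> \<le> C2 * (2 * C3) * \<Phi> (2 powr real_of_int k)" using C3 by (intro up) auto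
    finally have "extended_value \<Phi> a \<le> (if ennreal (2 powr (real_of_int k * r)) < M then ennreal (2 * C2 * C3 * \<Phi> (2 powr real_of_int k)) else 0)"
      using lt real afin by (auto simp: extended_value_def ennreal_less_iff mult_ac intro!: ennreal_leI)
    also have "\<dots> \<le> ?R" by (rule nn_integral_ge_point) simp
    finally show ?thesis .
  qed
qed

text \<open>
  The terms are at most a constant times \<open>\<Phi> T\<close> times powers of \<open>2 ^ k / (2 powr (1/r) T)\<close> with exponent \<open>p - r q > 0\<close>, and only
  levels \<open>2 ^ k < 2 powr (1/r) T\<close> contribute.  So the series is geometric.
\<close>

lemma level_sum_le:
  assumes orl: "orlicz_function \<Phi>" and C1: "C1 > 0" and C2: "C2 > 0" and r: "r > 0" and q: "q \<ge> 1" and p: "r * q < p"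
    and lo: "\<And>t s. t \<ge> 0 \<Longrightarrow> s \<in> {0..1} \<Longrightarrow> \<Phi> (s * t) \<le> C1 * s powr p * \<Phi> t"
    and up: "\<And>t s. t \<ge> 0 \<Longrightarrow> s \<ge> 1 \<Longrightarrow> \<Phi> (s * t) \<le> C2 * s * \<Phi> t"
    and T: "T \<ge> 0"
  shows "(\<integral>\<^sup>+k. ennreal ((2 powr (real_of_int k * r) / 2) powr (- q) *
        ((if 2 powr (real_of_int k * r) / 2 < T powr r then T powr r else 0) powr q * \<Phi> (2 powr real_of_int k))) \<partial>count_space UNIV)
     \<le> ennreal (C1 * C2 * 2 powr (1 / r) / (1 - 2 powr (- (p - r * q)))) * ennreal (\<Phi> T)"
proof (cases "T = 0")
  case True
  then show ?thesis by simp
next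
  case False
  then have T: "T > 0" using T by simp
  have pos: "\<And>t. t > 0 \<Longrightarrow> \<Phi> t > 0" using orl by (auto simp: orlicz_function_def)
  define a where "a = 2 powr (1 / r)"
  define e where "e = p - r * q"
  have a: "a \<ge> 1" "a powr r = 2" using r by (auto simp: a_def powr_powr ge_one_powr_ge_zero)
  have e: "e > 0" using p by (simp add: e_def)
  define K where "K = C1 * C2 * a * \<Phi> T"
  have K: "K \<ge> 0" using C1 C2 a pos[OF T] by (simp add: K_def)
  have tm: "(2 powr (real_of_int k * r) / 2) powr (- q) *
        ((if 2 powr (real_of_int k * r) / 2 < T powr r then T powr r else 0) powr q * \<Phi> (2 powr real_of_int k))
      \<le> K * (if 2 powr real_of_int k < a * T then (2 powr real_of_int k / (a * T)) powr e else 0)" for k :: int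
  proof -
    define b where "b = 2 powr real_of_int k"
    have b: "b > 0" "2 powr (real_of_int k * r) = b powr r" by (auto simp: b_def powr_powr)
    have "b powr r / 2 < T powr r \<longleftrightarrow> b powr r < (a * T) powr r" using a T by (simp add: powr_mult field_simps)
    also have "\<dots> \<longleftrightarrow> b < a * T" using b a T r powr_less_mono2[of r b "a * T"] powr_mono2[of r "a * T" b] by fastforce
    finally have iff: "b powr r / 2 < T powr r \<longleftrightarrow> b < a * T" .
    show ?thesis
    proof (cases "b < a * T")
      case True
      have "\<Phi> b = \<Phi> ((b / (a * T)) * (a * T))" using a T by simp
      also have "\<dots> \<le> C1 * (b / (a * T)) powr p * \<Phi> (a * T)"
        using a T True b by (intro lo) auto
      also have "\<dots> \<le> C1 * (b / (a * T)) powr p * (C2 * a * \<Phi> T)"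
        using C1 a T by (intro mult_left_mono up) auto
      finally have Phi: "\<Phi> b \<le> K * (b / (a * T)) powr p" by (simp add: K_def mult_ac)
      have "(b powr r / 2) powr (- q) * (T powr r) powr q = (b / (a * T)) powr (- (r * q))"
      proof -
        have "(b / (a * T)) powr (- (r * q)) = ((b / (a * T)) powr r) powr (- q)" by (simp add: powr_powr)
        also have "(b / (a * T)) powr r = b powr r / 2 / T powr r" using a T b by (simp add: powr_divide powr_mult)
        also have "(b powr r / 2 / T powr r) powr (- q) = (b powr r / 2) powr (- q) / (T powr r) powr (- q)"
          using b T by (simp add: powr_divide powr_mult)
        also have "\<dots> = (b powr r / 2) powr (- q) * (T powr r) powr q" by (simp add: powr_minus_divide)
        finally show ?thesis by simp
      qed
      then have "(b powr r / 2) powr (- q) * ((T powr r) powr q * \<Phi> b) = (b / (a * T)) powr (- (r * q)) * \<Phi> b"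
        by (simp add: mult.assoc[symmetric])
      also have "\<dots> \<le> (b / (a * T)) powr (- (r * q)) * (K * (b / (a * T)) powr p)"
        by (intro mult_left_mono Phi) auto
      also have "\<dots> = K * (b / (a * T)) powr e" by (simp add: e_def powr_add[symmetric] mult_ac)
      finally show ?thesis using True iff by (simp add: b flip: b_def)
    next
      case False
      then show ?thesis using iff by (simp add: b flip: b_def)
    qed
  qed
  have "(\<integral>\<^sup>+k. ennreal ((2 powr (real_of_int k * r) / 2) powr (- q) *
        ((if 2 powr (real_of_int k * r) / 2 < T powr r then T powr r else 0) powr q * \<Phi> (2 powr real_of_int k))) \<partial>count_space UNIV)
     \<le> (\<integral>\<^sup>+k. ennreal K * ennreal (if 2 powr real_of_int k < a * T then (2 powr real_of_int k / (a * T)) powr e else 0) \<partial>count_space UNIV)"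
    using tm K by (intro nn_integral_mono) (simp flip: ennreal_mult' add: ennreal_leI)
  also have "\<dots> = ennreal K * (\<integral>\<^sup>+k. ennreal (if 2 powr real_of_int k < a * T then (2 powr real_of_int k / (a * T)) powr e else 0) \<partial>count_space UNIV)"
    by (rule nn_integral_cmult) auto
  also have "\<dots> \<le> ennreal K * ennreal (1 / (1 - 2 powr (- e)))"
    using a T e by (intro mult_left_mono dyadic_geometric_sum_le) auto
  also have "\<dots> = ennreal (K * (1 / (1 - 2 powr (- e))))" using K by (intro ennreal_mult'[symmetric])
  also have "K * (1 / (1 - 2 powr (- e))) = (C1 * C2 * 2 powr (1 / r) / (1 - 2 powr (- (p - r * q)))) * \<Phi> T"
    by (simp add: K_def e_def a_def)
  also have "ennreal \<dots> = ennreal (C1 * C2 * 2 powr (1 / r) / (1 - 2 powr (- (p - r * q)))) * ennreal (\<Phi> T)"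
    using pos[OF T] by (intro ennreal_mult'') simp
  finally show ?thesis .
qed


text \<open>
  An interpolation argument in which the weight changes with the level.  With \<open>U = g\<^sup>r\<close>, the part of
  \<open>U\<close> below \<open>2 powr (k r) / 2\<close> cannot make \<open>M U\<close> exceed \<open>2 powr (k r)\<close>.  So the weak type inequality for the
  weight \<open>\<phi>(\<cdot>, 2 ^ k)\<close> is applied to the remaining part \<open>h k\<close>, and the sum over \<open>k\<close> is evaluated pointwise
  after exchanging it with the integral.  Both \<open>x \<mapsto> \<phi>(x, G x)\<close> and \<open>x \<mapsto> \<phi>(x, g x)\<close> may be
  nonmeasurable; all integrals in between have measurable integrands.
\<close>

lemma musielak_modular_le_of_maximal:
  fixes \<phi> :: "real^'n \<Rightarrow> real \<Rightarrow> real"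
  assumes gr: "growth_function \<phi>" and low: "uniformly_lower_type p \<phi>" and mu: "muckenhoupt q \<phi>"
    and r: "r > 0" and rq: "r * q < p" and C3: "C3 \<ge> 1"
  shows "\<exists>C>0. \<forall>g G. g \<in> borel_measurable lebesgue \<longrightarrow>
     (\<forall>x M. 0 \<le> M \<longrightarrow> maximal_function (\<lambda>y. ennreal (enn2real (g y) powr r)) x \<le> ennreal M \<longrightarrow>
        G x \<le> ennreal (C3 * M powr (1 / r))) \<longrightarrow>
     musielak_modular \<phi> G \<le> ennreal C * musielak_modular \<phi> g"
proof -
  have orl: "orlicz_function (\<phi> x)" for x using gr by (auto simp: growth_function_def)
  have meas: "(\<lambda>x. \<phi> x t) \<in> borel_measurable lebesgue" if "t \<ge> 0" for t
    using gr that by (auto simp: growth_function_def)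
  have pos: "\<phi> x t > 0" if "t > 0" for x t using orl[of x] that by (auto simp: orlicz_function_def)
  have q: "q \<ge> 1" using mu by (simp add: muckenhoupt_def)
  obtain C1 where C1: "C1 > 0" "\<And>x t s. t \<ge> 0 \<Longrightarrow> s \<in> {0..1} \<Longrightarrow> \<phi> x (s * t) \<le> C1 * s powr p * \<phi> x t"
    using low by (auto simp: uniformly_lower_type_def)
  obtain C2 where C2: "C2 > 0" "\<And>x t s. t \<ge> 0 \<Longrightarrow> s \<ge> 1 \<Longrightarrow> \<phi> x (s * t) \<le> C2 * s * \<phi> x t"
  proof -
    obtain C where "C > 0" "\<forall>x. \<forall>t\<ge>0. \<forall>s\<ge>1. \<phi> x (s * t) \<le> C * s powr 1 * \<phi> x t"
      using gr by (auto simp: growth_function_def uniformly_upper_type_def)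
    then show ?thesis by (intro that[of C]) auto
  qed
  obtain C4 where C4: "C4 > 0" "\<And>t. t > 0 \<Longrightarrow> ball_testing q C4 (\<lambda>x. \<phi> x t)"
    using muckenhoupt_ball_testing[OF mu pos meas] by auto
  define D where "D = C4 * (5 ^ CARD('n)) powr q"
  define K where "K = C1 * C2 * 2 powr (1 / r) / (1 - 2 powr (- (p - r * q)))"
  define C where "C = 2 * C2 * C3 * D * K"
  have D: "D > 0" using C4 by (simp add: D_def)
  have K: "K > 0" using C1 C2 rq by (simp add: K_def powr_less_one)
  have C: "C > 0" using C2 C3 D K by (simp add: C_def)
  have "musielak_modular \<phi> G \<le> ennreal C * musielak_modular \<phi> g"
    if g: "g \<in> borel_measurable lebesgue"
      and G: "\<And>x M. 0 \<le> M \<Longrightarrow> maximal_function (\<lambda>y. ennreal (enn2real (g y) powr r)) x \<le> ennreal M \<Longrightarrow>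
        G x \<le> ennreal (C3 * M powr (1 / r))" for g G
  proof -
    define U where "U y = enn2real (g y) powr r" for y
    define MU where "MU = maximal_function (\<lambda>y. ennreal (U y))"
    define e where "e k = 2 powr (real_of_int k * r)" for k :: int
    define h where "h k y = (if e k / 2 < U y then U y else 0)" for k y
    define t where "t k = 2 powr real_of_int k" for k :: int
    have e: "e k > 0" and t: "t k > 0" for k by (auto simp: e_def t_def)
    have mt [measurable]: "(\<lambda>x. \<phi> x (t k)) \<in> borel_measurable lebesgue" for k
      using meas[of "t k"] t[of k] by simp
    have Um: "U \<in> borel_measurable lebesgue" unfolding U_def using g by measurable
    have hm: "h k \<in> borel_measurable lebesgue" for k unfolding h_def using Um by measurable
    have h0: "h k x \<ge> 0" for k x by (auto simp: h_def U_def)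
    have op: "{x. ennreal (e k) < MU x} \<in> sets lebesgue" for k
      unfolding MU_def using e[of k] by (intro open_sets_lebesgue open_less_maximal_function) auto
    have weak: "(\<integral>\<^sup>+x\<in>{x. ennreal (e k) < MU x}. ennreal (\<phi> x (t k)) \<partial>lebesgue)
       \<le> (\<integral>\<^sup>+x. ennreal (D * (e k / 2) powr (- q)) * ennreal (h k x powr q * \<phi> x (t k)) \<partial>lebesgue)" for k
    proof -
      let ?s = "e k / 2"
      have sub: "{x. ennreal (e k) < MU x} \<subseteq> {x. ennreal ?s < maximal_function (\<lambda>y. ennreal (h k y)) x}"
      proof clarify
        fix x assume "ennreal (e k) < MU x"
        then obtain c \<rho> where x: "x \<in> ball c \<rho>" and big: "ennreal (e k * measure lborel (ball c \<rho>)) < (\<integral>\<^sup>+y\<in>ball c \<rho>. ennreal (U y) \<partial>lborel)"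
          using e[of k] unfolding MU_def by (subst (asm) less_maximal_function_iff) auto
        let ?m = "measure lborel (ball c \<rho>)"
        have em: "emeasure lborel (ball c \<rho>) = ennreal ?m"
          using emeasure_lborel_ball_finite[of c \<rho>] by (intro emeasure_eq_ennreal_measure) auto
        have "\<not> (\<integral>\<^sup>+y\<in>ball c \<rho>. ennreal (h k y) \<partial>lborel) \<le> ennreal (?s * ?m)"
        proof
          assume le: "(\<integral>\<^sup>+y\<in>ball c \<rho>. ennreal (h k y) \<partial>lborel) \<le> ennreal (?s * ?m)"
          have "(\<integral>\<^sup>+y\<in>ball c \<rho>. ennreal (U y) \<partial>lborel) = (\<integral>\<^sup>+y\<in>ball c \<rho>. ennreal (U y) \<partial>lebesgue)"
            by (simp add: nn_integral_completion)
          also have "\<dots> \<le> (\<integral>\<^sup>+y. ennreal (h k y) * indicator (ball c \<rho>) y + ennreal ?s * indicator (ball c \<rho>) y \<partial>lebesgue)"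
            using e[of k] by (intro nn_integral_mono) (auto simp: h_def indicator_def intro!: ennreal_leI)
          also have "\<dots> = (\<integral>\<^sup>+y\<in>ball c \<rho>. ennreal (h k y) \<partial>lebesgue) + (\<integral>\<^sup>+y. ennreal ?s * indicator (ball c \<rho>) y \<partial>lebesgue)"
            using hm[of k] by (intro nn_integral_add) auto
          also have "(\<integral>\<^sup>+y. ennreal ?s * indicator (ball c \<rho>) y \<partial>lebesgue) = ennreal ?s * ennreal ?m"
            by (subst nn_integral_cmult_indicator) (auto simp: ball_sets_lebesgue em)
          also have "(\<integral>\<^sup>+y\<in>ball c \<rho>. ennreal (h k y) \<partial>lebesgue) = (\<integral>\<^sup>+y\<in>ball c \<rho>. ennreal (h k y) \<partial>lborel)"
            by (simp add: nn_integral_completion)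
          also have "\<dots> + ennreal ?s * ennreal ?m \<le> ennreal (?s * ?m) + ennreal ?s * ennreal ?m"
            using le by (rule add_right_mono)
          also have "\<dots> = ennreal (e k * ?m)" using e[of k] by (simp flip: ennreal_mult' ennreal_plus)
          finally show False using big by simp
        qed
        then show "ennreal ?s < maximal_function (\<lambda>y. ennreal (h k y)) x"
          using x e[of k]
          by (subst less_maximal_function_iff) (auto simp del: mem_ball intro!: exI[of _ c] exI[of _ \<rho>])
      qed
      have "ennreal (?s powr q) * (\<integral>\<^sup>+x\<in>{x. ennreal (e k) < MU x}. ennreal (\<phi> x (t k)) \<partial>lebesgue)
         \<le> ennreal (?s powr q) * (\<integral>\<^sup>+x\<in>{x. ennreal ?s < maximal_function (\<lambda>y. ennreal (h k y)) x}. ennreal (\<phi> x (t k)) \<partial>lebesgue)"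
        using sub by (intro mult_left_mono nn_integral_mono) (auto simp: indicator_def)
      also have "\<dots> \<le> ennreal D * (\<integral>\<^sup>+x. ennreal (h k x powr q * \<phi> x (t k)) \<partial>lebesgue)"
        unfolding D_def using C4 q e[of k] t[of k] hm h0 meas[of "t k"] pos[OF t[of k]]
        by (intro maximal_function_weak_type) (auto intro: less_imp_le)
      finally have "ennreal (?s powr (- q)) * (ennreal (?s powr q) * (\<integral>\<^sup>+x\<in>{x. ennreal (e k) < MU x}. ennreal (\<phi> x (t k)) \<partial>lebesgue))
         \<le> ennreal (?s powr (- q)) * (ennreal D * (\<integral>\<^sup>+x. ennreal (h k x powr q * \<phi> x (t k)) \<partial>lebesgue))"
        by (rule mult_left_mono) simp
      also have "\<dots> = (\<integral>\<^sup>+x. ennreal (D * ?s powr (- q)) * ennreal (h k x powr q * \<phi> x (t k)) \<partial>lebesgue)"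
        using D hm[of k] meas[of "t k"] t[of k] by (subst nn_integral_cmult) (auto simp: ennreal_mult' mult_ac)
      also have "ennreal (?s powr (- q)) * (ennreal (?s powr q) * (\<integral>\<^sup>+x\<in>{x. ennreal (e k) < MU x}. ennreal (\<phi> x (t k)) \<partial>lebesgue))
         = (\<integral>\<^sup>+x\<in>{x. ennreal (e k) < MU x}. ennreal (\<phi> x (t k)) \<partial>lebesgue)"
      proof -
        have "ennreal (?s powr (- q)) * ennreal (?s powr q) = 1"
          using e[of k] by (simp add: powr_minus flip: ennreal_mult')
        then show ?thesis by (simp add: mult.assoc[symmetric])
      qed
      finally show ?thesis .
    qed
    have "musielak_modular \<phi> G \<le> (\<integral>\<^sup>+x. (\<integral>\<^sup>+k. ennreal (2 * C2 * C3) * (ennreal (\<phi> x (t k)) * indicator {x. ennreal (e k) < MU x} x) \<partial>count_space UNIV) \<partial>lebesgue)"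
      unfolding musielak_modular_eq
    proof (rule nn_integral_mono)
      fix x
      have "extended_value (\<phi> x) (G x) \<le>
        (\<integral>\<^sup>+k. (if ennreal (2 powr (real_of_int k * r)) < MU x then ennreal (2 * C2 * C3 * \<phi> x (2 powr real_of_int k)) else 0) \<partial>count_space UNIV)"
        by (rule level_sum_ge[OF orl r C2(1) C3]) (use C2 G in \<open>auto simp: MU_def U_def\<close>)
      also have "\<dots> = (\<integral>\<^sup>+k. ennreal (2 * C2 * C3) * (ennreal (\<phi> x (t k)) * indicator {x. ennreal (e k) < MU x} x) \<partial>count_space UNIV)"
        using C2 C3 by (intro nn_integral_cong) (auto simp: e_def t_def ennreal_mult')
      finally show "extended_value (\<phi> x) (G x) \<le> \<dots>" .
    qed
    also have "\<dots> = (\<integral>\<^sup>+k. (\<integral>\<^sup>+x. ennreal (2 * C2 * C3) * (ennreal (\<phi> x (t k)) * indicator {x. ennreal (e k) < MU x} x) \<partial>lebesgue) \<partial>count_space UNIV)"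
      using mt op by (intro nn_integral_count_space_nn_integral) (auto intro!: borel_measurable_times_ennreal borel_measurable_indicator less_imp_le)
    also have "\<dots> = (\<integral>\<^sup>+k. ennreal (2 * C2 * C3) * (\<integral>\<^sup>+x\<in>{x. ennreal (e k) < MU x}. ennreal (\<phi> x (t k)) \<partial>lebesgue) \<partial>count_space UNIV)"
      using mt op by (intro nn_integral_cong nn_integral_cmult) (auto intro!: borel_measurable_times_ennreal borel_measurable_indicator less_imp_le)
    also have "\<dots> \<le> (\<integral>\<^sup>+k. ennreal (2 * C2 * C3) * (\<integral>\<^sup>+x. ennreal (D * (e k / 2) powr (- q)) * ennreal (h k x powr q * \<phi> x (t k)) \<partial>lebesgue) \<partial>count_space UNIV)"
      by (intro nn_integral_mono mult_left_mono weak) auto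
    also have "\<dots> = (\<integral>\<^sup>+k. (\<integral>\<^sup>+x. ennreal (2 * C2 * C3 * D) * ennreal ((e k / 2) powr (- q) * (h k x powr q * \<phi> x (t k))) \<partial>lebesgue) \<partial>count_space UNIV)"
    proof (rule nn_integral_cong)
      fix k
      show "ennreal (2 * C2 * C3) * (\<integral>\<^sup>+x. ennreal (D * (e k / 2) powr (- q)) * ennreal (h k x powr q * \<phi> x (t k)) \<partial>lebesgue)
        = (\<integral>\<^sup>+x. ennreal (2 * C2 * C3 * D) * ennreal ((e k / 2) powr (- q) * (h k x powr q * \<phi> x (t k))) \<partial>lebesgue)"
      proof -
        have "ennreal (2 * C2 * C3) * (ennreal (D * a) * ennreal b) = ennreal (2 * C2 * C3 * D) * ennreal (a * b)" if "a \<ge> 0" for a b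
        proof -
          have "ennreal (2 * C2 * C3) * ennreal (D * a) = ennreal (2 * C2 * C3 * D * a)"
            using C2(1) C3 by (simp add: mult.assoc flip: ennreal_mult')
          also have "\<dots> = ennreal (2 * C2 * C3 * D) * ennreal a"
            using that by (rule ennreal_mult'')
          finally show ?thesis using that by (simp add: mult.assoc[symmetric] ennreal_mult')
        qed
        then show ?thesis using hm[of k] mt[of k] by (subst nn_integral_cmult[symmetric]) (auto simp: e_def)
      qed
    qed
    also have "\<dots> = (\<integral>\<^sup>+x. (\<integral>\<^sup>+k. ennreal (2 * C2 * C3 * D) * ennreal ((e k / 2) powr (- q) * (h k x powr q * \<phi> x (t k))) \<partial>count_space UNIV) \<partial>lebesgue)"
      using hm mt by (intro nn_integral_count_space_nn_integral[symmetric]) (auto intro!: less_imp_le)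
    also have "\<dots> \<le> (\<integral>\<^sup>+x. ennreal C * extended_value (\<phi> x) (g x) \<partial>lebesgue)"
    proof (rule nn_integral_mono)
      fix x
      let ?T = "enn2real (g x)"
      have "(\<integral>\<^sup>+k. ennreal (2 * C2 * C3 * D) * ennreal ((e k / 2) powr (- q) * (h k x powr q * \<phi> x (t k))) \<partial>count_space UNIV)
        = ennreal (2 * C2 * C3 * D) * (\<integral>\<^sup>+k. ennreal ((e k / 2) powr (- q) * (h k x powr q * \<phi> x (t k))) \<partial>count_space UNIV)"
        by (rule nn_integral_cmult) auto
      also have "\<dots> \<le> ennreal (2 * C2 * C3 * D) * (ennreal K * ennreal (\<phi> x ?T))"
        unfolding K_def e_def h_def t_def U_def
        by (intro mult_left_mono level_sum_le[OF orl C1(1) C2(1) r q rq C1(2) C2(2)]) auto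
      also have "\<dots> = ennreal C * ennreal (\<phi> x ?T)" using C2 C3 D K by (simp add: C_def ennreal_mult' mult.assoc)
      also have "\<dots> \<le> ennreal C * extended_value (\<phi> x) (g x)"
        by (intro mult_left_mono) (auto simp: extended_value_def)
      finally show "(\<integral>\<^sup>+k. ennreal (2 * C2 * C3 * D) * ennreal ((e k / 2) powr (- q) * (h k x powr q * \<phi> x (t k))) \<partial>count_space UNIV)
        \<le> ennreal C * extended_value (\<phi> x) (g x)" .
    qed
    also have "\<dots> \<le> ennreal C * musielak_modular \<phi> g"
      unfolding musielak_modular_eq using C by (rule nn_integral_cmult_le)
    finally show ?thesis .
  qed
  then show ?thesis using C by blast
qed


section \<open>Iterated partial derivatives\<close>

lemma has_derivative_partial_deriv:
  fixes \<psi> :: "real^'n \<Rightarrow> complex"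
  assumes "\<psi> differentiable (at x)"
  shows "(\<psi> has_derivative (\<lambda>h. \<Sum>i\<in>UNIV. (h $ i) *\<^sub>R partial_deriv i \<psi> x)) (at x)"
proof -
  obtain D where D: "(\<psi> has_derivative D) (at x)" using assms by (auto simp: differentiable_def)
  then have lin: "linear D" by (simp add: has_derivative_linear)
  have pd: "partial_deriv i \<psi> x = D (axis i 1)" for i
  proof -
    have "((\<lambda>h::real. x + h *\<^sub>R axis i 1) has_derivative (\<lambda>h. h *\<^sub>R axis i 1)) (at 0)"
      by (auto intro!: derivative_eq_intros)
    then have "((\<lambda>h. \<psi> (x + h *\<^sub>R axis i 1)) has_derivative (\<lambda>h. D (h *\<^sub>R axis i 1))) (at 0)"
      by (rule has_derivative_compose) (use D in simp)
    then have "((\<lambda>h. \<psi> (x + h *\<^sub>R axis i 1)) has_vector_derivative D (axis i 1)) (at 0)"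
      unfolding has_vector_derivative_def by (simp add: linear_scale[OF lin])
    then show ?thesis unfolding partial_deriv_def by (rule vector_derivative_at)
  qed
  have "D h = (\<Sum>i\<in>UNIV. (h $ i) *\<^sub>R partial_deriv i \<psi> x)" for h
  proof -
    have "D h = D (\<Sum>i\<in>UNIV. (h $ i) *\<^sub>R axis i 1)" using basis_expansion[of h] by (simp add: scalar_mult_eq_scaleR)
    then show ?thesis by (simp add: linear_sum[OF lin] linear_scale[OF lin] pd)
  qed
  then show ?thesis using D by presburger
qed

lemma partial_deriv_eqI:
  fixes \<psi> :: "real^'n \<Rightarrow> complex"
  assumes "(\<psi> has_derivative (\<lambda>h. \<Sum>i\<in>UNIV. (h $ i) *\<^sub>R c i)) (at x)"
  shows "partial_deriv i \<psi> x = c i"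
proof -
  have "((\<lambda>h::real. x + h *\<^sub>R axis i 1) has_derivative (\<lambda>h. h *\<^sub>R axis i 1)) (at 0)"
    by (auto intro!: derivative_eq_intros)
  then have "((\<lambda>h. \<psi> (x + h *\<^sub>R axis i 1)) has_derivative (\<lambda>h. \<Sum>j\<in>UNIV. ((h *\<^sub>R axis i 1 :: real^'n) $ j) *\<^sub>R c j)) (at 0)"
    by (rule has_derivative_compose) (use assms in simp)
  moreover have "(\<Sum>j\<in>UNIV. ((h *\<^sub>R axis i 1 :: real^'n) $ j) *\<^sub>R c j) = h *\<^sub>R c i" for h
    by (subst sum.remove[of _ i]) (auto simp: axis_def intro!: sum.neutral)
  ultimately have "((\<lambda>h. \<psi> (x + h *\<^sub>R axis i 1)) has_vector_derivative c i) (at 0)"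
    unfolding has_vector_derivative_def by simp
  then show ?thesis unfolding partial_deriv_def by (rule vector_derivative_at)
qed

lemma smooth_differentiable: "smooth \<psi> \<Longrightarrow> \<psi> differentiable (at x)"
  unfolding smooth_def by (drule spec[of _ "[]"]) (simp add: differentiable_on_def)

lemma smooth_has_derivative:
  "smooth \<psi> \<Longrightarrow> (\<psi> has_derivative (\<lambda>h. \<Sum>i\<in>UNIV. (h $ i) *\<^sub>R partial_deriv i \<psi> x)) (at x)"
  by (intro has_derivative_partial_deriv smooth_differentiable)

lemma smooth_partial_deriv: "smooth \<psi> \<Longrightarrow> smooth (partial_deriv i \<psi>)"
  unfolding smooth_def
proof
  fix "is" assume a: "\<forall>is. foldr partial_deriv is \<psi> differentiable_on UNIV"
  show "foldr partial_deriv is (partial_deriv i \<psi>) differentiable_on UNIV"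
    using a[rule_format, of "is @ [i]"] by simp
qed

lemma smooth_foldr: "smooth \<psi> \<Longrightarrow> smooth (foldr partial_deriv is \<psi>)"
  by (induction "is") (auto intro: smooth_partial_deriv)

lemma smooth_continuous_on: "smooth \<psi> \<Longrightarrow> continuous_on S \<psi>"
  by (meson continuous_at_imp_continuous_on differentiable_imp_continuous_within smooth_differentiable)

text \<open>
  Smoothness is the largest class of differentiable functions that is closed under partial derivatives.
\<close>

lemma smooth_coinduct:
  assumes P: "P \<psi>" and d: "\<And>\<psi> x. P \<psi> \<Longrightarrow> \<psi> differentiable (at x)"
    and p: "\<And>\<psi> i. P \<psi> \<Longrightarrow> P (partial_deriv i \<psi>)"
  shows "smooth \<psi>"
proof -
  have "P (foldr partial_deriv is \<psi>)" for "is" by (induction "is") (auto intro: P p)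
  then show ?thesis unfolding smooth_def differentiable_on_def using d by auto
qed

lemma partial_deriv_affine:
  fixes \<psi> :: "real^'n \<Rightarrow> complex"
  assumes "smooth \<psi>"
  shows "partial_deriv i (\<lambda>z. a * \<psi> (x + c *\<^sub>R z)) = (\<lambda>z. (a * of_real c) * partial_deriv i \<psi> (x + c *\<^sub>R z))"
    and "(\<lambda>z. a * \<psi> (x + c *\<^sub>R z)) differentiable (at z)"
proof -
  have "((\<lambda>z. a * \<psi> (x + c *\<^sub>R z)) has_derivative
      (\<lambda>h. \<Sum>i\<in>UNIV. (h $ i) *\<^sub>R (a * of_real c * partial_deriv i \<psi> (x + c *\<^sub>R z)))) (at z)" for z
  proof -
    have "((\<lambda>z. x + c *\<^sub>R z) has_derivative (\<lambda>h. c *\<^sub>R h)) (at z)" by (auto intro!: derivative_eq_intros)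
    then have "((\<lambda>z. \<psi> (x + c *\<^sub>R z)) has_derivative (\<lambda>h. \<Sum>i\<in>UNIV. ((c *\<^sub>R h) $ i) *\<^sub>R partial_deriv i \<psi> (x + c *\<^sub>R z))) (at z)"
      by (rule has_derivative_compose) (rule smooth_has_derivative[OF assms])
    then have "((\<lambda>z. a * \<psi> (x + c *\<^sub>R z)) has_derivative (\<lambda>h. a * (\<Sum>i\<in>UNIV. ((c *\<^sub>R h) $ i) *\<^sub>R partial_deriv i \<psi> (x + c *\<^sub>R z)))) (at z)"
      by (rule has_derivative_mult_right)
    moreover have "a * (\<Sum>i\<in>UNIV. ((c *\<^sub>R h) $ i) *\<^sub>R partial_deriv i \<psi> (x + c *\<^sub>R z)) = (\<Sum>i\<in>UNIV. (h $ i) *\<^sub>R (a * of_real c * partial_deriv i \<psi> (x + c *\<^sub>R z)))" for h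
      by (simp add: sum_distrib_left scaleR_conv_of_real[where 'a = complex] mult_ac)
    ultimately show ?thesis by simp
  qed
  note D = this
  show "partial_deriv i (\<lambda>z. a * \<psi> (x + c *\<^sub>R z)) = (\<lambda>z. (a * of_real c) * partial_deriv i \<psi> (x + c *\<^sub>R z))"
    by (rule ext, rule partial_deriv_eqI[OF D])
  show "(\<lambda>z. a * \<psi> (x + c *\<^sub>R z)) differentiable (at z)"
    by (rule differentiableI[OF D])
qed

lemma smooth_affine:
  assumes "smooth \<psi>" shows "smooth (\<lambda>z. a * \<psi> (x + c *\<^sub>R z))"
proof (rule smooth_coinduct[where P = "\<lambda>\<eta>. \<exists>\<psi> a. smooth \<psi> \<and> \<eta> = (\<lambda>z. a * \<psi> (x + c *\<^sub>R z))"])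
  fix \<eta> z i assume "\<exists>\<psi> a. smooth \<psi> \<and> \<eta> = (\<lambda>z. a * \<psi> (x + c *\<^sub>R z))"
  then obtain \<psi> a where *: "smooth \<psi>" "\<eta> = (\<lambda>z. a * \<psi> (x + c *\<^sub>R z))" by blast
  show "\<eta> differentiable (at z)" unfolding * by (rule partial_deriv_affine(2)[OF *(1)])
  show "\<exists>\<psi> a. smooth \<psi> \<and> partial_deriv i \<eta> = (\<lambda>z. a * \<psi> (x + c *\<^sub>R z))"
    unfolding * partial_deriv_affine(1)[OF *(1)] using smooth_partial_deriv[OF *(1)] by blast
qed (use assms in blast)

lemma foldr_partial_deriv_affine:
  assumes "smooth \<psi>"
  shows "foldr partial_deriv is (\<lambda>z. a * \<psi> (x + c *\<^sub>R z)) =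
    (\<lambda>z. (a * of_real c ^ length is) * foldr partial_deriv is \<psi> (x + c *\<^sub>R z))"
proof (induction "is")
  case (Cons i "is")
  have "foldr partial_deriv (i # is) (\<lambda>z. a * \<psi> (x + c *\<^sub>R z)) =
      partial_deriv i (\<lambda>z. (a * of_real c ^ length is) * foldr partial_deriv is \<psi> (x + c *\<^sub>R z))"
    by (simp only: Cons.IH foldr.simps o_apply)
  also have "\<dots> = (\<lambda>z. (a * of_real c ^ length is * of_real c) * partial_deriv i (foldr partial_deriv is \<psi>) (x + c *\<^sub>R z))"
    by (rule partial_deriv_affine(1)[OF smooth_foldr[OF assms]])
  finally show ?case by (simp add: mult_ac)
qed simp

lemma partial_deriv_lincomb:
  fixes \<psi> :: "real^'n \<Rightarrow> complex"
  assumes "smooth \<psi>" "smooth \<eta>"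
  shows "partial_deriv i (\<lambda>z. a * \<psi> z + b * \<eta> z) = (\<lambda>z. a * partial_deriv i \<psi> z + b * partial_deriv i \<eta> z)"
    and "(\<lambda>z. a * \<psi> z + b * \<eta> z) differentiable (at z)"
proof -
  have "((\<lambda>z. a * \<psi> z + b * \<eta> z) has_derivative
      (\<lambda>h. \<Sum>i\<in>UNIV. (h $ i) *\<^sub>R (a * partial_deriv i \<psi> z + b * partial_deriv i \<eta> z))) (at z)" for z
  proof -
    have "((\<lambda>z. a * \<psi> z + b * \<eta> z) has_derivative
      (\<lambda>h. a * (\<Sum>i\<in>UNIV. (h $ i) *\<^sub>R partial_deriv i \<psi> z) + b * (\<Sum>i\<in>UNIV. (h $ i) *\<^sub>R partial_deriv i \<eta> z))) (at z)"
      by (intro has_derivative_add has_derivative_mult_right smooth_has_derivative assms)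
    moreover have "a * (\<Sum>i\<in>UNIV. (h $ i) *\<^sub>R partial_deriv i \<psi> z) + b * (\<Sum>i\<in>UNIV. (h $ i) *\<^sub>R partial_deriv i \<eta> z) =
       (\<Sum>i\<in>UNIV. (h $ i) *\<^sub>R (a * partial_deriv i \<psi> z + b * partial_deriv i \<eta> z))" for h
      by (simp add: sum_distrib_left scaleR_conv_of_real[where 'a = complex] algebra_simps sum.distrib)
    ultimately show ?thesis by simp
  qed
  note D = this
  show "partial_deriv i (\<lambda>z. a * \<psi> z + b * \<eta> z) = (\<lambda>z. a * partial_deriv i \<psi> z + b * partial_deriv i \<eta> z)"
    by (rule ext, rule partial_deriv_eqI[OF D])
  show "(\<lambda>z. a * \<psi> z + b * \<eta> z) differentiable (at z)"
    by (rule differentiableI[OF D])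
qed

lemma smooth_lincomb:
  assumes "smooth \<psi>" "smooth \<eta>" shows "smooth (\<lambda>z. a * \<psi> z + b * \<eta> z)"
proof (rule smooth_coinduct[where P = "\<lambda>\<theta>. \<exists>\<psi> \<eta>. smooth \<psi> \<and> smooth \<eta> \<and> \<theta> = (\<lambda>z. a * \<psi> z + b * \<eta> z)"])
  fix \<theta> z i assume "\<exists>\<psi> \<eta>. smooth \<psi> \<and> smooth \<eta> \<and> \<theta> = (\<lambda>z. a * \<psi> z + b * \<eta> z)"
  then obtain \<psi> \<eta> where *: "smooth \<psi>" "smooth \<eta>" "\<theta> = (\<lambda>z. a * \<psi> z + b * \<eta> z)" by blast
  show "\<theta> differentiable (at z)" unfolding * by (rule partial_deriv_lincomb(2)[OF *(1,2)])
  show "\<exists>\<psi> \<eta>. smooth \<psi> \<and> smooth \<eta> \<and> partial_deriv i \<theta> = (\<lambda>z. a * \<psi> z + b * \<eta> z)"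
    unfolding * partial_deriv_lincomb(1)[OF *(1,2)] using smooth_partial_deriv[OF *(1)] smooth_partial_deriv[OF *(2)] by blast
qed (use assms in blast)

lemma foldr_partial_deriv_lincomb:
  assumes "smooth \<psi>" "smooth \<eta>"
  shows "foldr partial_deriv is (\<lambda>z. a * \<psi> z + b * \<eta> z) =
    (\<lambda>z. a * foldr partial_deriv is \<psi> z + b * foldr partial_deriv is \<eta> z)"
  by (induction "is") (use assms in \<open>auto simp: partial_deriv_lincomb[OF smooth_foldr smooth_foldr]\<close>)

text \<open>
  The mean value inequality for a function with gradient \<open>c\<close>.  The gradient is kept abstract because the
  remainder of a Taylor expansion is treated in the same way.
\<close>

lemma gradient_diff_le:
  fixes f :: "real^'n \<Rightarrow> complex"
  assumes D: "\<And>y. (f has_derivative (\<lambda>h. \<Sum>i\<in>UNIV. (h $ i) *\<^sub>R c i y)) (at y)"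
    and B: "\<And>i y. y \<in> closed_segment x (x + v) \<Longrightarrow> norm (c i y) \<le> B"
  shows "norm (f (x + v) - f x) \<le> real CARD('n) * B * norm v"
proof -
  have "norm (f (x + v) - f x) \<le> norm v * (real CARD('n) * B)"
  proof (rule differentiable_bound_segment[where G = UNIV])
    fix t :: real assume t: "t \<in> {0..1}"
    have "x + t *\<^sub>R v \<in> closed_segment x (x + v)"
      using t unfolding closed_segment_def by (auto intro!: exI[of _ t] simp: algebra_simps)
    note B' = B[OF this]
    show "onorm (\<lambda>h. \<Sum>i\<in>UNIV. (h $ i) *\<^sub>R c i (x + t *\<^sub>R v)) \<le> real CARD('n) * B"
    proof (rule onorm_le)
      fix h :: "real^'n"
      have "norm (\<Sum>i\<in>UNIV. (h $ i) *\<^sub>R c i (x + t *\<^sub>R v)) \<le> (\<Sum>i\<in>(UNIV::'n set). norm h * B)"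
      proof (rule order_trans[OF norm_sum sum_mono])
        fix i
        show "norm ((h $ i) *\<^sub>R c i (x + t *\<^sub>R v)) \<le> norm h * B"
          using component_le_norm_cart[of h i] B'[of i] by (simp, intro mult_mono) auto
      qed
      then show "norm (\<Sum>i\<in>UNIV. (h $ i) *\<^sub>R c i (x + t *\<^sub>R v)) \<le> real CARD('n) * B * norm h"
        by (simp add: mult_ac)
    qed
  qed (use D in auto)
  then show ?thesis by (simp add: mult_ac)
qed

lemma smooth_diff_le:
  fixes \<psi> :: "real^'n \<Rightarrow> complex"
  assumes "smooth \<psi>" and "\<And>i y. y \<in> closed_segment x (x + v) \<Longrightarrow> norm (partial_deriv i \<psi> y) \<le> B"
  shows "norm (\<psi> (x + v) - \<psi> x) \<le> real CARD('n) * B * norm v"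
  using assms by (intro gradient_diff_le[where c = "\<lambda>i. partial_deriv i \<psi>"] smooth_has_derivative)

lemma smooth_taylor_le:
  fixes \<psi> :: "real^'n \<Rightarrow> complex"
  assumes sm: "smooth \<psi>" and A: "\<And>i j y. norm (partial_deriv i (partial_deriv j \<psi>) y) \<le> A"
  shows "norm (\<psi> (x + v) - \<psi> x - (\<Sum>i\<in>UNIV. (v $ i) *\<^sub>R partial_deriv i \<psi> x)) \<le> (real CARD('n))\<^sup>2 * A * (norm v)\<^sup>2"
proof -
  have A0: "0 \<le> A" using A[of undefined undefined undefined] norm_ge_zero order_trans by blast
  let ?f = "\<lambda>y. \<psi> y - (\<Sum>i\<in>UNIV. (y $ i) *\<^sub>R partial_deriv i \<psi> x)"
  have "norm (?f (x + v) - ?f x) \<le> real CARD('n) * (real CARD('n) * A * norm v) * norm v"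
  proof (rule gradient_diff_le[where c = "\<lambda>i y. partial_deriv i \<psi> y - partial_deriv i \<psi> x"])
    fix y
    have "(?f has_derivative (\<lambda>h. (\<Sum>i\<in>UNIV. (h $ i) *\<^sub>R partial_deriv i \<psi> y) - (\<Sum>i\<in>UNIV. (h $ i) *\<^sub>R partial_deriv i \<psi> x))) (at y)"
      by (intro has_derivative_diff smooth_has_derivative sm has_derivative_sum has_derivative_scaleR_left
           bounded_linear_imp_has_derivative bounded_linear_vec_nth)
    then show "(?f has_derivative (\<lambda>h. \<Sum>i\<in>UNIV. (h $ i) *\<^sub>R (partial_deriv i \<psi> y - partial_deriv i \<psi> x))) (at y)"
      by (simp add: scaleR_diff_right sum_subtractf)
  next
    fix i y assume y: "y \<in> closed_segment x (x + v)"
    have "norm (partial_deriv i \<psi> (x + (y - x)) - partial_deriv i \<psi> x) \<le> real CARD('n) * A * norm (y - x)"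
      by (rule smooth_diff_le[OF smooth_partial_deriv[OF sm] A])
    also have "\<dots> \<le> real CARD('n) * A * norm v"
      using segment_bound1[OF y] A0 by (intro mult_left_mono) auto
    finally show "norm (partial_deriv i \<psi> y - partial_deriv i \<psi> x) \<le> real CARD('n) * A * norm v" by simp
  qed
  then show ?thesis by (simp add: power2_eq_square algebra_simps sum.distrib)
qed

text \<open>
  Two applications of the mean value inequality, one in each direction.  The second difference on the left
  is symmetric in the two directions, and therefore so is the mixed derivative.
\<close>

lemma smooth_second_difference:
  fixes \<psi> :: "real^'n \<Rightarrow> complex"
  assumes sm: "smooth \<psi>" and e: "e > 0"
  shows "\<exists>d>0. \<forall>h. 0 < h \<and> h < d \<longrightarrow>
    norm (\<psi> (x + h *\<^sub>R axis i 1 + h *\<^sub>R axis j 1) - \<psi> (x + h *\<^sub>R axis i 1) - \<psi> (x + h *\<^sub>R axis j 1) + \<psi> x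
       - (h * h) *\<^sub>R partial_deriv j (partial_deriv i \<psi>) x) \<le> e * h * h"
proof -
  define ei :: "real^'n" where "ei = axis i 1"
  define ej :: "real^'n" where "ej = axis j 1"
  let ?D = "partial_deriv j (partial_deriv i \<psi>)"
  have nrm: "norm ei = 1" "norm ej = 1" by (auto simp: ei_def ej_def norm_axis_1)
  have "isCont ?D x"
    using smooth_continuous_on[OF smooth_partial_deriv[OF smooth_partial_deriv[OF sm]], of UNIV] by (simp add: continuous_on_eq_continuous_at)
  then obtain d where d: "d > 0" "\<And>y. dist y x < d \<Longrightarrow> norm (?D y - ?D x) < e"
    unfolding continuous_at_eps_delta dist_norm using e by blast
  have vd: "((\<lambda>s. \<eta> (y + s *\<^sub>R axis k 1)) has_vector_derivative partial_deriv k \<eta> (y + s *\<^sub>R axis k 1)) (at s within S)"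
    if "smooth \<eta>" for \<eta> :: "real^'n \<Rightarrow> complex" and y s S k
  proof -
    have a: "((\<lambda>h::real. y + h *\<^sub>R axis k 1) has_derivative (\<lambda>h. h *\<^sub>R axis k 1)) (at s within S)"
      by (auto intro!: derivative_eq_intros)
    have "((\<lambda>h. \<eta> (y + h *\<^sub>R axis k 1)) has_derivative (\<lambda>h. \<Sum>j\<in>UNIV. ((h *\<^sub>R axis k 1 :: real^'n) $ j) *\<^sub>R partial_deriv j \<eta> (y + s *\<^sub>R axis k 1))) (at s within S)"
      by (rule has_derivative_compose[OF a]) (rule smooth_has_derivative[OF that])
    moreover have "(\<Sum>j\<in>UNIV. ((h *\<^sub>R axis k 1 :: real^'n) $ j) *\<^sub>R partial_deriv j \<eta> (y + s *\<^sub>R axis k 1)) = h *\<^sub>R partial_deriv k \<eta> (y + s *\<^sub>R axis k 1)" for h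
      by (subst sum.remove[of _ k]) (auto simp: axis_def intro!: sum.neutral)
    ultimately show ?thesis unfolding has_vector_derivative_def by simp
  qed
  have mvt: "norm (f h - f 0) \<le> B * h" if "0 < h"
      and "\<And>s. s \<in> {0..h} \<Longrightarrow> (f has_vector_derivative f' s) (at s within {0..h})"
      and "\<And>s. s \<in> {0..h} \<Longrightarrow> norm (f' s) \<le> B" for f :: "real \<Rightarrow> complex" and f' h B
  proof -
    have "norm (f h - f 0) \<le> B * norm (h - 0)"
    proof (rule differentiable_bound[where S = "{0..h}"])
      fix s assume s: "s \<in> {0..h}"
      show "(f has_derivative (\<lambda>t. t *\<^sub>R f' s)) (at s within {0..h})" using that(2)[OF s] by (simp add: has_vector_derivative_def)
      show "onorm (\<lambda>t. t *\<^sub>R f' s) \<le> B"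
        by (rule onorm_le) (use that(3)[OF s] in \<open>simp add: mult.commute[of B] mult_left_mono\<close>)
    qed (use that(1) in auto)
    then show ?thesis using that(1) by simp
  qed
  have "norm (\<psi> (x + h *\<^sub>R ei + h *\<^sub>R ej) - \<psi> (x + h *\<^sub>R ei) - \<psi> (x + h *\<^sub>R ej) + \<psi> x - (h * h) *\<^sub>R ?D x) \<le> e * h * h"
    if h: "0 < h" "h < d / 2" for h
  proof -
    have inner: "norm (partial_deriv i \<psi> (x + s *\<^sub>R ei + h *\<^sub>R ej) - partial_deriv i \<psi> (x + s *\<^sub>R ei) - h *\<^sub>R ?D x) \<le> e * h"
      if s: "s \<in> {0..h}" for s
    proof -
      have "norm ((\<lambda>t. partial_deriv i \<psi> (x + s *\<^sub>R ei + t *\<^sub>R ej) - t *\<^sub>R ?D x) h - (\<lambda>t. partial_deriv i \<psi> (x + s *\<^sub>R ei + t *\<^sub>R ej) - t *\<^sub>R ?D x) 0) \<le> e * h"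
      proof (rule mvt[OF h(1), where f' = "\<lambda>t. ?D (x + s *\<^sub>R ei + t *\<^sub>R ej) - ?D x"])
        fix t assume t: "t \<in> {0..h}"
        show "((\<lambda>t. partial_deriv i \<psi> (x + s *\<^sub>R ei + t *\<^sub>R ej) - t *\<^sub>R ?D x) has_vector_derivative ?D (x + s *\<^sub>R ei + t *\<^sub>R ej) - ?D x) (at t within {0..h})"
          unfolding ej_def by (intro has_vector_derivative_diff vd smooth_partial_deriv sm) (auto intro!: derivative_eq_intros simp: has_vector_derivative_def)
        have "dist (x + s *\<^sub>R ei + t *\<^sub>R ej) x \<le> norm (s *\<^sub>R ei) + norm (t *\<^sub>R ej)"
          using norm_triangle_ineq[of "s *\<^sub>R ei" "t *\<^sub>R ej"] by (simp add: dist_norm add.assoc)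
        also have "\<dots> < d" using s t h nrm by simp
        finally show "norm (?D (x + s *\<^sub>R ei + t *\<^sub>R ej) - ?D x) \<le> e" using d(2) by (simp add: less_imp_le)
      qed
      then show ?thesis by (simp add: algebra_simps)
    qed
    let ?g = "\<lambda>s. \<psi> (x + h *\<^sub>R ej + s *\<^sub>R ei) - \<psi> (x + s *\<^sub>R ei) - s *\<^sub>R (h *\<^sub>R ?D x)"
    have "norm (?g h - ?g 0) \<le> (e * h) * h"
    proof (rule mvt[OF h(1), where f' = "\<lambda>s. partial_deriv i \<psi> (x + h *\<^sub>R ej + s *\<^sub>R ei) - partial_deriv i \<psi> (x + s *\<^sub>R ei) - h *\<^sub>R ?D x"])
      fix s assume s: "s \<in> {0..h}"
      show "(?g has_vector_derivative partial_deriv i \<psi> (x + h *\<^sub>R ej + s *\<^sub>R ei) - partial_deriv i \<psi> (x + s *\<^sub>R ei) - h *\<^sub>R ?D x) (at s within {0..h})"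
        unfolding ei_def by (intro has_vector_derivative_diff vd sm) (auto intro!: derivative_eq_intros simp: has_vector_derivative_def)
      show "norm (partial_deriv i \<psi> (x + h *\<^sub>R ej + s *\<^sub>R ei) - partial_deriv i \<psi> (x + s *\<^sub>R ei) - h *\<^sub>R ?D x) \<le> e * h"
        using inner[OF s] by (simp add: add_ac)
    qed
    then show ?thesis by (simp add: algebra_simps)
  qed
  then show ?thesis using d(1) unfolding ei_def ej_def by (intro exI[of _ "d / 2"]) auto
qed

lemma partial_deriv_commute:
  assumes sm: "smooth \<psi>"
  shows "partial_deriv i (partial_deriv j \<psi>) = partial_deriv j (partial_deriv i \<psi>)"
proof
  fix x
  let ?a = "partial_deriv j (partial_deriv i \<psi>) x" and ?b = "partial_deriv i (partial_deriv j \<psi>) x"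
  have "norm (?a - ?b) \<le> 0 + e" if e: "e > 0" for e
  proof -
    obtain d1 where d1: "d1 > 0" "\<And>h. 0 < h \<Longrightarrow> h < d1 \<Longrightarrow>
      norm (\<psi> (x + h *\<^sub>R axis i 1 + h *\<^sub>R axis j 1) - \<psi> (x + h *\<^sub>R axis i 1) - \<psi> (x + h *\<^sub>R axis j 1) + \<psi> x - (h * h) *\<^sub>R ?a) \<le> (e/2) * h * h"
      using smooth_second_difference[OF sm, of "e/2" x i j] e by auto
    obtain d2 where d2: "d2 > 0" "\<And>h. 0 < h \<Longrightarrow> h < d2 \<Longrightarrow>
      norm (\<psi> (x + h *\<^sub>R axis j 1 + h *\<^sub>R axis i 1) - \<psi> (x + h *\<^sub>R axis j 1) - \<psi> (x + h *\<^sub>R axis i 1) + \<psi> x - (h * h) *\<^sub>R ?b) \<le> (e/2) * h * h"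
      using smooth_second_difference[OF sm, of "e/2" x j i] e by auto
    define h where "h = min d1 d2 / 2"
    have h: "0 < h" "h < d1" "h < d2" using d1(1) d2(1) by (auto simp: h_def)
    let ?E = "\<psi> (x + h *\<^sub>R axis i 1 + h *\<^sub>R axis j 1) - \<psi> (x + h *\<^sub>R axis i 1) - \<psi> (x + h *\<^sub>R axis j 1) + \<psi> x"
    have E2: "\<psi> (x + h *\<^sub>R axis j 1 + h *\<^sub>R axis i 1) - \<psi> (x + h *\<^sub>R axis j 1) - \<psi> (x + h *\<^sub>R axis i 1) + \<psi> x = ?E"
      by (simp add: algebra_simps)
    have "(h * h) * norm (?a - ?b) = norm ((?E - (h * h) *\<^sub>R ?b) - (?E - (h * h) *\<^sub>R ?a))"
      using h by (simp add: scaleR_diff_right[symmetric] abs_mult)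
    also have "\<dots> \<le> (e/2) * h * h + (e/2) * h * h"
      by (rule order_trans[OF norm_triangle_ineq4 add_mono]) (use d1(2)[OF h(1,2)] d2(2)[OF h(1,3)] E2 in auto)
    also have "\<dots> = (h * h) * e" by simp
    finally show ?thesis using h by simp
  qed
  then have "norm (?a - ?b) \<le> 0" by (rule field_le_epsilon)
  then show "?b = ?a" by simp
qed

lemma foldr_partial_deriv_move:
  assumes sm: "smooth \<psi>"
  shows "foldr partial_deriv (as @ j # bs) \<psi> = partial_deriv j (foldr partial_deriv (as @ bs) \<psi>)"
proof (induction as)
  case (Cons a as)
  have "foldr partial_deriv ((a # as) @ j # bs) \<psi> = partial_deriv a (partial_deriv j (foldr partial_deriv (as @ bs) \<psi>))"
    using Cons by simp
  also have "\<dots> = partial_deriv j (partial_deriv a (foldr partial_deriv (as @ bs) \<psi>))"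
    by (rule partial_deriv_commute) (rule smooth_foldr[OF sm])
  finally show ?case by simp
qed simp

lemma foldr_partial_deriv_cong_mset:
  assumes sm: "smooth \<psi>" and "mset is = mset js"
  shows "foldr partial_deriv is \<psi> = foldr partial_deriv js \<psi>"
  using assms(2)
proof (induction js arbitrary: "is")
  case (Cons j js)
  have "j \<in> set is" using Cons.prems by (metis list.set_intros(1) set_mset_mset)
  then obtain as bs where "is": "is = as @ j # bs" by (meson split_list)
  then have "mset (as @ bs) = mset js" using Cons.prems by simp
  then have IH: "foldr partial_deriv (as @ bs) \<psi> = foldr partial_deriv js \<psi>" by (rule Cons.IH)
  show ?case unfolding "is" foldr_partial_deriv_move[OF sm] IH by simp
qed simp

text \<open>
  The coordinates in the order in which \<^const>\<open>multi_deriv\<close> differentiates.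
\<close>

definition order_list :: "nat^'n \<Rightarrow> 'n list" where
  "order_list \<beta> = concat (map (\<lambda>i. replicate (\<beta> $ i) i) (SOME is. distinct is \<and> set is = UNIV))"

lemma some_enumeration: "distinct (SOME is. distinct is \<and> set is = (UNIV :: 'n::finite set))"
  "set (SOME is. distinct is \<and> set is = (UNIV :: 'n::finite set)) = UNIV"
  using someI_ex[of "\<lambda>is. distinct is \<and> set is = (UNIV :: 'n::finite set)"] finite_distinct_list[of "UNIV :: 'n set"] by auto

lemma multi_deriv_eq: "multi_deriv \<beta> \<psi> = foldr partial_deriv (order_list \<beta>) \<psi>"
proof -
  have r: "foldr partial_deriv (replicate k i) \<psi> = (partial_deriv i ^^ k) \<psi>" for k i and \<psi> :: "real^'n \<Rightarrow> complex"
    by (induction k) auto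
  have "foldr (\<lambda>i. partial_deriv i ^^ (\<beta> $ i)) js \<psi> = foldr partial_deriv (concat (map (\<lambda>i. replicate (\<beta> $ i) i) js)) \<psi>" for js
    by (induction js) (auto simp: r)
  then show ?thesis by (simp add: multi_deriv_def order_list_def)
qed

lemma count_order_list: "count (mset (order_list \<beta>)) i = \<beta> $ i"
proof -
  have "count (mset (concat (map (\<lambda>i. replicate (\<beta> $ i) i) js))) i = (if i \<in> set js then \<beta> $ i else 0)" if "distinct js" for js
    using that by (induction js) auto
  then show ?thesis by (simp add: order_list_def some_enumeration)
qed

lemma length_order_list: "length (order_list \<beta>) = multi_order \<beta>"
proof -
  have "length (order_list \<beta>) = (\<Sum>i\<leftarrow>(SOME is. distinct is \<and> set is = UNIV). \<beta> $ i)"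
    by (simp add: order_list_def length_concat o_def)
  also have "\<dots> = (\<Sum>i\<in>UNIV. \<beta> $ i)"
    by (subst sum_list_distinct_conv_sum_set) (simp_all add: some_enumeration)
  finally show ?thesis by (simp add: multi_order_def)
qed

text \<open>
  It is convenient to work with derivatives along arbitrary lists of coordinates, which behave well
  under induction; by symmetry they are the derivatives \<^const>\<open>multi_deriv\<close>.
\<close>

lemma foldr_partial_deriv_eq_multi_deriv:
  assumes "smooth (\<psi> :: real^'n \<Rightarrow> complex)"
  shows "\<exists>\<beta>. multi_order \<beta> = length is \<and> foldr partial_deriv is \<psi> = multi_deriv \<beta> \<psi>"
proof -
  define \<beta> :: "nat^'n" where "\<beta> = (\<chi> i. count (mset is) i)"
  have "mset (order_list \<beta>) = mset is" by (rule multiset_eqI) (simp add: count_order_list \<beta>_def)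
  moreover from this have "length (order_list \<beta>) = length is" by (metis size_mset)
  ultimately show ?thesis using foldr_partial_deriv_cong_mset[OF assms, of "order_list \<beta>" "is"]
    by (metis length_order_list multi_deriv_eq)
qed


section \<open>Schwartz functions and tempered distributions\<close>

text \<open>
  The seminorms of the Schwartz space, with a bound in place of the supremum: \<open>L\<close> derivatives with
  decay of order \<open>N\<close>.  Keeping \<open>A\<close> as an argument makes all estimates linear in it.
\<close>

definition decay_bound :: "nat \<Rightarrow> nat \<Rightarrow> real \<Rightarrow> (real^'n \<Rightarrow> complex) \<Rightarrow> bool" where
  "decay_bound L N A \<psi> \<longleftrightarrow>
     (\<forall>is x. length is \<le> L \<longrightarrow> norm (foldr partial_deriv is \<psi> x) * (1 + norm x) ^ N \<le> A)"

lemma decay_boundI: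
  "(\<And>is x. length is \<le> L \<Longrightarrow> norm (foldr partial_deriv is \<psi> x) * (1 + norm x) ^ N \<le> A) \<Longrightarrow> decay_bound L N A \<psi>"
  by (simp add: decay_bound_def)

lemma decay_boundD:
  "decay_bound L N A \<psi> \<Longrightarrow> length is \<le> L \<Longrightarrow> norm (foldr partial_deriv is \<psi> x) * (1 + norm x) ^ N \<le> A"
  by (simp add: decay_bound_def)

lemma decay_bound_nonneg: "decay_bound L N A \<psi> \<Longrightarrow> 0 \<le> A"
  using order_trans[OF norm_ge_zero, of "\<psi> 0" A] decay_boundD[of L N A \<psi> "[]" 0] by simp

lemma decay_bound_value:
  assumes "decay_bound L N A \<psi>" shows "norm (\<psi> x) * (1 + norm x) ^ N \<le> A"
  using decay_boundD[OF assms, of "[]" x] by simp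

lemma decay_bound_le:
  assumes "decay_bound L N A \<psi>" "length is \<le> L"
  shows "norm (foldr partial_deriv is \<psi> x) \<le> A / (1 + norm x) ^ N"
  using decay_boundD[OF assms, of x] by (simp add: pos_le_divide_eq add_pos_nonneg)

lemma decay_bound_mono:
  fixes \<psi> :: "real^'n \<Rightarrow> complex"
  assumes "decay_bound L N A \<psi>" "L' \<le> L" "N' \<le> N" "A \<le> A'"
  shows "decay_bound L' N' A' \<psi>"
proof (rule decay_boundI)
  fix "is" :: "'n list" and x :: "real^'n" assume "length is \<le> L'"
  then have "norm (foldr partial_deriv is \<psi> x) * (1 + norm x) ^ N \<le> A" using assms(2) by (intro decay_boundD[OF assms(1)]) auto
  moreover have "norm (foldr partial_deriv is \<psi> x) * (1 + norm x) ^ N' \<le> norm (foldr partial_deriv is \<psi> x) * (1 + norm x) ^ N"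
    using assms by (intro mult_left_mono power_increasing) auto
  ultimately show "norm (foldr partial_deriv is \<psi> x) * (1 + norm x) ^ N' \<le> A'" using assms(4) by linarith
qed

lemma decay_bound_foldr:
  fixes \<psi> :: "real^'n \<Rightarrow> complex"
  assumes "decay_bound (length is + L) N A \<psi>"
  shows "decay_bound L N A (foldr partial_deriv is \<psi>)"
proof (rule decay_boundI)
  fix js :: "'n list" and x :: "real^'n" assume "length js \<le> L"
  then show "norm (foldr partial_deriv js (foldr partial_deriv is \<psi>) x) * (1 + norm x) ^ N \<le> A"
    using decay_boundD[OF assms, of "js @ is" x] by simp
qed

lemma schwartz_seminorm_le_iff:
  assumes "0 \<le> A"
  shows "schwartz_seminorm k \<beta> \<psi> \<le> ennreal A \<longleftrightarrow> (\<forall>x. norm (multi_deriv \<beta> \<psi> x) * (1 + norm x) ^ k \<le> A)"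
  using assms by (simp add: schwartz_seminorm_def SUP_le_iff ennreal_le_iff mult.commute)

lemma decay_bound_of_each_derivative:
  fixes \<psi> :: "real^'n \<Rightarrow> complex"
  assumes "\<And>is. \<exists>A\<ge>0. \<forall>x. norm (foldr partial_deriv is \<psi> x) * (1 + norm x) ^ N \<le> A"
  shows "\<exists>A. decay_bound L N A \<psi>"
proof -
  obtain A where A: "\<And>is. A is \<ge> 0" "\<And>is x. norm (foldr partial_deriv is \<psi> x) * (1 + norm x) ^ N \<le> A is"
    using assms by metis
  let ?S = "{is :: 'n list. set is \<subseteq> UNIV \<and> length is \<le> L}"
  have fin: "finite ?S" by (rule finite_lists_length_le) simp
  have "decay_bound L N (\<Sum>is\<in>?S. A is) \<psi>"
  proof (rule decay_boundI)
    fix "is" :: "'n list" and x :: "real^'n" assume "length is \<le> L"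
    then have "A is \<le> (\<Sum>is\<in>?S. A is)" using fin A(1) by (intro member_le_sum) auto
    then show "norm (foldr partial_deriv is \<psi> x) * (1 + norm x) ^ N \<le> (\<Sum>is\<in>?S. A is)" using A(2)[of "is" x] by linarith
  qed
  then show ?thesis by blast
qed

lemma schwartz_iff:
  fixes \<psi> :: "real^'n \<Rightarrow> complex"
  shows "\<psi> \<in> schwartz_space \<longleftrightarrow> smooth \<psi> \<and> (\<forall>L N. \<exists>A. decay_bound L N A \<psi>)"
proof
  assume S: "\<psi> \<in> schwartz_space"
  then have sm: "smooth \<psi>" by (simp add: schwartz_space_def)
  have "\<exists>A. decay_bound L N A \<psi>" for L N
  proof -
    have "\<exists>A\<ge>0. \<forall>x. norm (foldr partial_deriv is \<psi> x) * (1 + norm x) ^ N \<le> A" for "is"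
    proof -
      obtain \<beta> where \<beta>: "foldr partial_deriv is \<psi> = multi_deriv \<beta> \<psi>"
        using foldr_partial_deriv_eq_multi_deriv[OF sm] by blast
      have "schwartz_seminorm N \<beta> \<psi> < \<infinity>" using S by (simp add: schwartz_space_def)
      then have "schwartz_seminorm N \<beta> \<psi> \<le> ennreal (enn2real (schwartz_seminorm N \<beta> \<psi>))" by (simp add: less_top)
      then show ?thesis unfolding \<beta> by (subst (asm) schwartz_seminorm_le_iff) (auto intro: exI[of _ "enn2real (schwartz_seminorm N \<beta> \<psi>)"])
    qed
    then show ?thesis by (rule decay_bound_of_each_derivative)
  qed
  then show "smooth \<psi> \<and> (\<forall>L N. \<exists>A. decay_bound L N A \<psi>)" using sm by blast
next
  assume S: "smooth \<psi> \<and> (\<forall>L N. \<exists>A. decay_bound L N A \<psi>)"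
  have "schwartz_seminorm k \<beta> \<psi> < \<infinity>" for k \<beta>
  proof -
    obtain A where A: "decay_bound (multi_order \<beta>) k A \<psi>" using S by blast
    have "schwartz_seminorm k \<beta> \<psi> \<le> ennreal A"
      using decay_bound_nonneg[OF A] decay_boundD[OF A, of "order_list \<beta>"]
      by (subst schwartz_seminorm_le_iff) (auto simp: multi_deriv_eq length_order_list)
    then show ?thesis by (simp add: le_less_trans)
  qed
  then show "\<psi> \<in> schwartz_space" using S by (simp add: schwartz_space_def)
qed

lemma schwartz_smooth: "\<psi> \<in> schwartz_space \<Longrightarrow> smooth \<psi>"
  by (simp add: schwartz_space_def)

lemma schwartz_decay:
  assumes "\<psi> \<in> schwartz_space" obtains A where "A > 0" "decay_bound L N A \<psi>"
proof -
  obtain A where A: "decay_bound L N A \<psi>" using assms unfolding schwartz_iff by blast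
  have "decay_bound L N (A + 1) \<psi>" by (rule decay_bound_mono[OF A]) auto
  then show ?thesis using decay_bound_nonneg[OF A] by (intro that[of "A + 1"]) auto
qed

lemma schwartz_foldr: "\<psi> \<in> schwartz_space \<Longrightarrow> foldr partial_deriv is \<psi> \<in> schwartz_space"
  unfolding schwartz_iff by (meson decay_bound_foldr smooth_foldr)

lemma schwartz_partial_deriv: "\<psi> \<in> schwartz_space \<Longrightarrow> partial_deriv i \<psi> \<in> schwartz_space"
  using schwartz_foldr[of \<psi> "[i]"] by simp

lemma decay_bound_lincomb:
  fixes \<psi> \<eta> :: "real^'n \<Rightarrow> complex"
  assumes "smooth \<psi>" "smooth \<eta>" "decay_bound L N A \<psi>" "decay_bound L N B \<eta>"
  shows "decay_bound L N (norm a * A + norm b * B) (\<lambda>z. a * \<psi> z + b * \<eta> z)"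
proof (rule decay_boundI)
  fix "is" :: "'n list" and x :: "real^'n" assume l: "length is \<le> L"
  let ?w = "(1 + norm x) ^ N"
  have w: "?w \<ge> 0" by simp
  have "norm (foldr partial_deriv is (\<lambda>z. a * \<psi> z + b * \<eta> z) x) * ?w
     \<le> (norm a * norm (foldr partial_deriv is \<psi> x) + norm b * norm (foldr partial_deriv is \<eta> x)) * ?w"
    using norm_triangle_ineq[of "a * foldr partial_deriv is \<psi> x" "b * foldr partial_deriv is \<eta> x"]
    by (intro mult_right_mono) (auto simp: foldr_partial_deriv_lincomb[OF assms(1,2)] norm_mult)
  also have "\<dots> = norm a * (norm (foldr partial_deriv is \<psi> x) * ?w) + norm b * (norm (foldr partial_deriv is \<eta> x) * ?w)"
    by (simp add: algebra_simps)
  also have "\<dots> \<le> norm a * A + norm b * B"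
    by (intro add_mono mult_left_mono decay_boundD[OF assms(3) l] decay_boundD[OF assms(4) l]) auto
  finally show "norm (foldr partial_deriv is (\<lambda>z. a * \<psi> z + b * \<eta> z) x) * ?w \<le> norm a * A + norm b * B" .
qed

lemma schwartz_lincomb:
  assumes "\<psi> \<in> schwartz_space" "\<eta> \<in> schwartz_space"
  shows "(\<lambda>z. a * \<psi> z + b * \<eta> z) \<in> schwartz_space"
  unfolding schwartz_iff
proof (intro conjI allI)
  have sm: "smooth \<psi>" "smooth \<eta>" using assms by (auto intro: schwartz_smooth)
  then show "smooth (\<lambda>z. a * \<psi> z + b * \<eta> z)" by (rule smooth_lincomb)
  fix L N
  obtain A B where "decay_bound L N A \<psi>" "decay_bound L N B \<eta>"
    using schwartz_decay[OF assms(1)] schwartz_decay[OF assms(2)] by metis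
  then show "\<exists>C. decay_bound L N C (\<lambda>z. a * \<psi> z + b * \<eta> z)"
    using decay_bound_lincomb[OF sm] by blast
qed

lemma decay_bound_affine:
  fixes \<psi> :: "real^'n \<Rightarrow> complex"
  assumes "smooth \<psi>" "decay_bound L N A \<psi>" "c \<noteq> 0"
  shows "decay_bound L N (A * (norm a * (1 + \<bar>c\<bar>) ^ L * ((1 + 1 / \<bar>c\<bar>) * (1 + norm x)) ^ N)) (\<lambda>z. a * \<psi> (x + c *\<^sub>R z))"
proof (rule decay_boundI)
  fix "is" :: "'n list" and z :: "real^'n" assume l: "length is \<le> L"
  let ?y = "x + c *\<^sub>R z" and ?d = "norm (foldr partial_deriv is \<psi> (x + c *\<^sub>R z))"
  have A: "A \<ge> 0" using assms(2) by (rule decay_bound_nonneg)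
  have "\<bar>c\<bar> * norm z \<le> norm ?y + norm x"
    using norm_triangle_ineq4[of ?y x] by simp
  then have "norm z \<le> (norm ?y + norm x) / \<bar>c\<bar>" using assms(3) by (simp add: field_simps)
  also have "1 + (norm ?y + norm x) / \<bar>c\<bar> \<le> (1 + 1 / \<bar>c\<bar>) * ((1 + norm x) * (1 + norm ?y))"
    using assms(3) by (simp add: field_simps add_nonneg_nonneg)
  finally have z: "1 + norm z \<le> ((1 + 1 / \<bar>c\<bar>) * (1 + norm x)) * (1 + norm ?y)" by (simp add: mult_ac)
  have "norm (foldr partial_deriv is (\<lambda>z. a * \<psi> (x + c *\<^sub>R z)) z) * (1 + norm z) ^ N = norm a * \<bar>c\<bar> ^ length is * ?d * (1 + norm z) ^ N"
    by (simp add: foldr_partial_deriv_affine[OF assms(1)] norm_mult norm_power)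
  also have "\<dots> \<le> norm a * (1 + \<bar>c\<bar>) ^ L * ?d * (((1 + 1 / \<bar>c\<bar>) * (1 + norm x)) * (1 + norm ?y)) ^ N"
  proof (intro mult_mono power_mono z)
    have "\<bar>c\<bar> ^ length is \<le> (1 + \<bar>c\<bar>) ^ length is" by (intro power_mono) auto
    also have "\<dots> \<le> (1 + \<bar>c\<bar>) ^ L" using l by (intro power_increasing) auto
    finally show "\<bar>c\<bar> ^ length is \<le> (1 + \<bar>c\<bar>) ^ L" .
  qed auto
  also have "\<dots> = norm a * (1 + \<bar>c\<bar>) ^ L * ((1 + 1 / \<bar>c\<bar>) * (1 + norm x)) ^ N * (?d * (1 + norm ?y) ^ N)"
    by (simp add: power_mult_distrib mult_ac)
  also have "\<dots> \<le> norm a * (1 + \<bar>c\<bar>) ^ L * ((1 + 1 / \<bar>c\<bar>) * (1 + norm x)) ^ N * A"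
    by (intro mult_left_mono decay_boundD[OF assms(2) l]) auto
  finally show "norm (foldr partial_deriv is (\<lambda>z. a * \<psi> (x + c *\<^sub>R z)) z) * (1 + norm z) ^ N
     \<le> A * (norm a * (1 + \<bar>c\<bar>) ^ L * ((1 + 1 / \<bar>c\<bar>) * (1 + norm x)) ^ N)" by (simp add: mult_ac)
qed

lemma schwartz_affine:
  assumes "\<psi> \<in> schwartz_space" "c \<noteq> 0"
  shows "(\<lambda>z. a * \<psi> (x + c *\<^sub>R z)) \<in> schwartz_space"
  unfolding schwartz_iff
proof (intro conjI allI)
  have sm: "smooth \<psi>" using assms by (auto intro: schwartz_smooth)
  then show "smooth (\<lambda>z. a * \<psi> (x + c *\<^sub>R z))" by (rule smooth_affine)
  fix L N
  obtain A where "decay_bound L N A \<psi>" using schwartz_decay[OF assms(1)] by metis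
  then show "\<exists>C. decay_bound L N C (\<lambda>z. a * \<psi> (x + c *\<^sub>R z))"
    using decay_bound_affine[OF sm _ assms(2)] by blast
qed

lemma dilate_eq_affine: "dilate t \<psi> = (\<lambda>z. complex_of_real (1 / t ^ CARD('n)) * \<psi> (0 + (1 / t) *\<^sub>R z))"
  for \<psi> :: "real^'n \<Rightarrow> complex"
  by (rule ext) (simp add: dilate_def divide_inverse)

lemma dilate_reflect_eq_affine:
  "(\<lambda>z. dilate t \<psi> (x - z)) = (\<lambda>z. complex_of_real (1 / t ^ CARD('n)) * \<psi> ((1 / t) *\<^sub>R x + (- 1 / t) *\<^sub>R z))"
  for \<psi> :: "real^'n \<Rightarrow> complex"
  by (rule ext) (simp add: dilate_def divide_inverse scaleR_diff_right)

lemma schwartz_dilate: "\<psi> \<in> schwartz_space \<Longrightarrow> t > 0 \<Longrightarrow> dilate t \<psi> \<in> schwartz_space"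
  unfolding dilate_eq_affine by (rule schwartz_affine) auto

lemma schwartz_reflect: "\<psi> \<in> schwartz_space \<Longrightarrow> (\<lambda>z. \<psi> (x - z)) \<in> schwartz_space"
  using schwartz_affine[of \<psi> "-1" 1 x] by simp

lemma schwartz_translate: "\<psi> \<in> schwartz_space \<Longrightarrow> (\<lambda>z. \<psi> (z - x)) \<in> schwartz_space"
  using schwartz_affine[of \<psi> "1" 1 "- x"] by simp

lemma zero_schwartz: "(\<lambda>z. 0) \<in> (schwartz_space :: (real^'n \<Rightarrow> complex) set)"
proof -
  have "smooth ((\<lambda>z. 0) :: real^'n \<Rightarrow> complex)"
  proof (rule smooth_coinduct[where P = "\<lambda>\<psi>. \<psi> = (\<lambda>z. 0)"])
    fix \<psi> :: "real^'n \<Rightarrow> complex" and i assume \<psi>: "\<psi> = (\<lambda>z. 0)"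
    show "partial_deriv i \<psi> = (\<lambda>z. 0)" unfolding \<psi>
      by (rule ext, rule partial_deriv_eqI) auto
  qed auto
  moreover from this have "foldr partial_deriv is (\<lambda>z. 0) = (\<lambda>z. 0)" for "is" :: "'n list"
    using foldr_partial_deriv_affine[of "\<lambda>z. 0" "is" 0 0 1] by simp
  ultimately show ?thesis unfolding schwartz_iff decay_bound_def by auto
qed

lemma test_functions_schwartz:
  fixes \<psi> :: "real^'n \<Rightarrow> complex"
  assumes "\<psi> \<in> test_functions"
  shows "\<psi> \<in> schwartz_space"
proof -
  define K where "K = closure {x. \<psi> x \<noteq> 0}"
  have sm: "smooth \<psi>" and K: "compact K" using assms by (auto simp: test_functions_def K_def)
  have out: "foldr partial_deriv is \<psi> x = 0" if "x \<notin> K" for "is" x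
    using that
  proof (induction "is" arbitrary: x)
    case Nil
    then show ?case using closure_subset[of "{x. \<psi> x \<noteq> 0}"] by (auto simp: K_def)
  next
    case (Cons i "is")
    let ?\<eta> = "foldr partial_deriv is \<psi>"
    have "open (- K)" using K by (simp add: compact_imp_closed open_Compl)
    have "((\<lambda>z. 0) has_derivative (\<lambda>h. 0)) (at x)" by simp
    then have "(?\<eta> has_derivative (\<lambda>h. 0)) (at x)"
      by (rule has_derivative_transform_within_open[OF _ \<open>open (- K)\<close>]) (use Cons in auto)
    then have "(?\<eta> has_derivative (\<lambda>h. \<Sum>i\<in>UNIV. (h $ i) *\<^sub>R 0)) (at x)" by simp
    then have "partial_deriv i ?\<eta> x = 0" by (rule partial_deriv_eqI)
    then show ?case by simp
  qed
  have "\<exists>A. decay_bound L N A \<psi>" for L N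
  proof -
    have "\<exists>A\<ge>0. \<forall>x. norm (foldr partial_deriv is \<psi> x) * (1 + norm x) ^ N \<le> A" for "is"
    proof -
      have "continuous_on K (\<lambda>x. norm (foldr partial_deriv is \<psi> x) * (1 + norm x) ^ N)"
        by (intro continuous_intros smooth_continuous_on smooth_foldr sm)
      then have "compact ((\<lambda>x. norm (foldr partial_deriv is \<psi> x) * (1 + norm x) ^ N) ` K)"
        using K by (rule compact_continuous_image)
      then have "bounded ((\<lambda>x. norm (foldr partial_deriv is \<psi> x) * (1 + norm x) ^ N) ` K)" by (rule compact_imp_bounded)
      then obtain A where "A > 0" "\<And>x. x \<in> K \<Longrightarrow> norm (norm (foldr partial_deriv is \<psi> x) * (1 + norm x) ^ N) \<le> A"
        unfolding bounded_pos by auto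
      then have "norm (foldr partial_deriv is \<psi> x) * (1 + norm x) ^ N \<le> A" for x
        using out[of x "is"] by (cases "x \<in> K") (fastforce, simp)
      then show ?thesis using \<open>A > 0\<close> by (intro exI[of _ A]) auto
    qed
    then show ?thesis by (rule decay_bound_of_each_derivative)
  qed
  then show ?thesis using sm by (simp add: schwartz_iff)
qed

lemma normalized_schwartz_iff:
  fixes \<psi> :: "real^'n \<Rightarrow> complex"
  shows "\<psi> \<in> normalized_schwartz m \<longleftrightarrow>
    \<psi> \<in> schwartz_space \<and> decay_bound (m + 1) ((m + 2) * (CARD('n) + 1)) 1 \<psi>"
proof -
  let ?N = "(m + 2) * (CARD('n) + 1)"
  have "(SUP x. SUP \<beta>\<in>{\<beta>. multi_order \<beta> \<le> m + 1}. ennreal ((1 + norm x) ^ ?N * norm (multi_deriv \<beta> \<psi> x))) \<le> 1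
     \<longleftrightarrow> decay_bound (m + 1) ?N 1 \<psi>" if S: "\<psi> \<in> schwartz_space"
  proof -
    have "(SUP x. SUP \<beta>\<in>{\<beta>. multi_order \<beta> \<le> m + 1}. ennreal ((1 + norm x) ^ ?N * norm (multi_deriv \<beta> \<psi> x))) \<le> 1
      \<longleftrightarrow> (\<forall>x \<beta>. multi_order \<beta> \<le> m + 1 \<longrightarrow> norm (multi_deriv \<beta> \<psi> x) * (1 + norm x) ^ ?N \<le> 1)"
      by (simp only: SUP_le_iff) (simp add: mult.commute)
    also have "\<dots> \<longleftrightarrow> decay_bound (m + 1) ?N 1 \<psi>"
    proof
      assume L: "\<forall>x \<beta>. multi_order \<beta> \<le> m + 1 \<longrightarrow> norm (multi_deriv \<beta> \<psi> x) * (1 + norm x) ^ ?N \<le> 1"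
      show "decay_bound (m + 1) ?N 1 \<psi>"
      proof (rule decay_boundI)
        fix "is" :: "'n list" and x :: "real^'n" assume l: "length is \<le> m + 1"
        obtain \<beta> where "multi_order \<beta> = length is" "foldr partial_deriv is \<psi> = multi_deriv \<beta> \<psi>"
          using foldr_partial_deriv_eq_multi_deriv[OF schwartz_smooth[OF S]] by blast
        then show "norm (foldr partial_deriv is \<psi> x) * (1 + norm x) ^ ?N \<le> 1" using L l by simp
      qed
    next
      assume R: "decay_bound (m + 1) ?N 1 \<psi>"
      show "\<forall>x \<beta>. multi_order \<beta> \<le> m + 1 \<longrightarrow> norm (multi_deriv \<beta> \<psi> x) * (1 + norm x) ^ ?N \<le> 1"
        using decay_boundD[OF R] by (simp add: multi_deriv_eq flip: length_order_list)
    qed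
    finally show ?thesis .
  qed
  then show ?thesis by (auto simp: normalized_schwartz_def)
qed

lemma tempered_lincomb:
  assumes "f \<in> tempered_distributions" "\<psi> \<in> schwartz_space" "\<eta> \<in> schwartz_space"
  shows "f (\<lambda>x. a * \<psi> x + b * \<eta> x) = a * f \<psi> + b * f \<eta>"
  using assms by (simp add: tempered_distributions_def)

lemma tempered_scale:
  assumes "f \<in> tempered_distributions" "\<psi> \<in> schwartz_space"
  shows "f (\<lambda>x. a * \<psi> x) = a * f \<psi>"
  using tempered_lincomb[OF assms zero_schwartz, of a 0] by simp

lemma tempered_diff:
  assumes "f \<in> tempered_distributions" "\<psi> \<in> schwartz_space" "\<eta> \<in> schwartz_space"
  shows "f (\<lambda>x. \<psi> x - \<eta> x) = f \<psi> - f \<eta>"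
  using tempered_lincomb[OF assms, of 1 "-1"] by simp

lemma topspace_schwartz: "topspace schwartz_topology = schwartz_space"
proof -
  have "\<exists>k \<beta> \<psi> \<epsilon>. \<eta> \<in> {\<eta> \<in> schwartz_space. schwartz_seminorm k \<beta> (\<lambda>x. \<eta> x - \<psi> x) < ennreal \<epsilon>} \<and> \<psi> \<in> schwartz_space \<and> 0 < \<epsilon>"
    if "\<eta> \<in> schwartz_space" for \<eta> :: "real^'a \<Rightarrow> complex"
  proof -
    have "schwartz_seminorm 0 (0 :: nat^'a) (\<lambda>x. 0 :: complex) = 0"
      using foldr_partial_deriv_affine[OF schwartz_smooth[OF zero_schwartz], of "order_list (0 :: nat^'a)" 0 0 1]
      by (auto simp: schwartz_seminorm_def multi_deriv_eq)
    then show ?thesis using that by (intro exI[of _ 0] exI[of _ "0 :: nat^'a"] exI[of _ \<eta>] exI[of _ 1]) simp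
  qed
  note mem = this
  show ?thesis unfolding schwartz_topology_def topology_generated_by_topspace
  proof (intro equalityI subsetI)
    fix \<eta> :: "real^'a \<Rightarrow> complex" assume "\<eta> \<in> schwartz_space"
    from mem[OF this] obtain k \<beta> \<psi> \<epsilon> where *: "\<eta> \<in> {\<eta> \<in> schwartz_space. schwartz_seminorm k \<beta> (\<lambda>x. \<eta> x - \<psi> x) < ennreal \<epsilon>}"
      "\<psi> \<in> schwartz_space" "0 < \<epsilon>" by (elim exE conjE)
    show "\<eta> \<in> \<Union>{{\<eta> \<in> schwartz_space. schwartz_seminorm k \<beta> (\<lambda>x. \<eta> x - \<psi> x) < ennreal \<epsilon>} | k \<beta> \<psi> \<epsilon>.
        \<psi> \<in> schwartz_space \<and> 0 < \<epsilon>}"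
      by (rule UnionI[OF _ *(1)], rule CollectI, rule exI[of _ k], rule exI[of _ \<beta>], rule exI[of _ \<psi>], rule exI[of _ \<epsilon>])
        (use *(2,3) in simp)
  qed auto
qed

text \<open>
  Induction over the topology generated by the seminorm balls.  The centre of a subbasic ball is
  arbitrary, so the triangle inequality decides how small the neighbourhood of zero has to be.
\<close>

lemma schwartz_neighbourhood_zero:
  assumes "openin (schwartz_topology :: (real^'n \<Rightarrow> complex) topology) V" "(\<lambda>x. 0) \<in> V"
  shows "\<exists>L N \<delta>. \<delta> > 0 \<and> (\<forall>\<eta>\<in>schwartz_space. decay_bound L N \<delta> \<eta> \<longrightarrow> \<eta> \<in> V)"
  using assms(1)[unfolded schwartz_topology_def openin_topology_generated_by_iff] assms(2)
proof (induction V rule: generate_topology_on.induct)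
  case (Int V W)
  obtain L N \<delta> where 1: "\<delta> > 0" "\<And>\<eta>. \<eta>\<in>schwartz_space \<Longrightarrow> decay_bound L N \<delta> \<eta> \<Longrightarrow> \<eta> \<in> V" using Int by blast
  obtain L' N' \<delta>' where 2: "\<delta>' > 0" "\<And>\<eta>. \<eta>\<in>schwartz_space \<Longrightarrow> decay_bound L' N' \<delta>' \<eta> \<Longrightarrow> \<eta> \<in> W" using Int by blast
  show ?case
  proof (rule exI[of _ "max L L'"], rule exI[of _ "max N N'"], rule exI[of _ "min \<delta> \<delta>'"], intro conjI ballI impI)
    fix \<eta> :: "real^'n \<Rightarrow> complex" assume a: "\<eta> \<in> schwartz_space" "decay_bound (max L L') (max N N') (min \<delta> \<delta>') \<eta>"
    have "decay_bound L N \<delta> \<eta>" by (rule decay_bound_mono[OF a(2)]) auto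
    moreover have "decay_bound L' N' \<delta>' \<eta>" by (rule decay_bound_mono[OF a(2)]) auto
    ultimately show "\<eta> \<in> V \<inter> W" using 1 2 a by blast
  qed (use 1 2 in simp)
next
  case (UN K)
  then obtain V where V: "V \<in> K" "(\<lambda>x. 0) \<in> V" by blast
  then show ?case using UN.IH[of V] by blast
next
  case (Basis V)
  then obtain k \<beta> \<psi> \<epsilon> where V: "V = {\<eta> \<in> schwartz_space. schwartz_seminorm k \<beta> (\<lambda>x. \<eta> x - \<psi> x) < ennreal \<epsilon>}"
      and \<psi>: "\<psi> \<in> schwartz_space" and \<epsilon>: "0 < \<epsilon>" by blast
  have "schwartz_seminorm k \<beta> (\<lambda>x. 0 - \<psi> x) < ennreal \<epsilon>" using Basis V by auto
  then obtain \<delta>0 where \<delta>0: "\<delta>0 \<ge> 0" "\<delta>0 < \<epsilon>" "schwartz_seminorm k \<beta> (\<lambda>x. 0 - \<psi> x) \<le> ennreal \<delta>0"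
  proof (cases "schwartz_seminorm k \<beta> (\<lambda>x. 0 - \<psi> x)")
    case (real r)
    then show ?thesis
      using \<open>schwartz_seminorm k \<beta> (\<lambda>x. 0 - \<psi> x) < ennreal \<epsilon>\<close> by (intro that[of r]) (auto simp: ennreal_less_iff)
  qed auto
  define \<delta> where "\<delta> = (\<epsilon> - \<delta>0) / 2"
  have neg: "multi_deriv \<beta> (\<lambda>x. \<eta> x - \<psi> x) x = multi_deriv \<beta> \<eta> x - multi_deriv \<beta> \<psi> x" if "\<eta> \<in> schwartz_space" for \<eta> x
    using foldr_partial_deriv_lincomb[OF schwartz_smooth[OF that] schwartz_smooth[OF \<psi>], of "order_list \<beta>" 1 "-1"]
    by (simp add: multi_deriv_eq)
  have z: "multi_deriv \<beta> (\<lambda>x. 0 - \<psi> x) x = - multi_deriv \<beta> \<psi> x" for x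
    using foldr_partial_deriv_lincomb[OF schwartz_smooth[OF \<psi>] schwartz_smooth[OF \<psi>], of "order_list \<beta>" "-1" 0]
    by (simp add: multi_deriv_eq)
  have b0: "norm (multi_deriv \<beta> \<psi> x) * (1 + norm x) ^ k \<le> \<delta>0" for x
    using \<delta>0 z by (subst (asm) schwartz_seminorm_le_iff) auto
  show ?case
  proof (rule exI[of _ "multi_order \<beta>"], rule exI[of _ k], rule exI[of _ \<delta>], intro conjI ballI impI)
    fix \<eta> :: "real^'n \<Rightarrow> complex" assume a: "\<eta> \<in> schwartz_space" "decay_bound (multi_order \<beta>) k \<delta> \<eta>"
    have "schwartz_seminorm k \<beta> (\<lambda>x. \<eta> x - \<psi> x) \<le> ennreal (\<delta> + \<delta>0)"
    proof (subst schwartz_seminorm_le_iff)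
      show "\<forall>x. norm (multi_deriv \<beta> (\<lambda>x. \<eta> x - \<psi> x) x) * (1 + norm x) ^ k \<le> \<delta> + \<delta>0"
      proof
        fix x
        have "norm (multi_deriv \<beta> (\<lambda>x. \<eta> x - \<psi> x) x) * (1 + norm x) ^ k
           \<le> (norm (multi_deriv \<beta> \<eta> x) + norm (multi_deriv \<beta> \<psi> x)) * (1 + norm x) ^ k"
          unfolding neg[OF a(1)] by (intro mult_right_mono norm_triangle_ineq4) auto
        also have "\<dots> \<le> \<delta> + \<delta>0"
          using b0[of x] decay_boundD[OF a(2), of "order_list \<beta>" x]
          by (simp add: multi_deriv_eq length_order_list distrib_right)
        finally show "norm (multi_deriv \<beta> (\<lambda>x. \<eta> x - \<psi> x) x) * (1 + norm x) ^ k \<le> \<delta> + \<delta>0" .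
      qed
    qed (use \<delta>0 in \<open>simp add: \<delta>_def\<close>)
    also have "\<dots> < ennreal \<epsilon>" using \<delta>0 by (intro ennreal_lessI) (auto simp: \<delta>_def field_simps)
    finally show "\<eta> \<in> V" using a V by simp
  qed (use \<delta>0 in \<open>simp add: \<delta>_def\<close>)
qed auto

text \<open>
  The preimage of the unit disc under \<open>f\<close> is a neighbourhood of zero, and linearity turns this into a bound:
  \<open>f\<close> has finite order.
\<close>

lemma tempered_bound:
  fixes f :: "(real^'n \<Rightarrow> complex) \<Rightarrow> complex"
  assumes f: "f \<in> tempered_distributions"
  obtains C L N where "C > 0"
    "\<And>\<psi> A. \<psi> \<in> schwartz_space \<Longrightarrow> decay_bound L N A \<psi> \<Longrightarrow> norm (f \<psi>) \<le> C * A"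
proof -
  have cont: "continuous_map schwartz_topology euclidean f" using f by (simp add: tempered_distributions_def)
  define V where "V = {\<psi> \<in> schwartz_space. f \<psi> \<in> ball 0 1}"
  have opn: "openin schwartz_topology V"
    using openin_continuous_map_preimage[OF cont, of "ball 0 1"] by (simp add: V_def topspace_schwartz)
  have zero: "(\<lambda>x. 0) \<in> V"
    using tempered_scale[OF f zero_schwartz, of 0] by (simp add: V_def zero_schwartz)
  obtain L N \<delta> where \<delta>V: "\<delta> > 0 \<and> (\<forall>\<eta>\<in>schwartz_space. decay_bound L N \<delta> \<eta> \<longrightarrow> \<eta> \<in> V)"
    using schwartz_neighbourhood_zero[OF opn zero] by (elim exE)
  then have \<delta>: "\<delta> > 0" and V: "\<And>\<eta>. \<eta> \<in> schwartz_space \<Longrightarrow> decay_bound L N \<delta> \<eta> \<Longrightarrow> \<eta> \<in> V"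
    by simp_all
  have "norm (f \<psi>) \<le> 1 / \<delta> * A" if S: "\<psi> \<in> schwartz_space" and d: "decay_bound L N A \<psi>" for \<psi> A
  proof -
    have le: "norm (f \<psi>) \<le> 1 / \<delta> * (A + e)" if e: "e > 0" for e
    proof -
      have A: "A + e > 0" using decay_bound_nonneg[OF d] e by simp
      define b where "b = \<delta> / (A + e)"
      have b: "b > 0" using A \<delta> by (simp add: b_def)
      have "decay_bound L N (norm (complex_of_real b) * (A + e) + norm (0::complex) * A) (\<lambda>z. complex_of_real b * \<psi> z + 0 * \<psi> z)"
        by (rule decay_bound_lincomb[OF schwartz_smooth[OF S] schwartz_smooth[OF S] decay_bound_mono[OF d] d]) (use e in auto)
      moreover have "norm (complex_of_real b) * (A + e) = \<delta>" 
      proof -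
        have "norm (complex_of_real b) = b" using b by simp
        moreover have "b * (A + e) = \<delta>" using A by (simp add: b_def)
        ultimately show ?thesis by simp
      qed
      ultimately have "decay_bound L N \<delta> (\<lambda>z. complex_of_real b * \<psi> z)" by simp
      moreover have "(\<lambda>z. complex_of_real b * \<psi> z) \<in> schwartz_space"
        using schwartz_lincomb[OF S S, of "complex_of_real b" 0] by simp
      ultimately have "(\<lambda>z. complex_of_real b * \<psi> z) \<in> V" using V by blast
      then have "b * norm (f \<psi>) < 1" using b tempered_scale[OF f S, of "complex_of_real b"] by (simp add: V_def norm_mult)
      then show ?thesis using A \<delta> by (simp add: b_def field_simps)
    qed
    have "norm (f \<psi>) \<le> 1 / \<delta> * A + e" if "e > 0" for e
      using le[of "\<delta> * e"] that \<delta> by (simp add: algebra_simps)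
    then show ?thesis by (rule field_le_epsilon)
  qed
  then show ?thesis using \<delta> by (intro that[of "1 / \<delta>"]) auto
qed


section \<open>Convolution of Schwartz functions\<close>

text \<open>
  The kernel is dominated by a sum over concentric balls, with \<open>i\<close> the least index whose ball contains
  \<open>y\<close>.  This reduces integrals against the kernel to integrals over balls.
\<close>

lemma decay_kernel_le_annuli:
  fixes y :: "'a::euclidean_space"
  shows "ennreal (1 / (1 + norm y) ^ (d + 1)) \<le> (\<Sum>i. ennreal (2 ^ (d + 1) / 2 ^ (i * (d + 1))) * indicator (ball 0 (2 ^ i)) y)"
proof -
  define i where "i = (LEAST i. norm y < 2 ^ i)"
  have "\<exists>i. norm y < 2 ^ i" by (rule real_arch_pow) simp
  then have i: "norm y < 2 ^ i" unfolding i_def by (rule LeastI_ex)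
  have "1 / (1 + norm y) ^ (d + 1) \<le> 2 ^ (d + 1) / 2 ^ (i * (d + 1))"
  proof -
    have "(2::real) ^ i \<le> 2 * (1 + norm y)"
    proof (cases i)
      case (Suc k)
      then have "\<not> norm y < 2 ^ k" unfolding i_def using not_less_Least[of k "\<lambda>i. norm y < 2 ^ i"] by auto
      then show ?thesis using Suc by simp
    qed (use norm_ge_zero[of y] in simp)
    then have "((2::real) ^ i) ^ (d + 1) \<le> (2 * (1 + norm y)) ^ (d + 1)" by (intro power_mono) auto
    then have "(2::real) ^ (i * (d + 1)) \<le> 2 ^ (d + 1) * (1 + norm y) ^ (d + 1)"
      by (simp only: power_mult power_mult_distrib)
    moreover have "(1 + norm y) ^ (d + 1) > 0" by (simp add: add_pos_nonneg)
    ultimately show ?thesis by (simp add: divide_simps mult.commute)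
  qed
  then have "ennreal (1 / (1 + norm y) ^ (d + 1)) \<le> ennreal (2 ^ (d + 1) / 2 ^ (i * (d + 1))) * indicator (ball 0 (2 ^ i)) y"
    using i by (simp add: ennreal_leI)
  also have "\<dots> = (\<Sum>j\<in>{i}. ennreal (2 ^ (d + 1) / 2 ^ (j * (d + 1))) * indicator (ball 0 (2 ^ j)) y)"
    by (simp only: sum.insert[OF finite.emptyI] empty_iff not_False_eq_True sum.empty add_0_right)
  also have "\<dots> \<le> (\<Sum>j. ennreal (2 ^ (d + 1) / 2 ^ (j * (d + 1))) * indicator (ball 0 (2 ^ j)) y)"
    by (rule sum_le_suminf) auto
  finally show ?thesis .
qed

lemma decay_kernel_integral_le:
  fixes V :: "'a::euclidean_space \<Rightarrow> ennreal"
  assumes V: "V \<in> borel_measurable borel" and M: "M \<ge> 0"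
    and le: "\<And>\<rho>. \<rho> > 0 \<Longrightarrow> (\<integral>\<^sup>+y\<in>ball 0 \<rho>. V y \<partial>lborel) \<le> ennreal (M * \<rho> ^ d)"
  shows "(\<integral>\<^sup>+y. ennreal (1 / (1 + norm y) ^ (d + 1)) * V y \<partial>lborel) \<le> ennreal (2 ^ (d + 2) * M)"
proof -
  let ?c = "\<lambda>i. ennreal (2 ^ (d + 1) / 2 ^ (i * (d + 1)))"
  have ind: "(\<lambda>y. indicator (ball (0::'a) r) y :: ennreal) \<in> borel_measurable borel" for r
    by (intro borel_measurable_indicator) auto
  have "(\<integral>\<^sup>+y. ennreal (1 / (1 + norm y) ^ (d + 1)) * V y \<partial>lborel) \<le> (\<integral>\<^sup>+y. (\<Sum>i. ?c i * (V y * indicator (ball 0 (2 ^ i)) y)) \<partial>lborel)"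
  proof (rule nn_integral_mono)
    fix y :: 'a
    have "ennreal (1 / (1 + norm y) ^ (d + 1)) * V y \<le> (\<Sum>i. ?c i * indicator (ball 0 (2 ^ i)) y) * V y"
      by (intro mult_right_mono decay_kernel_le_annuli) auto
    also have "\<dots> = (\<Sum>i. ?c i * indicator (ball 0 (2 ^ i)) y * V y)" by simp
    finally show "ennreal (1 / (1 + norm y) ^ (d + 1)) * V y \<le> (\<Sum>i. ?c i * (V y * indicator (ball 0 (2 ^ i)) y))"
      by (simp only: mult_ac)
  qed
  also have "\<dots> = (\<Sum>i. \<integral>\<^sup>+y. ?c i * (V y * indicator (ball 0 (2 ^ i)) y) \<partial>lborel)"
    by (rule nn_integral_suminf) (use V ind in measurable)
  also have "\<dots> \<le> (\<Sum>i. ennreal (2 ^ (d + 1) * M * (1 / 2) ^ i))"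
  proof (intro suminf_le)
    fix i
    have "(\<integral>\<^sup>+y. ?c i * (V y * indicator (ball 0 (2 ^ i)) y) \<partial>lborel) = ?c i * (\<integral>\<^sup>+y\<in>ball 0 (2 ^ i). V y \<partial>lborel)"
      by (rule nn_integral_cmult) (use V ind in measurable)
    also have "\<dots> \<le> ?c i * ennreal (M * (2 ^ i) ^ d)" by (intro mult_left_mono le) auto
    also have "\<dots> = ennreal (2 ^ (d + 1) / 2 ^ (i * (d + 1)) * (M * (2 ^ i) ^ d))" using M by (simp flip: ennreal_mult)
    also have "2 ^ (d + 1) / 2 ^ (i * (d + 1)) * (M * (2 ^ i) ^ d) = 2 ^ (d + 1) * M * (1 / 2) ^ i"
      by (simp add: power_add power_mult[symmetric] power_one_over field_simps)
    finally show "(\<integral>\<^sup>+y. ?c i * (V y * indicator (ball 0 (2 ^ i)) y) \<partial>lborel) \<le> ennreal (2 ^ (d + 1) * M * (1 / 2) ^ i)" .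
  qed auto
  also have "\<dots> = ennreal (2 ^ (d + 1) * M * 2)"
  proof (rule suminf_ennreal_eq)
    have "(\<lambda>i. (1 / 2 :: real) ^ i) sums 2" using geometric_sums[of "1/2 :: real"] by simp
    then show "(\<lambda>i. 2 ^ (d + 1) * M * (1 / 2) ^ i) sums (2 ^ (d + 1) * M * 2)" by (rule sums_mult)
  qed (use M in simp)
  finally show ?thesis by (simp add: mult_ac)
qed

lemma nn_integral_decay_kernel_finite:
  "(\<integral>\<^sup>+y. ennreal (1 / (1 + norm (y::'a::euclidean_space)) ^ (DIM('a) + 1)) \<partial>lborel) < \<infinity>"
proof -
  have "(\<integral>\<^sup>+y. ennreal (1 / (1 + norm (y::'a)) ^ (DIM('a) + 1)) * 1 \<partial>lborel) \<le> ennreal (2 ^ (DIM('a) + 2) * measure lborel (ball (0::'a) 1))"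
  proof (rule decay_kernel_integral_le)
    fix \<rho> :: real assume \<rho>: "\<rho> > 0"
    have "(\<integral>\<^sup>+y\<in>ball (0::'a) \<rho>. 1 \<partial>lborel) = emeasure lborel (ball (0::'a) \<rho>)" by simp
    also have "\<dots> = ennreal (measure lborel (ball (0::'a) \<rho>))"
      using emeasure_lborel_ball_finite[of "0::'a" \<rho>] by (intro emeasure_eq_ennreal_measure) auto
    also have "measure lborel (ball (0::'a) \<rho>) = measure lborel (ball (0::'a) 1) * \<rho> ^ DIM('a)"
      using \<rho> content_ball_conv_unit_ball[of \<rho> "0::'a"] by simp
    finally show "(\<integral>\<^sup>+y\<in>ball (0::'a) \<rho>. 1 \<partial>lborel) \<le> ennreal (measure lborel (ball (0::'a) 1) * \<rho> ^ DIM('a))" by simp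
  qed auto
  then show ?thesis by (simp add: le_less_trans)
qed

lemma schwartz_borel_measurable: "\<psi> \<in> schwartz_space \<Longrightarrow> \<psi> \<in> borel_measurable borel"
  by (intro borel_measurable_continuous_onI smooth_continuous_on schwartz_smooth)

lemma schwartz_moment_integrable:
  fixes \<eta> :: "real^'n \<Rightarrow> complex"
  assumes S: "\<eta> \<in> schwartz_space"
  shows "integrable lborel (\<lambda>y. norm (\<eta> y) * (1 + norm y) ^ N)"
proof (rule integrableI_bounded)
  have [measurable]: "\<eta> \<in> borel_measurable borel" using S by (rule schwartz_borel_measurable)
  show "(\<lambda>y. norm (\<eta> y) * (1 + norm y) ^ N) \<in> borel_measurable lborel" by measurable
  let ?d = "DIM(real^'n)"
  obtain A where A: "A > 0" "decay_bound 0 (N + (?d + 1)) A \<eta>" using S by (rule schwartz_decay)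
  have "(\<integral>\<^sup>+y. ennreal (norm (norm (\<eta> y) * (1 + norm y) ^ N)) \<partial>lborel) \<le> (\<integral>\<^sup>+y. ennreal A * ennreal (1 / (1 + norm (y :: real^'n)) ^ (?d + 1)) \<partial>lborel)"
  proof (rule nn_integral_mono)
    fix y :: "real^'n"
    have "norm (\<eta> y) * (1 + norm y) ^ N \<le> A / (1 + norm y) ^ (?d + 1)"
    proof -
      have "norm (\<eta> y) * (1 + norm y) ^ N * (1 + norm y) ^ (?d + 1) \<le> A"
        using decay_bound_value[OF A(2), of y] by (simp only: power_add mult.assoc)
      moreover have "(1 + norm y) ^ (?d + 1) > 0" by (simp add: add_pos_nonneg)
      ultimately show ?thesis using pos_le_divide_eq by blast
    qed
    then show "ennreal (norm (norm (\<eta> y) * (1 + norm y) ^ N)) \<le> ennreal A * ennreal (1 / (1 + norm y) ^ (?d + 1))"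
      using A(1) by (simp flip: ennreal_mult' add: ennreal_leI)
  qed
  also have "\<dots> = ennreal A * (\<integral>\<^sup>+y. ennreal (1 / (1 + norm (y::real^'n)) ^ (?d + 1)) \<partial>lborel)"
    by (rule nn_integral_cmult) auto
  also have "\<dots> < \<infinity>"
    using nn_integral_decay_kernel_finite[where 'a = "real^'n"] by (simp add: ennreal_mult_less_top)
  finally show "(\<integral>\<^sup>+y. ennreal (norm (norm (\<eta> y) * (1 + norm y) ^ N)) \<partial>lborel) < \<infinity>" .
qed

lemma schwartz_integrable:
  fixes \<eta> :: "real^'n \<Rightarrow> complex"
  assumes "\<eta> \<in> schwartz_space" shows "integrable lborel \<eta>"
  using schwartz_moment_integrable[OF assms, of 0] schwartz_borel_measurable[OF assms] by (simp add: integrable_norm_iff)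

definition moment :: "nat \<Rightarrow> (real^'n \<Rightarrow> complex) \<Rightarrow> real" where
  "moment N \<eta> = (LINT y|lborel. norm (\<eta> y) * (1 + norm y) ^ N)"

lemma moment_nonneg: "0 \<le> moment N \<eta>"
  unfolding moment_def by (intro integral_nonneg_AE) auto

text \<open>
  The convolution of \<open>\<theta>\<close> with \<open>s\<^sup>-\<^sup>n \<eta>(\<cdot>/s)\<close>.  The scale is moved to the argument of \<open>\<theta>\<close>, so that the bounds
  involve moments of \<open>\<eta>\<close> itself and the formula makes sense for negative \<open>s\<close>, too.
\<close>

definition scaled_conv :: "real \<Rightarrow> (real^'n \<Rightarrow> complex) \<Rightarrow> (real^'n \<Rightarrow> complex) \<Rightarrow> real^'n \<Rightarrow> complex" where
  "scaled_conv s \<eta> \<theta> x = (LINT y|lborel. \<eta> y * \<theta> (x - s *\<^sub>R y))"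

lemma integrable_mult_of_moment_bound:
  fixes \<eta> g :: "real^'n \<Rightarrow> complex"
  assumes \<eta>: "\<eta> \<in> schwartz_space" and g: "g \<in> borel_measurable borel"
    and le: "\<And>y. norm (g y) \<le> B * (1 + norm y) ^ N"
  shows "integrable lborel (\<lambda>y. \<eta> y * g y)" "norm (LINT y|lborel. \<eta> y * g y) \<le> B * moment N \<eta>"
proof -
  have [measurable]: "\<eta> \<in> borel_measurable borel" using \<eta> by (rule schwartz_borel_measurable)
  note g [measurable]
  have i: "integrable lborel (\<lambda>y. B * (norm (\<eta> y) * (1 + norm y) ^ N))"
    using schwartz_moment_integrable[OF \<eta>] by (intro integrable_mult_right)
  have pw: "norm (\<eta> y * g y) \<le> B * (norm (\<eta> y) * (1 + norm y) ^ N)" for y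
    using mult_left_mono[OF le[of y], of "norm (\<eta> y)"] by (simp add: norm_mult mult_ac)
  show int: "integrable lborel (\<lambda>y. \<eta> y * g y)"
    by (rule Bochner_Integration.integrable_bound[OF i]) (use pw in \<open>auto intro!: AE_I2 order_trans[OF pw]\<close>)
  have "norm (LINT y|lborel. \<eta> y * g y) \<le> (LINT y|lborel. B * (norm (\<eta> y) * (1 + norm y) ^ N))"
    by (rule Bochner_Integration.integral_norm_bound_integral[OF int i pw])
  then show "norm (LINT y|lborel. \<eta> y * g y) \<le> B * moment N \<eta>" by (simp add: moment_def)
qed

lemma scaled_conv_integrable:
  fixes \<eta> \<theta> :: "real^'n \<Rightarrow> complex"
  assumes "\<eta> \<in> schwartz_space" "\<theta> \<in> schwartz_space"
  shows "integrable lborel (\<lambda>y. \<eta> y * \<theta> (x - s *\<^sub>R y))"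
proof -
  have [measurable]: "\<theta> \<in> borel_measurable borel" using assms(2) by (rule schwartz_borel_measurable)
  obtain A where A: "A > 0" "decay_bound 0 0 A \<theta>" using assms(2) by (rule schwartz_decay)
  show ?thesis
    by (rule integrable_mult_of_moment_bound(1)[OF assms(1), where B = A and N = 0])
      (use decay_bound_value[OF A(2)] in auto)
qed

text \<open>
  Differentiation under the integral: all second derivatives of \<open>\<theta>\<close> are bounded, so the error of the linear
  approximation is quadratic, uniformly in the integration variable.
\<close>

lemma scaled_conv_has_derivative:
  fixes \<eta> \<theta> :: "real^'n \<Rightarrow> complex"
  assumes \<eta>: "\<eta> \<in> schwartz_space" and \<theta>: "\<theta> \<in> schwartz_space"
  shows "(scaled_conv s \<eta> \<theta> has_derivative (\<lambda>h. \<Sum>i\<in>UNIV. (h $ i) *\<^sub>R scaled_conv s \<eta> (partial_deriv i \<theta>) x)) (at x)"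
proof -
  have \<theta>': "partial_deriv i \<theta> \<in> schwartz_space" for i using \<theta> by (rule schwartz_partial_deriv)
  obtain A where A: "A > 0" "decay_bound 2 0 A \<theta>" using \<theta> by (rule schwartz_decay)
  define K where "K = (real CARD('n))\<^sup>2 * A"
  have [measurable]: "\<theta> \<in> borel_measurable borel" "\<And>i. partial_deriv i \<theta> \<in> borel_measurable borel"
    using \<theta> \<theta>' by (auto intro: schwartz_borel_measurable)
  show ?thesis
  proof (rule has_derivativeI_sandwich[where e = 1 and H = "\<lambda>y. (K * moment 0 \<eta>) * norm (y - x)"])
    show "bounded_linear (\<lambda>h. \<Sum>i\<in>UNIV. (h $ i) *\<^sub>R scaled_conv s \<eta> (partial_deriv i \<theta>) x)"
      by (intro bounded_linear_sum bounded_linear_scaleR_const bounded_linear_vec_nth)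
    fix y assume "y \<noteq> x"
    let ?v = "y - x"
    have int: "integrable lborel (\<lambda>w. \<eta> w * \<theta> (z - s *\<^sub>R w))" "integrable lborel (\<lambda>w. \<eta> w * partial_deriv i \<theta> (z - s *\<^sub>R w))" for z i
      using scaled_conv_integrable[OF \<eta>] \<theta> \<theta>' by auto
    have "scaled_conv s \<eta> \<theta> y - scaled_conv s \<eta> \<theta> x - (\<Sum>i\<in>UNIV. (?v $ i) *\<^sub>R scaled_conv s \<eta> (partial_deriv i \<theta>) x)
      = (LINT w|lborel. \<eta> w * (\<theta> (x - s *\<^sub>R w + ?v) - \<theta> (x - s *\<^sub>R w) - (\<Sum>i\<in>UNIV. (?v $ i) *\<^sub>R partial_deriv i \<theta> (x - s *\<^sub>R w))))"
    proof -
      have e: "x - s *\<^sub>R w + ?v = y - s *\<^sub>R w" for w by simp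
      have "(LINT w|lborel. \<eta> w * (\<theta> (y - s *\<^sub>R w) - \<theta> (x - s *\<^sub>R w) - (\<Sum>i\<in>UNIV. (?v $ i) *\<^sub>R partial_deriv i \<theta> (x - s *\<^sub>R w))))
        = (LINT w|lborel. \<eta> w * \<theta> (y - s *\<^sub>R w) - \<eta> w * \<theta> (x - s *\<^sub>R w) - (\<Sum>i\<in>UNIV. (?v $ i) *\<^sub>R (\<eta> w * partial_deriv i \<theta> (x - s *\<^sub>R w))))"
        by (simp add: right_diff_distrib sum_distrib_left)
      also have "\<dots> = scaled_conv s \<eta> \<theta> y - scaled_conv s \<eta> \<theta> x - (\<Sum>i\<in>UNIV. (?v $ i) *\<^sub>R scaled_conv s \<eta> (partial_deriv i \<theta>) x)"
        using int unfolding scaled_conv_def by simp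
      finally show ?thesis by (simp only: e)
    qed
    also have "norm \<dots> \<le> (K * (norm ?v)\<^sup>2) * moment 0 \<eta>"
    proof (rule integrable_mult_of_moment_bound(2)[OF \<eta>])
      fix w
      have "norm (partial_deriv i (partial_deriv j \<theta>) z) \<le> A" for i j z
        using decay_boundD[OF A(2), of "[i, j]" z] by simp
      then show "norm (\<theta> (x - s *\<^sub>R w + ?v) - \<theta> (x - s *\<^sub>R w) - (\<Sum>i\<in>UNIV. (?v $ i) *\<^sub>R partial_deriv i \<theta> (x - s *\<^sub>R w))) \<le> K * (norm ?v)\<^sup>2 * (1 + norm w) ^ 0"
        using smooth_taylor_le[OF schwartz_smooth[OF \<theta>], of A "x - s *\<^sub>R w" ?v] by (simp add: K_def)
    qed measurable
    finally show "norm (scaled_conv s \<eta> \<theta> y - scaled_conv s \<eta> \<theta> x - (\<Sum>i\<in>UNIV. (?v $ i) *\<^sub>R scaled_conv s \<eta> (partial_deriv i \<theta>) x)) / norm ?v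
       \<le> (K * moment 0 \<eta>) * norm (y - x)"
      using \<open>y \<noteq> x\<close> by (simp add: divide_simps power2_eq_square mult_ac)
  next
    have "((\<lambda>y. (K * moment 0 \<eta>) * norm (y - x)) \<longlongrightarrow> (K * moment 0 \<eta>) * norm (x - x)) (at x)" by (intro tendsto_intros)
    then show "((\<lambda>y. (K * moment 0 \<eta>) * norm (y - x)) \<longlongrightarrow> 0) (at x)" by simp
  qed auto
qed

lemma partial_deriv_scaled_conv:
  assumes "\<eta> \<in> schwartz_space" "\<theta> \<in> schwartz_space"
  shows "partial_deriv i (scaled_conv s \<eta> \<theta>) = scaled_conv s \<eta> (partial_deriv i \<theta>)"
  by (rule ext, rule partial_deriv_eqI[OF scaled_conv_has_derivative[OF assms]])

lemma foldr_partial_deriv_scaled_conv: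
  assumes "\<eta> \<in> schwartz_space" "\<theta> \<in> schwartz_space"
  shows "foldr partial_deriv is (scaled_conv s \<eta> \<theta>) = scaled_conv s \<eta> (foldr partial_deriv is \<theta>)"
  by (induction "is") (simp_all add: partial_deriv_scaled_conv[OF assms(1) schwartz_foldr[OF assms(2)]])

lemma smooth_scaled_conv:
  assumes "\<eta> \<in> schwartz_space" "\<theta> \<in> schwartz_space"
  shows "smooth (scaled_conv s \<eta> \<theta>)"
proof (rule smooth_coinduct[where P = "\<lambda>g. \<exists>\<theta>\<in>schwartz_space. g = scaled_conv s \<eta> \<theta>"])
  fix g x i assume "\<exists>\<theta>\<in>schwartz_space. g = scaled_conv s \<eta> \<theta>"
  then obtain \<theta> where \<theta>: "\<theta> \<in> schwartz_space" "g = scaled_conv s \<eta> \<theta>" by blast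
  show "g differentiable (at x)"
    unfolding \<theta>(2) by (rule differentiableI[OF scaled_conv_has_derivative[OF assms(1) \<theta>(1)]])
  show "\<exists>\<theta>\<in>schwartz_space. partial_deriv i g = scaled_conv s \<eta> \<theta>"
    unfolding \<theta>(2) partial_deriv_scaled_conv[OF assms(1) \<theta>(1)] using schwartz_partial_deriv[OF \<theta>(1)] by blast
qed (use assms in blast)

lemma one_plus_norm_shift_le:
  "1 + norm (x :: 'a::real_normed_vector) \<le> (1 + norm (x - y)) * (1 + norm y)"
proof -
  have "norm x \<le> norm (x - y) + norm y" using norm_triangle_sub[of x y] by simp
  then have "1 + norm x \<le> 1 + (norm (x - y) + norm y)" by simp
  also have "\<dots> \<le> (1 + norm (x - y)) * (1 + norm y)" by (simp add: algebra_simps)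
  finally show ?thesis .
qed

lemma scale_weight_le:
  "1 + norm (s *\<^sub>R y :: 'a::real_normed_vector) \<le> (1 + \<bar>s\<bar>) * (1 + norm y)"
  by (simp add: algebra_simps)

lemma decay_bound_scaled_conv:
  fixes \<eta> \<theta> :: "real^'n \<Rightarrow> complex"
  assumes \<eta>: "\<eta> \<in> schwartz_space" and \<theta>: "\<theta> \<in> schwartz_space" and d: "decay_bound L N A \<theta>"
  shows "decay_bound L N (A * (1 + \<bar>s\<bar>) ^ N * moment N \<eta>) (scaled_conv s \<eta> \<theta>)"
proof (rule decay_boundI)
  fix "is" :: "'n list" and x :: "real^'n" assume l: "length is \<le> L"
  let ?\<theta> = "foldr partial_deriv is \<theta>"
  have A: "A \<ge> 0" using d by (rule decay_bound_nonneg)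
  have \<theta>': "?\<theta> \<in> schwartz_space" using \<theta> by (rule schwartz_foldr)
  then have [measurable]: "?\<theta> \<in> borel_measurable borel" by (rule schwartz_borel_measurable)
  have x: "(1 + norm x) ^ N > 0" by (simp add: add_pos_nonneg)
  have "norm (LINT y|lborel. \<eta> y * ?\<theta> (x - s *\<^sub>R y)) \<le> (A * (1 + \<bar>s\<bar>) ^ N / (1 + norm x) ^ N) * moment N \<eta>"
  proof (rule integrable_mult_of_moment_bound(2)[OF \<eta>])
    fix y :: "real^'n"
    have "(1 + norm x) ^ N \<le> ((1 + norm (x - s *\<^sub>R y)) * ((1 + \<bar>s\<bar>) * (1 + norm y))) ^ N"
      by (intro power_mono order_trans[OF one_plus_norm_shift_le[of x "s *\<^sub>R y"] mult_left_mono] scale_weight_le) auto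
    then have "norm (?\<theta> (x - s *\<^sub>R y)) * (1 + norm x) ^ N \<le> norm (?\<theta> (x - s *\<^sub>R y)) * ((1 + norm (x - s *\<^sub>R y)) * ((1 + \<bar>s\<bar>) * (1 + norm y))) ^ N"
      by (rule mult_left_mono) auto
    also have "\<dots> = (norm (?\<theta> (x - s *\<^sub>R y)) * (1 + norm (x - s *\<^sub>R y)) ^ N) * ((1 + \<bar>s\<bar>) * (1 + norm y)) ^ N"
      by (simp add: power_mult_distrib mult_ac)
    also have "\<dots> \<le> A * ((1 + \<bar>s\<bar>) * (1 + norm y)) ^ N"
      by (intro mult_right_mono decay_boundD[OF d l]) auto
    also have "\<dots> = A * (1 + \<bar>s\<bar>) ^ N * (1 + norm y) ^ N" by (simp only: power_mult_distrib mult.assoc)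
    finally have "norm (?\<theta> (x - s *\<^sub>R y)) \<le> (A * (1 + \<bar>s\<bar>) ^ N * (1 + norm y) ^ N) / (1 + norm x) ^ N"
      using pos_le_divide_eq[OF x] by blast
    then show "norm (?\<theta> (x - s *\<^sub>R y)) \<le> A * (1 + \<bar>s\<bar>) ^ N / (1 + norm x) ^ N * (1 + norm y) ^ N" by simp
  qed measurable
  then show "norm (foldr partial_deriv is (scaled_conv s \<eta> \<theta>) x) * (1 + norm x) ^ N \<le> A * (1 + \<bar>s\<bar>) ^ N * moment N \<eta>"
    using x unfolding foldr_partial_deriv_scaled_conv[OF \<eta> \<theta>] scaled_conv_def by (simp add: field_simps)
qed

lemma schwartz_scaled_conv:
  assumes "\<eta> \<in> schwartz_space" "\<theta> \<in> schwartz_space"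
  shows "scaled_conv s \<eta> \<theta> \<in> schwartz_space"
  unfolding schwartz_iff
proof (intro conjI allI smooth_scaled_conv assms)
  fix L N
  obtain A where "decay_bound L N A \<theta>" using schwartz_decay[OF assms(2)] by metis
  then show "\<exists>A. decay_bound L N A (scaled_conv s \<eta> \<theta>)" using decay_bound_scaled_conv[OF assms] by blast
qed

lemma segment_weight_le:
  fixes x v z :: "'a::real_normed_vector"
  assumes "z \<in> closed_segment x (x + v)"
  shows "1 + norm x \<le> (1 + norm z) * (1 + norm v)"
proof -
  have "norm (x - z) \<le> norm v" using segment_bound1[OF assms] by (simp add: norm_minus_commute)
  then have "(1 + norm z) * (1 + norm (x - z)) \<le> (1 + norm z) * (1 + norm v)" by (intro mult_left_mono) auto
  then show ?thesis using one_plus_norm_shift_le[of x z] by (simp add: mult.commute)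
qed

text \<open>
  A difference with increment \<open>v\<close> decays like a derivative, up to a power of \<open>1 + |v|\<close> that accounts for
  the distance between \<open>x\<close> and the intermediate points.
\<close>

lemma decay_bound_diff_le:
  fixes \<theta> :: "real^'n \<Rightarrow> complex"
  assumes sm: "smooth \<theta>" and d: "decay_bound (Suc L) N A \<theta>" and l: "length is \<le> L"
  shows "norm (foldr partial_deriv is \<theta> (x + v) - foldr partial_deriv is \<theta> x) * (1 + norm x) ^ N
    \<le> real CARD('n) * A * norm v * (1 + norm v) ^ N"
proof -
  have x: "(1 + norm x) ^ N > 0" by (simp add: add_pos_nonneg)
  have "norm (foldr partial_deriv is \<theta> (x + v) - foldr partial_deriv is \<theta> x) \<le> real CARD('n) * (A * (1 + norm v) ^ N / (1 + norm x) ^ N) * norm v"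
  proof (rule smooth_diff_le[OF smooth_foldr[OF sm]])
    fix i z assume z: "z \<in> closed_segment x (x + v)"
    let ?p = "norm (partial_deriv i (foldr partial_deriv is \<theta>) z)"
    have "?p * (1 + norm x) ^ N \<le> ?p * ((1 + norm z) * (1 + norm v)) ^ N"
      by (intro mult_left_mono power_mono segment_weight_le[OF z]) auto
    also have "\<dots> = (?p * (1 + norm z) ^ N) * (1 + norm v) ^ N" by (simp add: power_mult_distrib)
    also have "\<dots> \<le> A * (1 + norm v) ^ N"
      using decay_boundD[OF d, of "i # is" z] l by (intro mult_right_mono) auto
    finally show "?p \<le> A * (1 + norm v) ^ N / (1 + norm x) ^ N" using x by (simp add: field_simps)
  qed
  also have "real CARD('n) * (A * (1 + norm v) ^ N / (1 + norm x) ^ N) * norm v = (real CARD('n) * A * norm v * (1 + norm v) ^ N) / (1 + norm x) ^ N"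
    by simp
  finally show ?thesis using pos_le_divide_eq[OF x] by blast
qed


section \<open>Moving a distribution under a convolution integral\<close>

lemma decay_bound_translate_diff:
  fixes \<theta> :: "real^'n \<Rightarrow> complex"
  assumes sm: "smooth \<theta>" and d: "decay_bound (Suc L) N A \<theta>" and l: "length is \<le> L"
  shows "norm (foldr partial_deriv is \<theta> (z - u) - foldr partial_deriv is \<theta> (z - v)) * (1 + norm z) ^ N
    \<le> real CARD('n) * A * norm (u - v) * (1 + norm (u - v)) ^ N * (1 + norm u) ^ N"
proof -
  let ?D = "norm (foldr partial_deriv is \<theta> (z - u) - foldr partial_deriv is \<theta> (z - v))"
  have "?D * (1 + norm z) ^ N \<le> ?D * ((1 + norm (z - u)) * (1 + norm u)) ^ N"
    by (intro mult_left_mono power_mono one_plus_norm_shift_le) auto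
  also have "\<dots> = (?D * (1 + norm (z - u)) ^ N) * (1 + norm u) ^ N" by (simp add: power_mult_distrib)
  also have "\<dots> \<le> (real CARD('n) * A * norm (u - v) * (1 + norm (u - v)) ^ N) * (1 + norm u) ^ N"
    using decay_bound_diff_le[OF sm d l, of "z - u" "u - v"] by (intro mult_right_mono) (auto simp: norm_minus_commute)
  finally show ?thesis .
qed

lemma tempered_translate_growth:
  fixes \<theta> :: "real^'n \<Rightarrow> complex"
  assumes f: "f \<in> tempered_distributions" and \<theta>: "\<theta> \<in> schwartz_space"
  obtains C N where "C > 0" "\<And>v. norm (f (\<lambda>z. \<theta> (z - v))) \<le> C * (1 + norm v) ^ N"
proof -
  obtain C L N where C: "C > 0" and fb: "\<And>\<psi> A. \<psi> \<in> schwartz_space \<Longrightarrow> decay_bound L N A \<psi> \<Longrightarrow> norm (f \<psi>) \<le> C * A"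
    using tempered_bound[OF f] by metis
  obtain A where A: "A > 0" "decay_bound L N A \<theta>" using schwartz_decay[OF \<theta>] by metis
  have "norm (f (\<lambda>z. \<theta> (z - v))) \<le> (C * A * 2 ^ L * 2 ^ N) * (1 + norm v) ^ N" for v
  proof -
    have "decay_bound L N (A * (2 ^ L * (2 * (1 + norm v)) ^ N)) (\<lambda>z. \<theta> (z - v))"
      using decay_bound_affine[OF schwartz_smooth[OF \<theta>] A(2), of 1 1 "- v"] by simp
    from fb[OF schwartz_translate[OF \<theta>] this]
    have "norm (f (\<lambda>z. \<theta> (z - v))) \<le> C * (A * (2 ^ L * (2 * (1 + norm v)) ^ N))" .
    also have "\<dots> = (C * A * 2 ^ L * 2 ^ N) * (1 + norm v) ^ N" by (simp only: power_mult_distrib mult_ac)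
    finally show ?thesis .
  qed
  then show ?thesis using A C by (intro that[of "C * A * 2 ^ L * 2 ^ N" N]) auto
qed

lemma tempered_translate_continuous:
  fixes \<theta> :: "real^'n \<Rightarrow> complex"
  assumes f: "f \<in> tempered_distributions" and \<theta>: "\<theta> \<in> schwartz_space"
  shows "continuous_on UNIV (\<lambda>v. f (\<lambda>z. \<theta> (z - v)))"
proof -
  obtain C L N where C: "C > 0" and fb: "\<And>\<psi> A. \<psi> \<in> schwartz_space \<Longrightarrow> decay_bound L N A \<psi> \<Longrightarrow> norm (f \<psi>) \<le> C * A"
    using tempered_bound[OF f] by metis
  obtain A where A: "A > 0" "decay_bound (Suc L) N A \<theta>" using schwartz_decay[OF \<theta>] by metis
  have le: "norm (f (\<lambda>z. \<theta> (z - u)) - f (\<lambda>z. \<theta> (z - v))) \<le> C * (real CARD('n) * A * norm (u - v) * (1 + norm (u - v)) ^ N * (1 + norm u) ^ N)" for u v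
  proof -
    have S: "(\<lambda>z. \<theta> (z - u)) \<in> schwartz_space" "(\<lambda>z. \<theta> (z - v)) \<in> schwartz_space" using schwartz_translate[OF \<theta>] by auto
    have tr: "foldr partial_deriv is (\<lambda>z. \<theta> (z - w)) = (\<lambda>z. foldr partial_deriv is \<theta> (z - w))" for "is" w
      using foldr_partial_deriv_affine[OF schwartz_smooth[OF \<theta>], of "is" 1 "- w" 1] by simp
    have "decay_bound L N (real CARD('n) * A * norm (u - v) * (1 + norm (u - v)) ^ N * (1 + norm u) ^ N) (\<lambda>z. \<theta> (z - u) - \<theta> (z - v))"
    proof (rule decay_boundI)
      fix "is" :: "'n list" and z :: "real^'n" assume l: "length is \<le> L"
      show "norm (foldr partial_deriv is (\<lambda>z. \<theta> (z - u) - \<theta> (z - v)) z) * (1 + norm z) ^ N \<le> real CARD('n) * A * norm (u - v) * (1 + norm (u - v)) ^ N * (1 + norm u) ^ N"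
        using foldr_partial_deriv_lincomb[OF schwartz_smooth[OF S(1)] schwartz_smooth[OF S(2)], of "is" 1 "-1"]
          decay_bound_translate_diff[OF schwartz_smooth[OF \<theta>] A(2) l, of z u v] by (simp add: tr)
    qed
    moreover have "(\<lambda>z. \<theta> (z - u) - \<theta> (z - v)) \<in> schwartz_space" using schwartz_lincomb[OF S, of 1 "-1"] by simp
    ultimately show ?thesis by (subst tempered_diff[OF f S, symmetric]) (rule fb)
  qed
  have "((\<lambda>v. f (\<lambda>z. \<theta> (z - v))) \<longlongrightarrow> f (\<lambda>z. \<theta> (z - u))) (at u)" for u
  proof (rule LIM_zero_cancel, rule Lim_null_comparison)
    let ?b = "\<lambda>v. C * (real CARD('n) * A * norm (u - v) * (1 + norm (u - v)) ^ N * (1 + norm u) ^ N)"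
    show "\<forall>\<^sub>F v in at u. norm (f (\<lambda>z. \<theta> (z - v)) - f (\<lambda>z. \<theta> (z - u))) \<le> ?b v"
      by (intro always_eventually allI, subst norm_minus_commute, rule le)
    have "(?b \<longlongrightarrow> ?b u) (at u)" by (intro tendsto_intros)
    then show "(?b \<longlongrightarrow> 0) (at u)" by simp
  qed
  then show ?thesis by (simp add: continuous_on_def)
qed

lemma schwartz_sum_translates:
  fixes \<theta> :: "real^'n \<Rightarrow> complex"
  assumes f: "f \<in> tempered_distributions" and \<theta>: "\<theta> \<in> schwartz_space" and V: "finite V"
  shows "(\<lambda>z. \<Sum>v\<in>V. c v * \<theta> (z - p v)) \<in> schwartz_space \<and>
    f (\<lambda>z. \<Sum>v\<in>V. c v * \<theta> (z - p v)) = (\<Sum>v\<in>V. c v * f (\<lambda>z. \<theta> (z - p v))) \<and>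
    foldr partial_deriv is (\<lambda>z. \<Sum>v\<in>V. c v * \<theta> (z - p v)) = (\<lambda>z. \<Sum>v\<in>V. c v * foldr partial_deriv is \<theta> (z - p v))"
  using V
proof induction
  case empty
  show ?case
    using zero_schwartz tempered_scale[OF f zero_schwartz, of 0]
      foldr_partial_deriv_lincomb[OF schwartz_smooth[OF zero_schwartz] schwartz_smooth[OF zero_schwartz], of "is" 0 0] by simp
next
  case (insert v V)
  let ?g = "\<lambda>z. \<Sum>v\<in>V. c v * \<theta> (z - p v)"
  have S: "(\<lambda>z. \<theta> (z - p v)) \<in> schwartz_space" "?g \<in> schwartz_space" using insert schwartz_translate[OF \<theta>] by auto
  have eq: "(\<lambda>z. \<Sum>v\<in>insert v V. c v * \<theta> (z - p v)) = (\<lambda>z. c v * \<theta> (z - p v) + 1 * ?g z)" using insert by simp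
  have tr: "foldr partial_deriv is (\<lambda>z. \<theta> (z - p v)) = (\<lambda>z. foldr partial_deriv is \<theta> (z - p v))"
    using foldr_partial_deriv_affine[OF schwartz_smooth[OF \<theta>], of "is" 1 "- p v" 1] by simp
  show ?case unfolding eq
    using schwartz_lincomb[OF S, of "c v" 1] tempered_lincomb[OF f S, of "c v" 1]
      foldr_partial_deriv_lincomb[OF schwartz_smooth[OF S(1)] schwartz_smooth[OF S(2)], of "is" "c v" 1] insert tr by simp
qed

lemma integral_simple_substitution:
  fixes \<eta> :: "'a \<Rightarrow> complex" and h :: "'b \<Rightarrow> complex"
  assumes \<eta>: "integrable M \<eta>" and \<sigma>: "simple_function M \<sigma>"
  shows "(LINT w|M. \<eta> w * h (\<sigma> w)) = (\<Sum>v\<in>\<sigma> ` space M. (LINT w|M. \<eta> w * indicator (\<sigma> -` {v} \<inter> space M) w) * h v)"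
    and "integrable M (\<lambda>w. \<eta> w * h (\<sigma> w))"
proof -
  have fin: "finite (\<sigma> ` space M)" and sets: "\<And>v. v \<in> \<sigma> ` space M \<Longrightarrow> \<sigma> -` {v} \<inter> space M \<in> sets M"
    using \<sigma> by (auto simp: simple_function_def)
  have eq: "\<eta> w * h (\<sigma> w) = (\<Sum>v\<in>\<sigma> ` space M. (\<eta> w * indicator (\<sigma> -` {v} \<inter> space M) w) * h v)" if "w \<in> space M" for w
  proof -
    have "(\<Sum>v\<in>\<sigma> ` space M. (\<eta> w * indicator (\<sigma> -` {v} \<inter> space M) w) * h v) = (\<Sum>v\<in>\<sigma> ` space M. if v = \<sigma> w then \<eta> w * h v else 0)"
      using that by (intro sum.cong) (auto simp: indicator_def)
    then show ?thesis using fin that by simp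
  qed
  have int: "integrable M (\<lambda>w. (\<eta> w * indicator (\<sigma> -` {v} \<inter> space M) w) * h v)" if "v \<in> \<sigma> ` space M" for v
  proof -
    have "integrable M (\<lambda>w. indicator (\<sigma> -` {v} \<inter> space M) w *\<^sub>R \<eta> w)"
      using sets[OF that] \<eta> by (rule integrable_mult_indicator)
    then have "integrable M (\<lambda>w. \<eta> w * indicator (\<sigma> -` {v} \<inter> space M) w)"
      by (rule Bochner_Integration.integrable_cong[THEN iffD1, rotated 2]) (auto simp: indicator_def)
    then show ?thesis by (rule integrable_mult_left)
  qed
  have "(LINT w|M. \<eta> w * h (\<sigma> w)) = (LINT w|M. (\<Sum>v\<in>\<sigma> ` space M. (\<eta> w * indicator (\<sigma> -` {v} \<inter> space M) w) * h v))"
    by (intro Bochner_Integration.integral_cong refl eq)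
  also have "\<dots> = (\<Sum>v\<in>\<sigma> ` space M. (LINT w|M. (\<eta> w * indicator (\<sigma> -` {v} \<inter> space M) w) * h v))"
    by (rule Bochner_Integration.integral_sum) (rule int)
  finally show "(LINT w|M. \<eta> w * h (\<sigma> w)) = (\<Sum>v\<in>\<sigma> ` space M. (LINT w|M. \<eta> w * indicator (\<sigma> -` {v} \<inter> space M) w) * h v)" by simp
  have "integrable M (\<lambda>w. \<Sum>v\<in>\<sigma> ` space M. (\<eta> w * indicator (\<sigma> -` {v} \<inter> space M) w) * h v)"
    by (intro Bochner_Integration.integrable_sum int)
  then show "integrable M (\<lambda>w. \<eta> w * h (\<sigma> w))"
    by (rule Bochner_Integration.integrable_cong[THEN iffD1, rotated 2]) (use eq in auto)
qed

text \<open>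
  For a simple function in place of the integration variable, the integral is a finite linear
  combination of translates and the assertion is linearity of \<open>f\<close>.  Simple functions \<open>\<sigma> j\<close> that
  converge to the identity, with \<open>|\<sigma> j w| \<le> 2 |w|\<close>, then give the general case: both sides converge,
  by dominated convergence, since translation is Lipschitz continuous in every seminorm with a constant
  of polynomial growth.
\<close>

lemma tempered_scaled_conv:
  fixes f :: "(real^'n \<Rightarrow> complex) \<Rightarrow> complex" and \<eta> \<theta> :: "real^'n \<Rightarrow> complex"
  assumes f: "f \<in> tempered_distributions" and \<eta>: "\<eta> \<in> schwartz_space" and \<theta>: "\<theta> \<in> schwartz_space"
  shows "f (scaled_conv s \<eta> \<theta>) = (LINT w|lborel. \<eta> w * f (\<lambda>z. \<theta> (z - s *\<^sub>R w)))"
proof -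
  obtain C L N where C: "C > 0" and fb: "\<And>\<psi> A. \<psi> \<in> schwartz_space \<Longrightarrow> decay_bound L N A \<psi> \<Longrightarrow> norm (f \<psi>) \<le> C * A"
    using tempered_bound[OF f] by metis
  obtain A where A: "A > 0" "decay_bound (Suc L) N A \<theta>" using schwartz_decay[OF \<theta>] by metis
  obtain C1 N1 where C1: "C1 > 0" and growth: "\<And>v. norm (f (\<lambda>z. \<theta> (z - v))) \<le> C1 * (1 + norm v) ^ N1"
    using tempered_translate_growth[OF f \<theta>] by metis
  define F where "F v = f (\<lambda>z. \<theta> (z - v))" for v
  have Fc: "continuous_on UNIV F" unfolding F_def by (rule tempered_translate_continuous[OF f \<theta>])
  have [measurable]: "F \<in> borel_measurable borel" by (rule borel_measurable_continuous_onI[OF Fc])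
  have \<eta>i: "integrable lborel \<eta>" by (rule schwartz_integrable[OF \<eta>])
  have [measurable]: "\<eta> \<in> borel_measurable borel" "\<theta> \<in> borel_measurable borel" using \<eta> \<theta> by (auto intro: schwartz_borel_measurable)
  have "(\<lambda>w::real^'n. w) \<in> borel_measurable lborel" by simp
  from borel_measurable_implies_sequence_metric[OF this, of 0]
  obtain \<sigma> where simp\<sigma>: "\<And>j. simple_function lborel (\<sigma> j)"
     and lim\<sigma>: "\<And>w. (\<lambda>j. \<sigma> j w) \<longlonglongrightarrow> (w::real^'n)" and bd\<sigma>: "\<And>j w. norm (\<sigma> j w) \<le> 2 * norm w" by auto
  have [measurable]: "\<sigma> j \<in> borel_measurable borel" for j using borel_measurable_simple_function[OF simp\<sigma>[of j]] by simp
  define c where "c j v = (LINT w|lborel. \<eta> w * indicator (\<sigma> j -` {v} \<inter> space lborel) w)" for j v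
  define V where "V j = \<sigma> j ` space lborel" for j
  have finV: "finite (V j)" for j using simp\<sigma>[of j] by (simp add: V_def simple_function_def)
  define G where "G j = (\<lambda>z. \<Sum>v\<in>V j. c j v * \<theta> (z - s *\<^sub>R v))" for j
  have subst: "(LINT w|lborel. \<eta> w * h (\<sigma> j w)) = (\<Sum>v\<in>V j. c j v * h v)" for h :: "real^'n \<Rightarrow> complex" and j
    unfolding V_def c_def by (rule integral_simple_substitution(1)[OF \<eta>i simp\<sigma>])
  have GS: "G j \<in> schwartz_space" for j unfolding G_def using schwartz_sum_translates[OF f \<theta> finV, of "c j" "\<lambda>v. s *\<^sub>R v"] by blast
  have fG: "f (G j) = (LINT w|lborel. \<eta> w * F (s *\<^sub>R \<sigma> j w))" for j
  proof -
    have "f (G j) = (\<Sum>v\<in>V j. c j v * F (s *\<^sub>R v))"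
      unfolding G_def F_def using schwartz_sum_translates[OF f \<theta> finV, of "c j" "\<lambda>v. s *\<^sub>R v"] by blast
    also have "\<dots> = (LINT w|lborel. \<eta> w * F (s *\<^sub>R \<sigma> j w))"
      by (rule subst[of "\<lambda>v. F (s *\<^sub>R v)", symmetric])
    finally show ?thesis .
  qed
  have dG: "foldr partial_deriv is (G j) z = (LINT w|lborel. \<eta> w * foldr partial_deriv is \<theta> (z - s *\<^sub>R \<sigma> j w))" for j "is" z
  proof -
    have "foldr partial_deriv is (G j) = (\<lambda>z. \<Sum>v\<in>V j. c j v * foldr partial_deriv is \<theta> (z - s *\<^sub>R v))"
      unfolding G_def using schwartz_sum_translates[OF f \<theta> finV, of "c j" "\<lambda>v. s *\<^sub>R v"] by blast
    then show ?thesis by (simp add: subst[of "\<lambda>v. foldr partial_deriv is \<theta> (z - s *\<^sub>R v)"])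
  qed
  have lim1: "(\<lambda>j. f (G j)) \<longlonglongrightarrow> (LINT w|lborel. \<eta> w * F (s *\<^sub>R w))"
    unfolding fG
  proof (rule integral_dominated_convergence[where w = "\<lambda>w. (C1 * (1 + \<bar>2 * s\<bar>) ^ N1) * (norm (\<eta> w) * (1 + norm w) ^ N1)"])
    show "AE w in lborel. (\<lambda>j. \<eta> w * F (s *\<^sub>R \<sigma> j w)) \<longlonglongrightarrow> \<eta> w * F (s *\<^sub>R w)"
    proof (rule AE_I2)
      fix w
      have "isCont F (s *\<^sub>R w)" using Fc by (simp add: continuous_on_eq_continuous_at)
      then have "(\<lambda>j. F (s *\<^sub>R \<sigma> j w)) \<longlonglongrightarrow> F (s *\<^sub>R w)"
        by (rule isCont_tendsto_compose) (intro tendsto_intros lim\<sigma>)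
      then show "(\<lambda>j. \<eta> w * F (s *\<^sub>R \<sigma> j w)) \<longlonglongrightarrow> \<eta> w * F (s *\<^sub>R w)" by (intro tendsto_intros)
    qed
    show "integrable lborel (\<lambda>w. (C1 * (1 + \<bar>2 * s\<bar>) ^ N1) * (norm (\<eta> w) * (1 + norm w) ^ N1))"
      using schwartz_moment_integrable[OF \<eta>] by (intro integrable_mult_right)
    fix j
    show "AE w in lborel. norm (\<eta> w * F (s *\<^sub>R \<sigma> j w)) \<le> (C1 * (1 + \<bar>2 * s\<bar>) ^ N1) * (norm (\<eta> w) * (1 + norm w) ^ N1)"
    proof (rule AE_I2)
      fix w
      have "norm (s *\<^sub>R \<sigma> j w) \<le> norm ((2 * s) *\<^sub>R w)" using mult_left_mono[OF bd\<sigma>[of j w], of "\<bar>s\<bar>"] by (simp add: abs_mult)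
      then have "1 + norm (s *\<^sub>R \<sigma> j w) \<le> (1 + \<bar>2 * s\<bar>) * (1 + norm w)" using scale_weight_le[of "2 * s" w] by linarith
      then have "norm (F (s *\<^sub>R \<sigma> j w)) \<le> C1 * ((1 + \<bar>2 * s\<bar>) * (1 + norm w)) ^ N1"
        unfolding F_def using C1 by (intro order_trans[OF growth] mult_left_mono power_mono) auto
      then have "norm (\<eta> w) * norm (F (s *\<^sub>R \<sigma> j w)) \<le> norm (\<eta> w) * (C1 * ((1 + \<bar>2 * s\<bar>) * (1 + norm w)) ^ N1)"
        by (rule mult_left_mono) simp
      then show "norm (\<eta> w * F (s *\<^sub>R \<sigma> j w)) \<le> (C1 * (1 + \<bar>2 * s\<bar>) ^ N1) * (norm (\<eta> w) * (1 + norm w) ^ N1)"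
        by (simp add: norm_mult power_mult_distrib mult_ac)
    qed
  qed measurable
  \<comment> \<open>a bound for the seminorm of the difference of the two translates of \<open>\<theta>\<close>\<close>
  define e where "e j w = real CARD('n) * A * norm (s *\<^sub>R w - s *\<^sub>R \<sigma> j w) * (1 + norm (s *\<^sub>R w - s *\<^sub>R \<sigma> j w)) ^ N * (1 + norm (s *\<^sub>R w)) ^ N" for j w
  have [measurable]: "e j \<in> borel_measurable borel" for j unfolding e_def by measurable
  define \<epsilon> where "\<epsilon> j = (LINT w|lborel. norm (\<eta> w) * e j w)" for j
  define K where "K = real CARD('n) * A * ((1 + \<bar>3 * s\<bar>) ^ (N + 1) * (1 + \<bar>s\<bar>) ^ N)"
  have e_le: "norm (norm (\<eta> w) * e j w) \<le> K * (norm (\<eta> w) * (1 + norm w) ^ (2 * N + 1))" for j w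
  proof -
    have "norm (w - \<sigma> j w) \<le> 3 * norm w" using norm_triangle_ineq4[of w "\<sigma> j w"] bd\<sigma>[of j w] by linarith
    then have "\<bar>s\<bar> * norm (w - \<sigma> j w) \<le> \<bar>s\<bar> * (3 * norm w)" by (rule mult_left_mono) simp
    then have n1: "norm (s *\<^sub>R w - s *\<^sub>R \<sigma> j w) \<le> norm ((3 * s) *\<^sub>R w)" by (simp add: scaleR_diff_right[symmetric] abs_mult)
    then have n2: "1 + norm (s *\<^sub>R w - s *\<^sub>R \<sigma> j w) \<le> (1 + \<bar>3 * s\<bar>) * (1 + norm w)" using scale_weight_le[of "3 * s" w] by linarith
    have "norm (s *\<^sub>R w - s *\<^sub>R \<sigma> j w) * (1 + norm (s *\<^sub>R w - s *\<^sub>R \<sigma> j w)) ^ N \<le> (1 + norm (s *\<^sub>R w - s *\<^sub>R \<sigma> j w)) ^ (N + 1)"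
      by (simp add: mult_right_mono)
    also have "\<dots> \<le> ((1 + \<bar>3 * s\<bar>) * (1 + norm w)) ^ (N + 1)" by (intro power_mono n2) auto
    finally have "norm (s *\<^sub>R w - s *\<^sub>R \<sigma> j w) * (1 + norm (s *\<^sub>R w - s *\<^sub>R \<sigma> j w)) ^ N * (1 + norm (s *\<^sub>R w)) ^ N
       \<le> ((1 + \<bar>3 * s\<bar>) * (1 + norm w)) ^ (N + 1) * ((1 + \<bar>s\<bar>) * (1 + norm w)) ^ N"
      by (intro mult_mono power_mono scale_weight_le) auto
    also have "\<dots> = ((1 + \<bar>3 * s\<bar>) ^ (N + 1) * (1 + \<bar>s\<bar>) ^ N) * (1 + norm w) ^ (2 * N + 1)"
    proof -
      have e: "2 * N + 1 = (N + 1) + N" by simp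
      show ?thesis unfolding e power_add[of _ "N + 1" N] by (simp only: power_mult_distrib mult_ac)
    qed
    finally have "(real CARD('n) * A) * (norm (s *\<^sub>R w - s *\<^sub>R \<sigma> j w) * (1 + norm (s *\<^sub>R w - s *\<^sub>R \<sigma> j w)) ^ N * (1 + norm (s *\<^sub>R w)) ^ N)
       \<le> (real CARD('n) * A) * (((1 + \<bar>3 * s\<bar>) ^ (N + 1) * (1 + \<bar>s\<bar>) ^ N) * (1 + norm w) ^ (2 * N + 1))"
      using A(1) by (intro mult_left_mono) auto
    then have "e j w \<le> K * (1 + norm w) ^ (2 * N + 1)" by (simp only: e_def K_def mult.assoc)
    then have "norm (\<eta> w) * e j w \<le> norm (\<eta> w) * (K * (1 + norm w) ^ (2 * N + 1))" by (rule mult_left_mono) simp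
    moreover have "0 \<le> e j w" using A(1) by (simp add: e_def)
    ultimately show ?thesis by (simp add: mult_ac)
  qed
  have Ki: "integrable lborel (\<lambda>w. K * (norm (\<eta> w) * (1 + norm w) ^ (2 * N + 1)))"
    using schwartz_moment_integrable[OF \<eta>] by (intro integrable_mult_right)
  have ei: "integrable lborel (\<lambda>w. norm (\<eta> w) * e j w)" for j
    by (rule Bochner_Integration.integrable_bound[OF Ki], measurable, rule AE_I2, rule order_trans[OF e_le])
      (simp only: real_norm_def abs_ge_self)
  have lim2: "\<epsilon> \<longlonglongrightarrow> (LINT w|(lborel :: (real^'n) measure). (0::real))"
    unfolding \<epsilon>_def
  proof (rule integral_dominated_convergence[OF _ _ Ki])
    show "AE w in lborel. (\<lambda>j. norm (\<eta> w) * e j w) \<longlonglongrightarrow> 0"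
    proof (rule AE_I2)
      fix w
      have "(\<lambda>j. norm (\<eta> w) * e j w) \<longlonglongrightarrow> norm (\<eta> w) * (real CARD('n) * A * norm (s *\<^sub>R w - s *\<^sub>R w) * (1 + norm (s *\<^sub>R w - s *\<^sub>R w)) ^ N * (1 + norm (s *\<^sub>R w)) ^ N)"
        unfolding e_def by (intro tendsto_intros lim\<sigma>)
      then show "(\<lambda>j. norm (\<eta> w) * e j w) \<longlonglongrightarrow> 0" by simp
    qed
    show "AE w in lborel. norm (norm (\<eta> w) * e j w) \<le> K * (norm (\<eta> w) * (1 + norm w) ^ (2 * N + 1))" for j
      using e_le by (intro AE_I2)
  qed measurable
  have close: "norm (f (G j) - f (scaled_conv s \<eta> \<theta>)) \<le> C * \<epsilon> j" for j
  proof -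
    have SC: "scaled_conv s \<eta> \<theta> \<in> schwartz_space" by (rule schwartz_scaled_conv[OF \<eta> \<theta>])
    have "decay_bound L N (\<epsilon> j) (\<lambda>z. scaled_conv s \<eta> \<theta> z - G j z)"
    proof (rule decay_boundI)
      fix "is" :: "'n list" and z :: "real^'n" assume l: "length is \<le> L"
      let ?\<theta> = "foldr partial_deriv is \<theta>"
      have S': "?\<theta> \<in> schwartz_space" by (rule schwartz_foldr[OF \<theta>])
      have i1: "integrable lborel (\<lambda>w. \<eta> w * ?\<theta> (z - s *\<^sub>R w))" by (rule scaled_conv_integrable[OF \<eta> S'])
      have i2: "integrable lborel (\<lambda>w. \<eta> w * ?\<theta> (z - s *\<^sub>R \<sigma> j w))"
        by (rule integral_simple_substitution(2)[OF \<eta>i simp\<sigma>, of "\<lambda>v. ?\<theta> (z - s *\<^sub>R v)"])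
      have "foldr partial_deriv is (\<lambda>z. scaled_conv s \<eta> \<theta> z - G j z) z = scaled_conv s \<eta> ?\<theta> z - foldr partial_deriv is (G j) z"
        using foldr_partial_deriv_lincomb[OF schwartz_smooth[OF SC] schwartz_smooth[OF GS[of j]], of "is" 1 "-1"]
        by (simp add: foldr_partial_deriv_scaled_conv[OF \<eta> \<theta>])
      also have "\<dots> = (LINT w|lborel. \<eta> w * ?\<theta> (z - s *\<^sub>R w) - \<eta> w * ?\<theta> (z - s *\<^sub>R \<sigma> j w))"
        unfolding dG scaled_conv_def using i1 i2 by simp
      finally have eq: "foldr partial_deriv is (\<lambda>z. scaled_conv s \<eta> \<theta> z - G j z) z * complex_of_real ((1 + norm z) ^ N)
        = (LINT w|lborel. (\<eta> w * ?\<theta> (z - s *\<^sub>R w) - \<eta> w * ?\<theta> (z - s *\<^sub>R \<sigma> j w)) * complex_of_real ((1 + norm z) ^ N))"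
        by simp
      have "norm (LINT w|lborel. (\<eta> w * ?\<theta> (z - s *\<^sub>R w) - \<eta> w * ?\<theta> (z - s *\<^sub>R \<sigma> j w)) * complex_of_real ((1 + norm z) ^ N)) \<le> \<epsilon> j"
        unfolding \<epsilon>_def
      proof (rule Bochner_Integration.integral_norm_bound_integral[OF _ ei])
        show "integrable lborel (\<lambda>w. (\<eta> w * ?\<theta> (z - s *\<^sub>R w) - \<eta> w * ?\<theta> (z - s *\<^sub>R \<sigma> j w)) * complex_of_real ((1 + norm z) ^ N))"
          by (intro integrable_mult_left Bochner_Integration.integrable_diff i1 i2)
        fix w
        have "norm (\<eta> w) * (norm (?\<theta> (z - s *\<^sub>R w) - ?\<theta> (z - s *\<^sub>R \<sigma> j w)) * (1 + norm z) ^ N) \<le> norm (\<eta> w) * e j w"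
          unfolding e_def by (intro mult_left_mono decay_bound_translate_diff[OF schwartz_smooth[OF \<theta>] A(2) l]) auto
        moreover have "norm (complex_of_real ((1 + norm z) ^ N)) = (1 + norm z) ^ N" by (simp only: norm_of_real) simp
        ultimately show "norm ((\<eta> w * ?\<theta> (z - s *\<^sub>R w) - \<eta> w * ?\<theta> (z - s *\<^sub>R \<sigma> j w)) * complex_of_real ((1 + norm z) ^ N)) \<le> norm (\<eta> w) * e j w"
          by (simp only: right_diff_distrib[symmetric] norm_mult mult.assoc)
      qed
      moreover have "norm (complex_of_real ((1 + norm z) ^ N)) = (1 + norm z) ^ N" by (simp only: norm_of_real) simp
      ultimately show "norm (foldr partial_deriv is (\<lambda>z. scaled_conv s \<eta> \<theta> z - G j z) z) * (1 + norm z) ^ N \<le> \<epsilon> j"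
        unfolding eq[symmetric] by (simp only: norm_mult)
    qed
    moreover have "(\<lambda>z. scaled_conv s \<eta> \<theta> z - G j z) \<in> schwartz_space" using schwartz_lincomb[OF SC GS[of j], of 1 "-1"] by simp
    ultimately have "norm (f (\<lambda>z. scaled_conv s \<eta> \<theta> z - G j z)) \<le> C * \<epsilon> j" by (intro fb)
    then show ?thesis using tempered_diff[OF f SC GS[of j]] by (simp add: norm_minus_commute)
  qed
  have "(\<lambda>j. f (G j)) \<longlonglongrightarrow> f (scaled_conv s \<eta> \<theta>)"
  proof (rule LIM_zero_cancel, rule Lim_null_comparison)
    show "\<forall>\<^sub>F j in sequentially. norm (f (G j) - f (scaled_conv s \<eta> \<theta>)) \<le> C * \<epsilon> j" using close by simp
    have "(\<lambda>j. C * \<epsilon> j) \<longlonglongrightarrow> C * 0" using lim2 by (intro tendsto_intros) simp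
    then show "(\<lambda>j. C * \<epsilon> j) \<longlonglongrightarrow> 0" by simp
  qed
  then show ?thesis using LIMSEQ_unique[OF lim1] by (simp add: F_def)
qed


section \<open>A telescoping reproducing formula\<close>

lemma lborel_affine_transform:
  fixes x :: "'a::euclidean_space"
  assumes c: "c \<noteq> 0"
  shows "g \<in> borel_measurable borel \<Longrightarrow> (\<integral>\<^sup>+y. g y \<partial>lborel) = ennreal (\<bar>c\<bar> ^ DIM('a)) * (\<integral>\<^sup>+y. g (x + c *\<^sub>R y) \<partial>lborel)"
    and "h \<in> borel_measurable borel \<Longrightarrow> (LINT y|lborel. h y) = (\<bar>c\<bar> ^ DIM('a)) *\<^sub>R (LINT y|lborel. (h (x + c *\<^sub>R y) :: complex))"
proof -
  have eq: "(lborel :: 'a measure) = density (distr lborel borel (\<lambda>y. x + c *\<^sub>R y)) (\<lambda>_. \<bar>c\<bar> ^ DIM('a))"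
    by (rule lborel_affine[OF c])
  {
    assume g: "g \<in> borel_measurable borel"
    have "(\<integral>\<^sup>+y. g y \<partial>lborel) = (\<integral>\<^sup>+y. ennreal (\<bar>c\<bar> ^ DIM('a)) * g (x + c *\<^sub>R y) \<partial>lborel)"
      by (subst eq, subst nn_integral_density, use g in simp, use g in simp, subst nn_integral_distr) (use g in simp_all)
    also have "\<dots> = ennreal (\<bar>c\<bar> ^ DIM('a)) * (\<integral>\<^sup>+y. g (x + c *\<^sub>R y) \<partial>lborel)"
      by (rule nn_integral_cmult) (use g in measurable)
    finally show "(\<integral>\<^sup>+y. g y \<partial>lborel) = ennreal (\<bar>c\<bar> ^ DIM('a)) * (\<integral>\<^sup>+y. g (x + c *\<^sub>R y) \<partial>lborel)" .
  }
  {
    assume h: "h \<in> borel_measurable borel"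
    have "(LINT y|lborel. h y) = (LINT y|lborel. (\<bar>c\<bar> ^ DIM('a)) *\<^sub>R h (x + c *\<^sub>R y))"
      by (subst eq, subst integral_density, use h in simp, simp, simp, subst integral_distr) (use h in simp_all)
    then show "(LINT y|lborel. h y) = (\<bar>c\<bar> ^ DIM('a)) *\<^sub>R (LINT y|lborel. h (x + c *\<^sub>R y))" by simp
  }
qed

text \<open>
  The roles of the two factors are exchanged by a change of variables: afterwards the integral runs
  over translates of \<open>\<Phi>\<close> at one fixed scale, to which the distribution can be applied.
\<close>

lemma dilate_scaled_conv:
  fixes \<Phi> \<eta> :: "real^'n \<Rightarrow> complex"
  assumes \<Phi>: "\<Phi> \<in> schwartz_space" and \<eta>: "\<eta> \<in> schwartz_space" and t: "t > 0" and s: "s > 0"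
  shows "dilate t (scaled_conv s \<Phi> \<eta>) (x - z) = scaled_conv (- t) \<eta> (\<lambda>z. dilate (t * s) \<Phi> (x - z)) z"
proof -
  let ?n = "CARD('n)"
  have [measurable]: "\<Phi> \<in> borel_measurable borel" "\<eta> \<in> borel_measurable borel" using \<Phi> \<eta> by (auto intro: schwartz_borel_measurable)
  let ?b = "(x - z) /\<^sub>R t"
  let ?h = "\<lambda>w. \<eta> w * dilate (t * s) \<Phi> (x - (z - - t *\<^sub>R w))"
  have h: "?h (?b + (- s) *\<^sub>R y) = complex_of_real (1 / (t * s) ^ ?n) * (\<Phi> y * \<eta> (?b - s *\<^sub>R y))" for y
  proof -
    have "(x - (z - - t *\<^sub>R (?b + (- s) *\<^sub>R y))) /\<^sub>R (t * s) = y"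
    proof -
      have "inverse t * inverse s * (t * s) = 1" using t s by (simp add: field_simps)
      then show ?thesis using t s by (simp add: scaleR_add_right scaleR_diff_right)
    qed
    then show ?thesis unfolding dilate_def by simp
  qed
  have "scaled_conv (- t) \<eta> (\<lambda>z. dilate (t * s) \<Phi> (x - z)) z = (LINT w|lborel. ?h w)"
    unfolding scaled_conv_def by simp
  also have "\<dots> = (\<bar>- s\<bar> ^ DIM(real^'n)) *\<^sub>R (LINT y|lborel. ?h (?b + (- s) *\<^sub>R y))"
    by (rule lborel_affine_transform(2)) (use s in \<open>simp_all add: dilate_def\<close>)
  also have "\<dots> = (s ^ ?n) *\<^sub>R (complex_of_real (1 / (t * s) ^ ?n) * (LINT y|lborel. \<Phi> y * \<eta> (?b - s *\<^sub>R y)))"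
    unfolding h using s by simp
  also have "\<dots> = complex_of_real (s ^ ?n * (1 / (t * s) ^ ?n)) * scaled_conv s \<Phi> \<eta> ?b"
    by (simp add: scaled_conv_def scaleR_conv_of_real)
  also have "s ^ ?n * (1 / (t * s) ^ ?n) = 1 / t ^ ?n" using s by (simp add: power_mult_distrib)
  also have "complex_of_real (1 / t ^ ?n) * scaled_conv s \<Phi> \<eta> ?b = dilate t (scaled_conv s \<Phi> \<eta>) (x - z)"
    by (simp add: dilate_def)
  finally show ?thesis by simp
qed

text \<open>
  With \<open>a = 1 / \<integral>\<Phi>\<close> this is \<open>\<psi>\<close> minus its approximation at scale \<open>s\<close>.
\<close>

definition refine_step :: "complex \<Rightarrow> (real^'n \<Rightarrow> complex) \<Rightarrow> real \<Rightarrow> (real^'n \<Rightarrow> complex) \<Rightarrow> real^'n \<Rightarrow> complex" where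
  "refine_step a \<Phi> s \<psi> x = \<psi> x - a * scaled_conv s \<Phi> \<psi> x"

lemma refine_step_lincomb: "refine_step a \<Phi> s \<psi> = (\<lambda>x. 1 * \<psi> x + (- a) * scaled_conv s \<Phi> \<psi> x)"
  by (rule ext) (simp add: refine_step_def)

lemma schwartz_refine_step:
  assumes "\<Phi> \<in> schwartz_space" "\<psi> \<in> schwartz_space"
  shows "refine_step a \<Phi> s \<psi> \<in> schwartz_space"
  unfolding refine_step_lincomb by (intro schwartz_lincomb schwartz_scaled_conv assms)

lemma decay_bound_refine_step:
  fixes \<Phi> \<psi> :: "real^'n \<Rightarrow> complex"
  assumes \<Phi>: "\<Phi> \<in> schwartz_space" and \<psi>: "\<psi> \<in> schwartz_space" and d: "decay_bound L N A \<psi>" and s: "0 \<le> s" "s \<le> 1"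
  shows "decay_bound L N (A * (1 + norm a * (2 ^ N * moment N \<Phi>))) (refine_step a \<Phi> s \<psi>)"
proof -
  have A: "A \<ge> 0" using d by (rule decay_bound_nonneg)
  have "decay_bound L N (norm (1::complex) * A + norm (- a) * (A * (1 + \<bar>s\<bar>) ^ N * moment N \<Phi>)) (refine_step a \<Phi> s \<psi>)"
    unfolding refine_step_lincomb
    by (intro decay_bound_lincomb decay_bound_scaled_conv schwartz_smooth schwartz_scaled_conv \<Phi> \<psi> d)
  moreover have "norm (1::complex) * A + norm (- a) * (A * (1 + \<bar>s\<bar>) ^ N * moment N \<Phi>) \<le> A * (1 + norm a * (2 ^ N * moment N \<Phi>))"
  proof -
    have "(1 + \<bar>s\<bar>) ^ N \<le> 2 ^ N" using s by (intro power_mono) auto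
    then have "norm a * (A * (1 + \<bar>s\<bar>) ^ N * moment N \<Phi>) \<le> norm a * (A * 2 ^ N * moment N \<Phi>)"
      using A moment_nonneg[of N \<Phi>] by (intro mult_left_mono mult_right_mono) auto
    then show ?thesis by (simp add: algebra_simps)
  qed
  ultimately show ?thesis by (rule decay_bound_mono[OF _ order_refl order_refl])
qed

text \<open>
  Since \<open>a \<integral>\<Phi> = 1\<close>, the value at \<open>x\<close> is an average of the differences \<open>\<psi> x - \<psi> (x - s y)\<close>, which are of size
  \<open>s\<close> if one derivative of \<open>\<psi>\<close> is controlled.
\<close>

lemma decay_bound_refine_step_gain:
  fixes \<Phi> \<psi> :: "real^'n \<Rightarrow> complex"
  assumes \<Phi>: "\<Phi> \<in> schwartz_space" and \<psi>: "\<psi> \<in> schwartz_space" and a: "a * (LINT y|lborel. \<Phi> y) = 1"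
    and d: "decay_bound (Suc L) N A \<psi>" and s: "0 \<le> s" "s \<le> 1"
  shows "decay_bound L N (A * s * (norm a * (real CARD('n) * moment (N + 1) \<Phi>))) (refine_step a \<Phi> s \<psi>)"
proof (rule decay_boundI)
  fix "is" :: "'n list" and x :: "real^'n" assume l: "length is \<le> L"
  let ?\<psi> = "foldr partial_deriv is \<psi>"
  have A: "A \<ge> 0" using d by (rule decay_bound_nonneg)
  have S: "?\<psi> \<in> schwartz_space" by (rule schwartz_foldr[OF \<psi>])
  then have [measurable]: "?\<psi> \<in> borel_measurable borel" by (rule schwartz_borel_measurable)
  have x: "(1 + norm x) ^ N > 0" by (simp add: add_pos_nonneg)
  have "foldr partial_deriv is (refine_step a \<Phi> s \<psi>) x = ?\<psi> x - a * scaled_conv s \<Phi> ?\<psi> x"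
    unfolding refine_step_lincomb foldr_partial_deriv_lincomb[OF schwartz_smooth[OF \<psi>] schwartz_smooth[OF schwartz_scaled_conv[OF \<Phi> \<psi>]]]
      foldr_partial_deriv_scaled_conv[OF \<Phi> \<psi>] by simp
  also have "?\<psi> x = a * (LINT y|lborel. \<Phi> y * ?\<psi> x)" using a by (simp add: mult.assoc[symmetric])
  also have "a * (LINT y|lborel. \<Phi> y * ?\<psi> x) - a * scaled_conv s \<Phi> ?\<psi> x = a * (LINT y|lborel. \<Phi> y * ?\<psi> x - \<Phi> y * ?\<psi> (x - s *\<^sub>R y))"
  proof -
    have "(LINT y|lborel. \<Phi> y * ?\<psi> x - \<Phi> y * ?\<psi> (x - s *\<^sub>R y)) = (LINT y|lborel. \<Phi> y * ?\<psi> x) - scaled_conv s \<Phi> ?\<psi> x"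
      unfolding scaled_conv_def
      by (rule Bochner_Integration.integral_diff) (use schwartz_integrable[OF \<Phi>] scaled_conv_integrable[OF \<Phi> S] in auto)
    then show ?thesis by (simp only: right_diff_distrib)
  qed
  finally have eq: "foldr partial_deriv is (refine_step a \<Phi> s \<psi>) x = a * (LINT y|lborel. \<Phi> y * (?\<psi> x - ?\<psi> (x - s *\<^sub>R y)))"
    by (simp add: right_diff_distrib)
  have "norm (LINT y|lborel. \<Phi> y * (?\<psi> x - ?\<psi> (x - s *\<^sub>R y))) \<le> (real CARD('n) * A * s / (1 + norm x) ^ N) * moment (N + 1) \<Phi>"
  proof (rule integrable_mult_of_moment_bound(2)[OF \<Phi>])
    fix y :: "real^'n"
    have sy: "norm (s *\<^sub>R y) \<le> norm y" using s by (simp add: mult_left_le_one_le)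
    have "norm (?\<psi> x - ?\<psi> (x - s *\<^sub>R y)) * (1 + norm x) ^ N \<le> real CARD('n) * A * norm (s *\<^sub>R y) * (1 + norm (s *\<^sub>R y)) ^ N"
      using decay_bound_diff_le[OF schwartz_smooth[OF \<psi>] d l, of x "- (s *\<^sub>R y)"] by (simp add: norm_minus_commute)
    also have "\<dots> \<le> real CARD('n) * A * (s * norm y) * (1 + norm y) ^ N"
      using sy s A by (intro mult_mono power_mono) auto
    also have "\<dots> \<le> real CARD('n) * A * (s * (1 + norm y)) * (1 + norm y) ^ N"
      using s A by (intro mult_right_mono mult_left_mono) auto
    also have "\<dots> = real CARD('n) * A * s * (1 + norm y) ^ (N + 1)" by simp
    finally have "norm (?\<psi> x - ?\<psi> (x - s *\<^sub>R y)) \<le> (real CARD('n) * A * s * (1 + norm y) ^ (N + 1)) / (1 + norm x) ^ N"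
      using pos_le_divide_eq[OF x] by blast
    then show "norm (?\<psi> x - ?\<psi> (x - s *\<^sub>R y)) \<le> real CARD('n) * A * s / (1 + norm x) ^ N * (1 + norm y) ^ (N + 1)" by simp
  qed measurable
  then have "norm (foldr partial_deriv is (refine_step a \<Phi> s \<psi>) x) \<le> norm a * ((real CARD('n) * A * s / (1 + norm x) ^ N) * moment (N + 1) \<Phi>)"
    unfolding eq norm_mult by (rule mult_left_mono) simp
  also have "\<dots> = (A * s * (norm a * (real CARD('n) * moment (N + 1) \<Phi>))) / (1 + norm x) ^ N" by simp
  finally show "norm (foldr partial_deriv is (refine_step a \<Phi> s \<psi>) x) * (1 + norm x) ^ N \<le> A * s * (norm a * (real CARD('n) * moment (N + 1) \<Phi>))"
    using pos_le_divide_eq[OF x] by blast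
qed

text \<open>
  The remainders of the successive approximation, at the scales \<open>1 / 2 ^ (\<sigma> k)\<close>.
\<close>

primrec residual :: "complex \<Rightarrow> (real^'n \<Rightarrow> complex) \<Rightarrow> nat \<Rightarrow> (real^'n \<Rightarrow> complex) \<Rightarrow> nat \<Rightarrow> real^'n \<Rightarrow> complex" where
  "residual a \<Phi> \<sigma> \<psi> 0 = \<psi>"
| "residual a \<Phi> \<sigma> \<psi> (Suc k) = refine_step a \<Phi> ((1 / 2) ^ (\<sigma> * k)) (residual a \<Phi> \<sigma> \<psi> k)"

lemma schwartz_residual:
  assumes "\<Phi> \<in> schwartz_space" "\<psi> \<in> schwartz_space"
  shows "residual a \<Phi> \<sigma> \<psi> k \<in> schwartz_space"
  by (induction k) (use assms in \<open>auto intro: schwartz_refine_step\<close>)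

text \<open>
  Each step costs the constant \<open>\<alpha> N\<close>.  By induction on \<open>d\<close>, controlling \<open>d\<close> derivatives of \<open>\<psi>\<close> gains the factor
  \<open>(1 / 2) ^ (\<sigma> d)\<close> per step: \<open>d\<close> of the derivatives are spent in the last \<open>d\<close> steps, whose scales differ from
  the current one by constant factors only.
\<close>

lemma residual_decay:
  fixes \<Phi> :: "real^'n \<Rightarrow> complex"
  assumes \<Phi>: "\<Phi> \<in> schwartz_space" and a: "a * (LINT y|lborel. \<Phi> y) = 1"
  defines "\<alpha> N \<equiv> 1 + norm a * (2 ^ N * moment N \<Phi>)"
  shows "\<exists>c>0. \<forall>\<psi> A L k. \<psi> \<in> schwartz_space \<longrightarrow> decay_bound (L + d) N A \<psi> \<longrightarrow>
    decay_bound L N (c * A * (\<alpha> N * (1 / 2) ^ (\<sigma> * d)) ^ k) (residual a \<Phi> \<sigma> \<psi> k)"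
proof (induction d)
  case 0
  have "decay_bound L N (A * \<alpha> N ^ k) (residual a \<Phi> \<sigma> \<psi> k)"
    if S: "\<psi> \<in> schwartz_space" and d: "decay_bound L N A \<psi>" for \<psi> A L k
  proof (induction k)
    case (Suc k)
    have "decay_bound L N (A * \<alpha> N ^ k * \<alpha> N) (refine_step a \<Phi> ((1 / 2) ^ (\<sigma> * k)) (residual a \<Phi> \<sigma> \<psi> k))"
      unfolding \<alpha>_def by (rule decay_bound_refine_step[OF \<Phi> schwartz_residual[OF \<Phi> S] Suc[unfolded \<alpha>_def]])
        (auto simp: power_le_one)
    then show ?case by (simp add: mult_ac)
  qed (use d in simp)
  then show ?case by (intro exI[of _ 1]) auto
next
  case (Suc d)
  then obtain c where c: "c > 0" and IH: "\<And>\<psi> A L k. \<psi> \<in> schwartz_space \<Longrightarrow> decay_bound (L + d) N A \<psi> \<Longrightarrow>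
      decay_bound L N (c * A * (\<alpha> N * (1 / 2) ^ (\<sigma> * d)) ^ k) (residual a \<Phi> \<sigma> \<psi> k)" by blast
  define \<beta> where "\<beta> = norm a * (real CARD('n) * moment (N + 1) \<Phi>)"
  have \<beta>: "\<beta> \<ge> 0" unfolding \<beta>_def by (intro mult_nonneg_nonneg moment_nonneg) auto
  have \<alpha>: "\<alpha> N \<ge> 1" unfolding \<alpha>_def using moment_nonneg[of N \<Phi>] by simp
  define \<gamma> where "\<gamma> = \<alpha> N * (1 / 2) ^ (\<sigma> * Suc d)"
  have \<gamma>: "\<gamma> > 0" using \<alpha> by (simp add: \<gamma>_def)
  \<comment> \<open>the maximum with 1 is for \<open>k = 0\<close>, where no step has been made and no derivative spent\<close>
  define c' where "c' = max 1 (c * \<beta> / \<gamma>)"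
  have c': "c' \<ge> 1" "c * \<beta> \<le> c' * \<gamma>"
    using \<gamma> by (auto simp: c'_def pos_divide_le_eq[symmetric])
  have "decay_bound L N (c' * A * \<gamma> ^ k) (residual a \<Phi> \<sigma> \<psi> k)"
    if S: "\<psi> \<in> schwartz_space" and d: "decay_bound (L + Suc d) N A \<psi>" for \<psi> A L k
  proof (cases k)
    case 0
    have "A \<le> c' * A" using c' decay_bound_nonneg[OF d] by (simp add: mult_le_cancel_right1)
    then show ?thesis using 0 by (simp add: decay_bound_mono[OF d])
  next
    case (Suc j)
    have A: "A \<ge> 0" using d by (rule decay_bound_nonneg)
    have "decay_bound (Suc L) N (c * A * (\<alpha> N * (1 / 2) ^ (\<sigma> * d)) ^ j) (residual a \<Phi> \<sigma> \<psi> j)"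
      using IH[OF S, of "Suc L"] d by simp
    then have dec: "decay_bound L N (c * A * (\<alpha> N * (1 / 2) ^ (\<sigma> * d)) ^ j * (1 / 2) ^ (\<sigma> * j) * \<beta>) (residual a \<Phi> \<sigma> \<psi> (Suc j))"
      unfolding \<beta>_def residual.simps
      by (intro decay_bound_refine_step_gain[OF \<Phi> schwartz_residual[OF \<Phi> S] a]) (auto simp: power_le_one)
    have "c * A * (\<alpha> N * (1 / 2) ^ (\<sigma> * d)) ^ j * (1 / 2) ^ (\<sigma> * j) * \<beta> = (c * \<beta>) * A * \<gamma> ^ j"
    proof -
      have "(\<alpha> N * (1 / 2) ^ (\<sigma> * d)) ^ j * (1 / 2) ^ (\<sigma> * j) = \<gamma> ^ j"
        unfolding \<gamma>_def by (simp add: power_mult power_add mult_ac flip: power_mult_distrib)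
      then show ?thesis by (simp add: mult_ac)
    qed
    also have "(c * \<beta>) * A * \<gamma> ^ j \<le> (c' * \<gamma>) * A * \<gamma> ^ j"
      using c' A \<gamma> by (intro mult_right_mono) auto
    also have "\<dots> = c' * A * \<gamma> ^ Suc j" by simp
    finally show ?thesis unfolding Suc by (rule decay_bound_mono[OF dec order_refl order_refl])
  qed
  then show ?case using c' unfolding \<gamma>_def by (intro exI[of _ c']) auto
qed


text \<open>
  With \<open>d\<close> derivatives such that \<open>2 ^ d\<close> exceeds \<open>2 \<alpha>\<close> the remainders decay geometrically in the one seminorm
  that controls \<open>f\<close>.
\<close>

lemma residual_tendsto_zero:
  fixes \<Phi> \<psi> :: "real^'n \<Rightarrow> complex"
  assumes f: "f \<in> tempered_distributions" and \<Phi>: "\<Phi> \<in> schwartz_space" and a: "a * (LINT y|lborel. \<Phi> y) = 1"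
    and \<psi>: "\<psi> \<in> schwartz_space" and \<sigma>: "\<sigma> \<ge> 1" and t: "t > 0"
  shows "(\<lambda>k. distr_conv f (dilate t (residual a \<Phi> \<sigma> \<psi> k)) x) \<longlonglongrightarrow> 0"
proof -
  obtain C L N where C: "C > 0" and fb: "\<And>\<psi> A. \<psi> \<in> schwartz_space \<Longrightarrow> decay_bound L N A \<psi> \<Longrightarrow> norm (f \<psi>) \<le> C * A"
    using tempered_bound[OF f] by metis
  define \<alpha> where "\<alpha> = 1 + norm a * (2 ^ N * moment N \<Phi>)"
  have \<alpha>: "\<alpha> \<ge> 1" unfolding \<alpha>_def using moment_nonneg[of N \<Phi>] by simp
  obtain d where d: "2 * \<alpha> < 2 ^ d" using real_arch_pow[of 2 "2 * \<alpha>"] by auto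
  obtain c where c: "c > 0" and res: "\<And>\<psi> A L k. \<psi> \<in> schwartz_space \<Longrightarrow> decay_bound (L + d) N A \<psi> \<Longrightarrow>
      decay_bound L N (c * A * (\<alpha> * (1 / 2) ^ (\<sigma> * d)) ^ k) (residual a \<Phi> \<sigma> \<psi> k)"
    using residual_decay[OF \<Phi> a, of d N \<sigma>] unfolding \<alpha>_def by blast
  obtain A where A: "A > 0" "decay_bound (L + d) N A \<psi>" using schwartz_decay[OF \<psi>] by metis
  define \<rho> where "\<rho> = \<alpha> * (1 / 2) ^ (\<sigma> * d)"
  have \<rho>: "0 \<le> \<rho>" "\<rho> < 1"
  proof -
    have "(1 / 2 :: real) ^ (\<sigma> * d) \<le> (1 / 2) ^ d" using \<sigma> by (intro power_decreasing) auto
    then have "\<rho> \<le> \<alpha> * (1 / 2) ^ d" unfolding \<rho>_def using \<alpha> by (intro mult_left_mono) auto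
    also have "\<dots> < 1" using d \<alpha> by (simp add: power_one_over field_simps)
    finally show "\<rho> < 1" .
  qed (use \<alpha> in \<open>simp add: \<rho>_def\<close>)
  define B where "B = norm (complex_of_real (1 / t ^ CARD('n))) * (1 + \<bar>- 1 / t\<bar>) ^ L * ((1 + 1 / \<bar>- 1 / t\<bar>) * (1 + norm ((1 / t) *\<^sub>R x))) ^ N"
  have le: "norm (distr_conv f (dilate t (residual a \<Phi> \<sigma> \<psi> k)) x) \<le> (C * c * A * B) * \<rho> ^ k" for k
  proof -
    let ?R = "residual a \<Phi> \<sigma> \<psi> k"
    have R: "?R \<in> schwartz_space" by (rule schwartz_residual[OF \<Phi> \<psi>])
    have "decay_bound L N (c * A * \<rho> ^ k) ?R" unfolding \<rho>_def by (rule res[OF \<psi> A(2)])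
    then have "decay_bound L N (c * A * \<rho> ^ k * B) (\<lambda>z. dilate t ?R (x - z))"
      unfolding dilate_reflect_eq_affine B_def using t by (intro decay_bound_affine schwartz_smooth R) auto
    then have "norm (f (\<lambda>z. dilate t ?R (x - z))) \<le> C * (c * A * \<rho> ^ k * B)"
      by (intro fb schwartz_reflect schwartz_dilate R t)
    then show ?thesis by (simp add: distr_conv_def mult_ac)
  qed
  show ?thesis
  proof (rule Lim_null_comparison)
    show "\<forall>\<^sub>F k in sequentially. norm (distr_conv f (dilate t (residual a \<Phi> \<sigma> \<psi> k)) x) \<le> (C * c * A * B) * \<rho> ^ k"
      using le by simp
    show "(\<lambda>k. (C * c * A * B) * \<rho> ^ k) \<longlonglongrightarrow> 0"
      using LIMSEQ_realpow_zero[OF \<rho>] by (rule tendsto_mult_right_zero)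
  qed
qed

text \<open>
  One step of the telescoping sum, after applying \<open>f\<close>.
\<close>

lemma residual_step:
  fixes \<Phi> \<psi> :: "real^'n \<Rightarrow> complex"
  assumes f: "f \<in> tempered_distributions" and \<Phi>: "\<Phi> \<in> schwartz_space" and \<psi>: "\<psi> \<in> schwartz_space" and t: "t > 0"
  shows "distr_conv f (dilate t (residual a \<Phi> \<sigma> \<psi> k)) x = distr_conv f (dilate t (residual a \<Phi> \<sigma> \<psi> (Suc k))) x
     + a * (LINT w|lborel. residual a \<Phi> \<sigma> \<psi> k w * distr_conv f (dilate (t * (1 / 2) ^ (\<sigma> * k)) \<Phi>) (x - t *\<^sub>R w))"
proof -
  let ?R = "residual a \<Phi> \<sigma> \<psi> k" and ?R' = "residual a \<Phi> \<sigma> \<psi> (Suc k)"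
  define s :: real where "s = (1 / 2) ^ (\<sigma> * k)"
  have s: "s > 0" by (simp add: s_def)
  let ?S = "scaled_conv s \<Phi> ?R"
  let ?\<theta> = "\<lambda>z. dilate (t * s) \<Phi> (x - z)"
  have R: "?R \<in> schwartz_space" "?R' \<in> schwartz_space" by (rule schwartz_residual[OF \<Phi> \<psi>])+
  have S: "?S \<in> schwartz_space" by (rule schwartz_scaled_conv[OF \<Phi> R(1)])
  have "t * s > 0" using t s by simp
  then have \<theta>: "?\<theta> \<in> schwartz_space" by (intro schwartz_reflect schwartz_dilate \<Phi>)
  have eq: "(\<lambda>z. dilate t ?R (x - z)) = (\<lambda>z. 1 * dilate t ?R' (x - z) + a * dilate t ?S (x - z))"
    by (rule ext) (simp add: dilate_def refine_step_def s_def algebra_simps)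
  have "distr_conv f (dilate t ?R) x = f (\<lambda>z. 1 * dilate t ?R' (x - z) + a * dilate t ?S (x - z))"
    unfolding distr_conv_def by (simp only: eq)
  also have "\<dots> = 1 * f (\<lambda>z. dilate t ?R' (x - z)) + a * f (\<lambda>z. dilate t ?S (x - z))"
    by (intro tempered_lincomb f schwartz_reflect schwartz_dilate R S t)
  also have "(\<lambda>z. dilate t ?S (x - z)) = scaled_conv (- t) ?R ?\<theta>"
    by (rule ext) (rule dilate_scaled_conv[OF \<Phi> R(1) t s])
  also have "f \<dots> = (LINT w|lborel. ?R w * f (\<lambda>z. ?\<theta> (z - (- t) *\<^sub>R w)))"
    by (rule tempered_scaled_conv[OF f R(1) \<theta>])
  also have "\<dots> = (LINT w|lborel. ?R w * distr_conv f (dilate (t * s) \<Phi>) (x - t *\<^sub>R w))"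
    unfolding distr_conv_def by (simp add: algebra_simps)
  finally show ?thesis by (simp add: distr_conv_def s_def)
qed

lemma norm_integral_le_of_nn_integral:
  fixes g :: "'a \<Rightarrow> complex"
  assumes "(\<integral>\<^sup>+x. ennreal (norm (g x)) \<partial>M) \<le> ennreal B" "0 \<le> B"
  shows "norm (LINT x|M. g x) \<le> B"
proof (cases "integrable M g")
  case True
  then have "ennreal (norm (LINT x|M. g x)) \<le> (\<integral>\<^sup>+x. ennreal (norm (g x)) \<partial>M)" by (rule integral_norm_bound_ennreal)
  then have "ennreal (norm (LINT x|M. g x)) \<le> ennreal B" using assms(1) by order
  then show ?thesis using assms(2) by simp
next
  case False
  then show ?thesis using assms(2) by (simp add: not_integrable_integral_eq)
qed

lemma distr_conv_continuous:
  fixes \<theta> :: "real^'n \<Rightarrow> complex"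
  assumes f: "f \<in> tempered_distributions" and \<theta>: "\<theta> \<in> schwartz_space"
  shows "continuous_on UNIV (distr_conv f \<theta>)"
proof -
  have "(\<lambda>z. \<theta> (0 + (- 1) *\<^sub>R z)) \<in> schwartz_space" using schwartz_affine[OF \<theta>, of "-1" 1 0] by simp
  from tempered_translate_continuous[OF f this] show ?thesis unfolding distr_conv_def[abs_def] by simp
qed

text \<open>
  The reproducing formula as an estimate.  The spacing \<open>\<sigma>\<close> is chosen so large that \<open>\<alpha> / 2 ^ (\<sigma> L)\<close>, the
  decay of the remainders, is at most half of \<open>2 powr (- \<delta> \<sigma>)\<close>; the spare factor makes the series converge,
  so that a bound for each single layer is sufficient.  The final remainder vanishes in the limit in every
  seminorm, because \<open>\<psi>\<close> has arbitrarily many derivatives; its bounds depend on \<open>f\<close>, but the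
  limit does not.
\<close>

lemma reproducing_bound:
  fixes \<Phi> :: "real^'n \<Rightarrow> complex"
  assumes \<Phi>: "\<Phi> \<in> schwartz_space" and nz: "(LINT y|lborel. \<Phi> y) \<noteq> 0" and \<delta>: "\<delta> < real L"
  obtains C where "C > 0"
    "\<And>f \<psi> A t x X. f \<in> tempered_distributions \<Longrightarrow> \<psi> \<in> schwartz_space \<Longrightarrow> decay_bound L N A \<psi> \<Longrightarrow> t > 0 \<Longrightarrow> X \<ge> 0 \<Longrightarrow>
      (\<And>l. (\<integral>\<^sup>+w. ennreal (norm (distr_conv f (dilate (t * (1 / 2) ^ l) \<Phi>) (x - t *\<^sub>R w)) / (1 + norm w) ^ N) \<partial>lborel)
         \<le> ennreal (2 powr (\<delta> * real l) * X)) \<Longrightarrow>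
      norm (distr_conv f (dilate t \<psi>) x) \<le> C * A * X"
proof -
  define a where "a = 1 / (LINT y|lborel. \<Phi> y)"
  have a: "a * (LINT y|lborel. \<Phi> y) = 1" using nz by (simp add: a_def)
  define \<alpha> where "\<alpha> = 1 + norm a * (2 ^ N * moment N \<Phi>)"
  have \<alpha>: "\<alpha> \<ge> 1" unfolding \<alpha>_def using moment_nonneg[of N \<Phi>] by simp
  obtain \<sigma> :: nat where \<sigma>: "log 2 (2 * \<alpha>) / (real L - \<delta>) < real \<sigma>" using reals_Archimedean2 by blast
  have \<sigma>1: "\<sigma> \<ge> 1"
  proof -
    have "0 \<le> log 2 (2 * \<alpha>) / (real L - \<delta>)" using \<alpha> \<delta> by simp
    then show ?thesis using \<sigma> by linarith
  qed
  define \<rho> where "\<rho> = \<alpha> * (1 / 2) ^ (\<sigma> * L) * 2 powr (\<delta> * real \<sigma>)"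
  have \<rho>: "0 \<le> \<rho>" "\<rho> \<le> 1 / 2"
  proof -
    have "log 2 (2 * \<alpha>) < (real L - \<delta>) * real \<sigma>" using \<sigma> \<delta> by (simp add: field_simps)
    then have "2 * \<alpha> < 2 powr ((real L - \<delta>) * real \<sigma>)" using \<alpha> by (simp add: log_less_iff)
    also have "\<dots> = 2 ^ (\<sigma> * L) / 2 powr (\<delta> * real \<sigma>)"
    proof -
      have "(real L - \<delta>) * real \<sigma> = real (\<sigma> * L) - \<delta> * real \<sigma>" by (simp add: algebra_simps)
      then show ?thesis by (simp only: powr_diff powr_realpow[OF zero_less_numeral])
    qed
    finally show "\<rho> \<le> 1 / 2" by (simp add: \<rho>_def power_one_over field_simps)
  qed (use \<alpha> in \<open>simp add: \<rho>_def\<close>)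
  obtain c where c: "c > 0" and res: "\<And>\<psi> A L' k. \<psi> \<in> schwartz_space \<Longrightarrow> decay_bound (L' + L) N A \<psi> \<Longrightarrow>
      decay_bound L' N (c * A * (\<alpha> * (1 / 2) ^ (\<sigma> * L)) ^ k) (residual a \<Phi> \<sigma> \<psi> k)"
    using residual_decay[OF \<Phi> a, of L N \<sigma>] unfolding \<alpha>_def by blast
  define C where "C = 2 * (norm a + 1) * c"
  have C: "C > 0" using c by (simp add: C_def add_nonneg_pos)
  have "norm (distr_conv f (dilate t \<psi>) x) \<le> C * A * X"
    if f: "f \<in> tempered_distributions" and \<psi>: "\<psi> \<in> schwartz_space" and d: "decay_bound L N A \<psi>" and t: "t > 0" and X: "X \<ge> 0"
      and hyp: "\<And>l. (\<integral>\<^sup>+w. ennreal (norm (distr_conv f (dilate (t * (1 / 2) ^ l) \<Phi>) (x - t *\<^sub>R w)) / (1 + norm w) ^ N) \<partial>lborel)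
         \<le> ennreal (2 powr (\<delta> * real l) * X)" for f \<psi> A t x X
  proof -
    let ?R = "residual a \<Phi> \<sigma> \<psi>"
    define D where "D k = distr_conv f (dilate t (?R k)) x" for k
    define I where "I k = (LINT w|lborel. ?R k w * distr_conv f (dilate (t * (1 / 2) ^ (\<sigma> * k)) \<Phi>) (x - t *\<^sub>R w))" for k
    have A: "A \<ge> 0" using d by (rule decay_bound_nonneg)
    have tele: "D 0 = D K + (\<Sum>k<K. a * I k)" for K
    proof (induction K)
      case (Suc K)
      then show ?case using residual_step[OF f \<Phi> \<psi> t, of a \<sigma> K x] by (simp add: D_def I_def)
    qed simp
    have I: "norm (I k) \<le> c * A * X * \<rho> ^ k" for k
      unfolding I_def
    proof (rule norm_integral_le_of_nn_integral)
      let ?u = "distr_conv f (dilate (t * (1 / 2) ^ (\<sigma> * k)) \<Phi>)"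
      let ?b = "c * A * (\<alpha> * (1 / 2) ^ (\<sigma> * L)) ^ k"
      have b: "?b \<ge> 0" using c A \<alpha> by simp
      have "t * (1 / 2) ^ (\<sigma> * k) > 0" using t by simp
      then have "?u \<in> borel_measurable borel"
        by (intro borel_measurable_continuous_onI distr_conv_continuous f schwartz_dilate \<Phi>)
      then have [measurable]: "(\<lambda>w. ?u (x - t *\<^sub>R w)) \<in> borel_measurable borel" by measurable
      have R: "decay_bound 0 N ?b (?R k)" using res[OF \<psi>, of 0] d by simp
      have "(\<integral>\<^sup>+w. ennreal (norm (?R k w * ?u (x - t *\<^sub>R w))) \<partial>lborel) \<le> (\<integral>\<^sup>+w. ennreal ?b * ennreal (norm (?u (x - t *\<^sub>R w)) / (1 + norm w) ^ N) \<partial>lborel)"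
      proof (rule nn_integral_mono)
        fix w
        have "norm (?R k w) * norm (?u (x - t *\<^sub>R w)) \<le> ?b / (1 + norm w) ^ N * norm (?u (x - t *\<^sub>R w))"
          using decay_bound_le[OF R, of "[]" w] by (intro mult_right_mono) auto
        then have "norm (?R k w * ?u (x - t *\<^sub>R w)) \<le> ?b * (norm (?u (x - t *\<^sub>R w)) / (1 + norm w) ^ N)" by (simp add: norm_mult)
        then show "ennreal (norm (?R k w * ?u (x - t *\<^sub>R w))) \<le> ennreal ?b * ennreal (norm (?u (x - t *\<^sub>R w)) / (1 + norm w) ^ N)"
          using b by (simp only: ennreal_mult'[OF b, symmetric] ennreal_leI)
      qed
      also have "\<dots> = ennreal ?b * (\<integral>\<^sup>+w. ennreal (norm (?u (x - t *\<^sub>R w)) / (1 + norm w) ^ N) \<partial>lborel)"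
        by (rule nn_integral_cmult) measurable
      also have "\<dots> \<le> ennreal ?b * ennreal (2 powr (\<delta> * real (\<sigma> * k)) * X)" by (intro mult_left_mono hyp) auto
      also have "\<dots> = ennreal (?b * (2 powr (\<delta> * real (\<sigma> * k)) * X))" by (rule ennreal_mult'[OF b, symmetric])
      also have "?b * (2 powr (\<delta> * real (\<sigma> * k)) * X) = c * A * X * \<rho> ^ k"
      proof -
        have "2 powr (\<delta> * real (\<sigma> * k)) = (2 powr (\<delta> * real \<sigma>)) ^ k" by (simp add: powr_powr mult_ac flip: powr_realpow)
        then show ?thesis by (simp add: \<rho>_def power_mult_distrib mult_ac)
      qed
      finally show "(\<integral>\<^sup>+w. ennreal (norm (?R k w * ?u (x - t *\<^sub>R w))) \<partial>lborel) \<le> ennreal (c * A * X * \<rho> ^ k)" .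
    qed (use c A X \<rho> in simp)
    have sum: "norm (\<Sum>k<K. a * I k) \<le> C * A * X" for K
    proof -
      have "norm (\<Sum>k<K. a * I k) \<le> (\<Sum>k<K. norm a * (c * A * X) * (1 / 2) ^ k)"
      proof (rule order_trans[OF norm_sum sum_mono])
        fix k
        have "\<rho> ^ k \<le> (1 / 2) ^ k" using \<rho> by (intro power_mono)
        then have "c * A * X * \<rho> ^ k \<le> c * A * X * (1 / 2) ^ k" using c A X by (intro mult_left_mono) auto
        then have "norm (I k) \<le> c * A * X * (1 / 2) ^ k" using I[of k] by linarith
        then have "norm a * norm (I k) \<le> norm a * (c * A * X * (1 / 2) ^ k)" by (rule mult_left_mono) simp
        then show "norm (a * I k) \<le> norm a * (c * A * X) * (1 / 2) ^ k" by (simp only: norm_mult mult.assoc)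
      qed
      also have "\<dots> = norm a * (c * A * X) * (\<Sum>k<K. (1 / 2) ^ k)" by (simp add: sum_distrib_left)
      also have "\<dots> \<le> norm a * (c * A * X) * 2"
      proof -
        have "(\<Sum>k<K. (1 / 2 :: real) ^ k) \<le> 2" by (simp add: sum_gp_strict)
        then show ?thesis using c A X by (intro mult_left_mono) auto
      qed
      also have "\<dots> \<le> C * A * X"
      proof -
        have "norm a * (c * A * X) * 2 \<le> (norm a + 1) * (c * A * X) * 2" using c A X by (intro mult_right_mono) auto
        then show ?thesis by (simp add: C_def mult_ac)
      qed
      finally show ?thesis .
    qed
    have "norm (D 0) \<le> C * A * X + norm (D K)" for K
      using norm_triangle_ineq[of "D K" "\<Sum>k<K. a * I k"] sum[of K] tele[of K] by simp
    moreover have "(\<lambda>K. C * A * X + norm (D K)) \<longlonglongrightarrow> C * A * X + 0"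
      unfolding D_def by (intro tendsto_intros tendsto_norm_zero residual_tendsto_zero[OF f \<Phi> a \<psi> \<sigma>1 t])
    ultimately have "norm (D 0) \<le> C * A * X + 0" by (intro LIMSEQ_le_const) auto
    then show ?thesis by (simp add: D_def)
  qed
  then show ?thesis using C that by blast
qed


section \<open>Averages against decaying kernels\<close>

text \<open>
  For \<open>s \<le> t\<close> these weights are submultiplicative along \<open>x\<close>, \<open>w\<close>, \<open>v\<close> (\<open>weight_mult\<close> below); this
  replaces all geometric case distinctions.
\<close>

definition weight :: "real \<Rightarrow> 'a::real_normed_vector \<Rightarrow> 'a \<Rightarrow> real" where
  "weight t x v = 1 + norm (x - v) / t"

lemma weight_ge_1: "t > 0 \<Longrightarrow> 1 \<le> weight t x v"
  by (simp add: weight_def)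

lemma weight_mult:
  assumes "0 < s" "s \<le> t"
  shows "weight t x v \<le> weight t x w * weight s w v"
proof -
  have "norm (x - v) \<le> norm (x - w) + norm (w - v)" using norm_triangle_ineq[of "x - w" "w - v"] by simp
  then have "norm (x - v) / t \<le> norm (x - w) / t + norm (w - v) / t" using assms by (simp add: divide_right_mono flip: add_divide_distrib)
  also have "norm (w - v) / t \<le> norm (w - v) / s" using assms by (intro divide_left_mono) auto
  finally have "weight t x v \<le> 1 + norm (x - w) / t + norm (w - v) / s" by (simp add: weight_def)
  also have "\<dots> \<le> weight t x w * weight s w v" using assms by (simp add: weight_def algebra_simps)
  finally show ?thesis .
qed

lemma weight_measurable [measurable]:
  "(\<lambda>v. weight t (x :: 'a::euclidean_space) v) \<in> borel_measurable borel"
  unfolding weight_def by measurable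

text \<open>
  The convolution of \<open>U\<close> with \<open>t\<^sup>-\<^sup>n (1 + |x| / t) ^ - \<Lambda>\<close>.
\<close>

definition kernel_avg :: "nat \<Rightarrow> real \<Rightarrow> ('a::euclidean_space \<Rightarrow> ennreal) \<Rightarrow> 'a \<Rightarrow> ennreal" where
  "kernel_avg \<Lambda> t U x = (\<integral>\<^sup>+v. ennreal (1 / (t ^ DIM('a) * weight t x v ^ \<Lambda>)) * U v \<partial>lborel)"

lemma nn_integral_kernel_cmult:
  fixes U :: "'a::euclidean_space \<Rightarrow> ennreal"
  assumes [measurable]: "U \<in> borel_measurable borel"
  shows "(\<integral>\<^sup>+v. a * (ennreal (1 / (t ^ DIM('a) * weight t x v ^ \<Lambda>)) * U v) \<partial>lborel) = a * kernel_avg \<Lambda> t U x"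
  unfolding kernel_avg_def by (rule nn_integral_cmult) measurable

lemma kernel_avg_affine:
  fixes U :: "'a::euclidean_space \<Rightarrow> ennreal"
  assumes [measurable]: "U \<in> borel_measurable borel" and t: "t > 0"
  shows "kernel_avg \<Lambda> t U x = (\<integral>\<^sup>+w. ennreal (1 / (1 + norm w) ^ \<Lambda>) * U (x - t *\<^sub>R w) \<partial>lborel)"
proof -
  let ?G = "\<lambda>v. ennreal (1 / (t ^ DIM('a) * weight t x v ^ \<Lambda>)) * U v"
  have w: "weight t x (x + (- t) *\<^sub>R w) = 1 + norm w" for w using t by (simp add: weight_def)
  have "kernel_avg \<Lambda> t U x = ennreal (\<bar>- t\<bar> ^ DIM('a)) * (\<integral>\<^sup>+w. ?G (x + (- t) *\<^sub>R w) \<partial>lborel)"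
    unfolding kernel_avg_def by (rule lborel_affine_transform(1)) (use t in \<open>simp, measurable\<close>)
  also have "\<dots> = (\<integral>\<^sup>+w. ennreal (\<bar>- t\<bar> ^ DIM('a)) * ?G (x + (- t) *\<^sub>R w) \<partial>lborel)"
    by (rule nn_integral_cmult[symmetric]) measurable
  also have "\<dots> = (\<integral>\<^sup>+w. ennreal (1 / (1 + norm w) ^ \<Lambda>) * U (x - t *\<^sub>R w) \<partial>lborel)"
  proof (rule nn_integral_cong)
    fix w :: 'a
    have "ennreal (\<bar>- t\<bar> ^ DIM('a)) * ennreal (1 / (t ^ DIM('a) * (1 + norm w) ^ \<Lambda>)) = ennreal (1 / (1 + norm w) ^ \<Lambda>)"
      using t by (simp flip: ennreal_mult')
    then show "ennreal (\<bar>- t\<bar> ^ DIM('a)) * ?G (x + (- t) *\<^sub>R w) = ennreal (1 / (1 + norm w) ^ \<Lambda>) * U (x - t *\<^sub>R w)"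
      unfolding w by (simp add: mult.assoc[symmetric])
  qed
  finally show ?thesis .
qed

lemma kernel_avg_measurable:
  fixes U :: "'a::euclidean_space \<Rightarrow> ennreal"
  assumes [measurable]: "U \<in> borel_measurable borel"
  shows "kernel_avg \<Lambda> t U \<in> borel_measurable borel"
proof -
  have "(\<lambda>x. \<integral>\<^sup>+v. ennreal (1 / (t ^ DIM('a) * weight t x v ^ \<Lambda>)) * U v \<partial>lborel) \<in> borel_measurable borel"
    unfolding weight_def by (rule sigma_finite_measure.borel_measurable_nn_integral[OF sigma_finite_lborel]) measurable
  then show ?thesis unfolding kernel_avg_def[abs_def] .
qed

lemma kernel_avg_shift_le:
  fixes U :: "'a::euclidean_space \<Rightarrow> ennreal"
  assumes U: "U \<in> borel_measurable borel" and s: "0 < s" "s \<le> t"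
  shows "kernel_avg \<Lambda> s U w \<le> ennreal ((t / s) ^ DIM('a) * weight t x w ^ \<Lambda>) * kernel_avg \<Lambda> t U x"
proof -
  let ?d = "DIM('a)"
  let ?c = "(t / s) ^ ?d * weight t x w ^ \<Lambda>"
  note U [measurable]
  have c: "?c \<ge> 0" using s weight_ge_1[of t x w] by simp
  have "kernel_avg \<Lambda> s U w \<le> (\<integral>\<^sup>+v. ennreal ?c * (ennreal (1 / (t ^ ?d * weight t x v ^ \<Lambda>)) * U v) \<partial>lborel)"
    unfolding kernel_avg_def
  proof (rule nn_integral_mono)
    fix v
    have p: "weight t x v > 0" "weight s w v > 0" "weight t x w > 0"
      using s weight_ge_1[of t x v] weight_ge_1[of s w v] weight_ge_1[of t x w] by auto
    have "weight t x v ^ \<Lambda> \<le> (weight t x w * weight s w v) ^ \<Lambda>"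
      using p by (intro power_mono weight_mult s) auto
    then have "1 / weight s w v ^ \<Lambda> \<le> weight t x w ^ \<Lambda> / weight t x v ^ \<Lambda>"
      using p by (simp add: divide_simps power_mult_distrib mult_ac)
    then have "(1 / s ^ ?d) * (1 / weight s w v ^ \<Lambda>) \<le> (1 / s ^ ?d) * (weight t x w ^ \<Lambda> / weight t x v ^ \<Lambda>)"
      using s by (intro mult_left_mono) auto
    also have "\<dots> = ?c * (1 / (t ^ ?d * weight t x v ^ \<Lambda>))" using s by (simp add: power_divide)
    finally have "ennreal (1 / (s ^ ?d * weight s w v ^ \<Lambda>)) \<le> ennreal ?c * ennreal (1 / (t ^ ?d * weight t x v ^ \<Lambda>))"
      using c by (simp flip: ennreal_mult' add: ennreal_leI)
    then show "ennreal (1 / (s ^ ?d * weight s w v ^ \<Lambda>)) * U v \<le> ennreal ?c * (ennreal (1 / (t ^ ?d * weight t x v ^ \<Lambda>)) * U v)"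
      by (simp only: mult.assoc[symmetric] mult_right_mono[OF _ zero_le])
  qed
  also have "\<dots> = ennreal ?c * kernel_avg \<Lambda> t U x" by (rule nn_integral_kernel_cmult[OF U])
  finally show ?thesis .
qed

lemma kernel_avg_antimono:
  fixes U :: "'a::euclidean_space \<Rightarrow> ennreal"
  assumes "t > 0" "\<Lambda> \<le> \<Lambda>'" shows "kernel_avg \<Lambda>' t U x \<le> kernel_avg \<Lambda> t U x"
  unfolding kernel_avg_def
proof (intro nn_integral_mono mult_right_mono ennreal_leI)
  fix v
  have "weight t x v ^ \<Lambda> \<le> weight t x v ^ \<Lambda>'" using assms weight_ge_1[of t x v] by (intro power_increasing) auto
  moreover have "weight t x v ^ \<Lambda> > 0" using assms weight_ge_1[of t x v] by simp
  ultimately show "1 / (t ^ DIM('a) * weight t x v ^ \<Lambda>') \<le> 1 / (t ^ DIM('a) * weight t x v ^ \<Lambda>)"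
    using assms by (intro divide_left_mono mult_left_mono mult_pos_pos) auto
qed auto

text \<open>
  Averaging at a fine scale with good decay does not enlarge an average at a coarse scale: the weight of
  the coarse kernel is moved from \<open>v\<close> to \<open>w\<close>, which costs \<open>k\<close> of the \<open>k + j\<close> powers of the fine kernel, and what
  is left of the latter is integrable in \<open>v\<close>.
\<close>

lemma kernel_avg_iterate_le:
  fixes U :: "'a::euclidean_space \<Rightarrow> ennreal"
  assumes U: "U \<in> borel_measurable borel" and s: "0 < s" "s \<le> t"
  shows "kernel_avg k t (kernel_avg (k + j) s U) x \<le> (\<integral>\<^sup>+y. ennreal (1 / (1 + norm (y::'a)) ^ j) \<partial>lborel) * kernel_avg k t U x"
proof -
  let ?d = "DIM('a)" and ?\<kappa> = "\<integral>\<^sup>+y. ennreal (1 / (1 + norm (y::'a)) ^ j) \<partial>lborel"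
  note U [measurable]
  have "kernel_avg k t (kernel_avg (k + j) s U) x =
    (\<integral>\<^sup>+v. (\<integral>\<^sup>+w. ennreal (1 / (t ^ ?d * weight t x v ^ k)) * (ennreal (1 / (s ^ ?d * weight s v w ^ (k + j))) * U w) \<partial>lborel) \<partial>lborel)"
    unfolding kernel_avg_def by (intro nn_integral_cong nn_integral_cmult[symmetric]) measurable
  also have "\<dots> = (\<integral>\<^sup>+w. (\<integral>\<^sup>+v. ennreal (1 / (t ^ ?d * weight t x v ^ k)) * (ennreal (1 / (s ^ ?d * weight s v w ^ (k + j))) * U w) \<partial>lborel) \<partial>lborel)"
    unfolding weight_def by (rule lborel_pair.Fubini') measurable
  also have "\<dots> \<le> (\<integral>\<^sup>+w. ?\<kappa> * (ennreal (1 / (t ^ ?d * weight t x w ^ k)) * U w) \<partial>lborel)"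
  proof (rule nn_integral_mono)
    fix w
    have "(\<integral>\<^sup>+v. ennreal (1 / (t ^ ?d * weight t x v ^ k)) * (ennreal (1 / (s ^ ?d * weight s v w ^ (k + j))) * U w) \<partial>lborel)
      \<le> (\<integral>\<^sup>+v. (ennreal (1 / (t ^ ?d * weight t x w ^ k)) * U w) * (ennreal (1 / (s ^ ?d * weight s w v ^ j)) * 1) \<partial>lborel)"
    proof (rule nn_integral_mono)
      fix v
      have p: "weight t x v > 0" "weight s v w > 0" "weight t x w > 0"
        using s weight_ge_1[of t x v] weight_ge_1[of s v w] weight_ge_1[of t x w] by auto
      have sym: "weight s w v = weight s v w" by (simp add: weight_def norm_minus_commute)
      have "weight t x w ^ k \<le> (weight t x v * weight s v w) ^ k"
        using p by (intro power_mono weight_mult s) auto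
      then have "1 / (weight t x v ^ k * weight s v w ^ k) \<le> 1 / weight t x w ^ k"
        using p by (intro divide_left_mono) (auto simp: power_mult_distrib)
      then have "1 / (weight t x v ^ k * weight s v w ^ k) * (1 / (t ^ ?d * s ^ ?d * weight s v w ^ j)) \<le> 1 / weight t x w ^ k * (1 / (t ^ ?d * s ^ ?d * weight s v w ^ j))"
        using p s by (intro mult_right_mono) auto
      then have "1 / (t ^ ?d * weight t x v ^ k) * (1 / (s ^ ?d * weight s v w ^ (k + j))) \<le> 1 / (t ^ ?d * weight t x w ^ k) * (1 / (s ^ ?d * weight s w v ^ j))"
        unfolding sym by (simp add: power_add mult_ac)
      then have "ennreal (1 / (t ^ ?d * weight t x v ^ k)) * ennreal (1 / (s ^ ?d * weight s v w ^ (k + j))) \<le> ennreal (1 / (t ^ ?d * weight t x w ^ k)) * ennreal (1 / (s ^ ?d * weight s w v ^ j))"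
        using p s sym by (simp flip: ennreal_mult' add: ennreal_leI)
      then have "ennreal (1 / (t ^ ?d * weight t x v ^ k)) * ennreal (1 / (s ^ ?d * weight s v w ^ (k + j))) * U w \<le> ennreal (1 / (t ^ ?d * weight t x w ^ k)) * ennreal (1 / (s ^ ?d * weight s w v ^ j)) * U w"
        by (rule mult_right_mono) simp
      then show "ennreal (1 / (t ^ ?d * weight t x v ^ k)) * (ennreal (1 / (s ^ ?d * weight s v w ^ (k + j))) * U w) \<le> (ennreal (1 / (t ^ ?d * weight t x w ^ k)) * U w) * (ennreal (1 / (s ^ ?d * weight s w v ^ j)) * 1)"
        by (simp only: mult_ac mult_1_right mult_1_left)
    qed
    also have "\<dots> = (ennreal (1 / (t ^ ?d * weight t x w ^ k)) * U w) * kernel_avg j s (\<lambda>_. 1) w"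
      unfolding kernel_avg_def by (rule nn_integral_cmult) measurable
    also have "kernel_avg j s (\<lambda>_. 1) w = ?\<kappa>" by (subst kernel_avg_affine) (use s in auto)
    finally show "(\<integral>\<^sup>+v. ennreal (1 / (t ^ ?d * weight t x v ^ k)) * (ennreal (1 / (s ^ ?d * weight s v w ^ (k + j))) * U w) \<partial>lborel)
       \<le> ?\<kappa> * (ennreal (1 / (t ^ ?d * weight t x w ^ k)) * U w)" by (simp only: mult.commute)
  qed
  also have "\<dots> = ?\<kappa> * kernel_avg k t U x" by (rule nn_integral_kernel_cmult[OF U])
  finally show ?thesis .
qed

lemma kernel_avg_le_maximal_function:
  fixes U :: "'a::euclidean_space \<Rightarrow> ennreal"
  assumes U: "U \<in> borel_measurable borel" and t: "t > 0" and M: "maximal_function U x \<le> ennreal M" "0 \<le> M"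
  shows "kernel_avg (DIM('a) + 1) t U x \<le> ennreal (2 ^ (DIM('a) + 2) * (M * measure lborel (ball (0::'a) 1)))"
proof -
  let ?d = "DIM('a)"
  note U [measurable]
  show ?thesis unfolding kernel_avg_affine[OF U t]
  proof (rule decay_kernel_integral_le)
    fix \<rho> :: real assume \<rho>: "\<rho> > 0"
    let ?G = "\<lambda>v. U v * indicator (ball x (t * \<rho>)) v"
    have ind: "(indicator (ball x (t * \<rho>)) :: 'a \<Rightarrow> ennreal) \<in> borel_measurable borel" by (intro borel_measurable_indicator) auto
    note ind [measurable]
    have "?G (x + (- t) *\<^sub>R y) = U (x - t *\<^sub>R y) * indicator (ball 0 \<rho>) y" for y
      using t by (simp add: indicator_def dist_norm)
    then have "(\<integral>\<^sup>+v. ?G v \<partial>lborel) = ennreal (\<bar>- t\<bar> ^ ?d) * (\<integral>\<^sup>+y\<in>ball 0 \<rho>. U (x - t *\<^sub>R y) \<partial>lborel)"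
      using lborel_affine_transform(1)[of "- t" ?G x] t by simp
    moreover have "(\<integral>\<^sup>+v. ?G v \<partial>lborel) \<le> ennreal (M * measure lborel (ball x (t * \<rho>)))"
      using t \<rho> M by (intro integral_ball_le_maximal_function) auto
    moreover have "measure lborel (ball x (t * \<rho>)) = t ^ ?d * (measure lborel (ball (0::'a) 1) * \<rho> ^ ?d)"
      using t \<rho> by (simp add: content_ball_conv_unit_ball[of "t * \<rho>" x] power_mult_distrib)
    ultimately have "ennreal (t ^ ?d) * (\<integral>\<^sup>+y\<in>ball 0 \<rho>. U (x - t *\<^sub>R y) \<partial>lborel) \<le> ennreal (t ^ ?d * (M * measure lborel (ball (0::'a) 1) * \<rho> ^ ?d))"
      using t by (simp add: mult_ac)
    then have "ennreal (t ^ ?d) * (\<integral>\<^sup>+y\<in>ball 0 \<rho>. U (x - t *\<^sub>R y) \<partial>lborel) \<le> ennreal (t ^ ?d) * ennreal (M * measure lborel (ball (0::'a) 1) * \<rho> ^ ?d)"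
      using t by (simp only: ennreal_mult'[OF zero_le_power[OF less_imp_le[OF t]]])
    then show "(\<integral>\<^sup>+y\<in>ball 0 \<rho>. U (x - t *\<^sub>R y) \<partial>lborel) \<le> ennreal (M * measure lborel (ball (0::'a) 1) * \<rho> ^ ?d)"
      using t by (subst (asm) ennreal_mult_le_mult_iff) auto
  qed (use M in auto)
qed


section \<open>The sub-mean-value property of the layers\<close>

text \<open>
  Since \<open>f\<close> has finite order, its layers grow at most polynomially in \<open>2 ^ l\<close> and in the distance to \<open>x\<close>.  The
  exponent depends on \<open>f\<close>.
\<close>

lemma tempered_dilate_growth:
  fixes \<Phi> :: "real^'n \<Rightarrow> complex"
  assumes f: "f \<in> tempered_distributions" and \<Phi>: "\<Phi> \<in> schwartz_space"
  obtains \<kappa>0 where "\<And>t x. t > 0 \<Longrightarrow> \<exists>S\<ge>0. \<forall>\<kappa>\<ge>\<kappa>0. \<forall>l w.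
    norm (distr_conv f (dilate (t * (1 / 2) ^ l) \<Phi>) w) \<le> S * 2 powr (real l * \<kappa>) * weight t x w powr \<kappa>"
proof -
  let ?n = "CARD('n)"
  obtain C L N where C: "C > 0" and fb: "\<And>\<psi> A. \<psi> \<in> schwartz_space \<Longrightarrow> decay_bound L N A \<psi> \<Longrightarrow> norm (f \<psi>) \<le> C * A"
    using tempered_bound[OF f] by metis
  obtain A where A: "A > 0" "decay_bound L N A \<Phi>" using schwartz_decay[OF \<Phi>] by metis
  define q where "q = ?n + L + N"
  have "\<exists>S\<ge>0. \<forall>\<kappa>\<ge>real q. \<forall>l w.
    norm (distr_conv f (dilate (t * (1 / 2) ^ l) \<Phi>) w) \<le> S * 2 powr (real l * \<kappa>) * weight t x w powr \<kappa>" if t: "t > 0" for t and x :: "real^'n"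
  proof -
    define K where "K = (1 / t) ^ ?n * (1 + 1 / t) ^ L * ((1 + t) * ((1 + 1 / t) * ((1 + norm x) * (1 + t)))) ^ N"
    have K: "K \<ge> 0" using t by (simp add: K_def)
    have "norm (distr_conv f (dilate (t * (1 / 2) ^ l) \<Phi>) w) \<le> (C * A * K) * 2 powr (real l * \<kappa>) * weight t x w powr \<kappa>"
      if \<kappa>: "\<kappa> \<ge> real q" for \<kappa> l w
    proof -
      define s where "s = t * (1 / 2) ^ l"
      define b where "b = weight t x w"
      have b: "b \<ge> 1" unfolding b_def using t by (rule weight_ge_1)
      have s: "s > 0" "s \<le> t" using t by (auto simp: s_def power_le_one mult_left_le)
      have p2: "(1::real) \<le> 2 ^ l" by simp
      have inv: "1 / s = 2 ^ l * (1 / t)" by (simp add: s_def power_one_over)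
      have inv1: "1 + 1 / s \<le> 2 ^ l * (1 + 1 / t)" unfolding inv using p2 t by (simp add: algebra_simps)
      have w: "1 + norm w \<le> ((1 + norm x) * (1 + t)) * b"
      proof -
        have "1 + norm w \<le> (1 + norm (x - w)) * (1 + norm x)"
          using one_plus_norm_shift_le[of w x] by (simp add: norm_minus_commute)
        also have "(1 + norm (x - w)) * (1 + norm x) \<le> ((1 + t) * b) * (1 + norm x)"
          unfolding b_def weight_def using t by (intro mult_right_mono) (simp_all add: field_simps)
        finally show ?thesis by (simp add: mult_ac)
      qed
      have B: "decay_bound L N (A * (norm (complex_of_real (1 / s ^ ?n)) * (1 + \<bar>- 1 / s\<bar>) ^ L * ((1 + 1 / \<bar>- 1 / s\<bar>) * (1 + norm ((1 / s) *\<^sub>R w))) ^ N)) (\<lambda>z. dilate s \<Phi> (w - z))"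
        unfolding dilate_reflect_eq_affine by (rule decay_bound_affine[OF schwartz_smooth[OF \<Phi>] A(2)]) (use s in auto)
      have "norm (complex_of_real (1 / s ^ ?n)) * (1 + \<bar>- 1 / s\<bar>) ^ L * ((1 + 1 / \<bar>- 1 / s\<bar>) * (1 + norm ((1 / s) *\<^sub>R w))) ^ N
        \<le> (2 ^ l * (1 / t)) ^ ?n * (2 ^ l * (1 + 1 / t)) ^ L * ((1 + t) * ((2 ^ l * (1 + 1 / t)) * (((1 + norm x) * (1 + t)) * b))) ^ N"
      proof (intro mult_mono power_mono)
        show "norm (complex_of_real (1 / s ^ ?n)) \<le> (2 ^ l * (1 / t)) ^ ?n"
        proof -
          have "norm (complex_of_real (1 / s ^ ?n)) = (1 / s) ^ ?n" using s by (simp only: norm_of_real) (simp add: power_one_over)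
          then show ?thesis by (simp add: inv)
        qed
        show "1 + \<bar>- 1 / s\<bar> \<le> 2 ^ l * (1 + 1 / t)" using inv1 s by simp
        show "1 + 1 / \<bar>- 1 / s\<bar> \<le> 1 + t" using s by simp
        show "1 + norm ((1 / s) *\<^sub>R w) \<le> 2 ^ l * (1 + 1 / t) * ((1 + norm x) * (1 + t) * b)"
        proof -
          have "1 + norm ((1 / s) *\<^sub>R w) \<le> (1 + 1 / s) * (1 + norm w)" using scale_weight_le[of "1 / s" w] s by simp
          also have "\<dots> \<le> (2 ^ l * (1 + 1 / t)) * ((1 + norm x) * (1 + t) * b)"
            using inv1 w t s by (intro mult_mono) auto
          finally show ?thesis .
        qed
      qed (use t s b in auto)
      also have "\<dots> = K * (2 ^ l) ^ q * b ^ N"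
        by (simp only: K_def q_def power_add power_mult_distrib mult_ac)
      also have "\<dots> \<le> K * 2 powr (real l * \<kappa>) * b powr \<kappa>"
      proof (intro mult_mono order_refl)
        have "((2::real) ^ l) ^ q = 2 powr (real l * real q)" by (simp add: powr_realpow power_mult flip: of_nat_mult)
        also have "\<dots> \<le> 2 powr (real l * \<kappa>)" using \<kappa> by (intro powr_mono mult_left_mono) auto
        finally show "((2::real) ^ l) ^ q \<le> 2 powr (real l * \<kappa>)" .
        have "b ^ N = b powr real N" using b by (simp add: powr_realpow)
        also have "\<dots> \<le> b powr \<kappa>" using b \<kappa> by (intro powr_mono) (auto simp: q_def)
        finally show "b ^ N \<le> b powr \<kappa>" .
      qed (use K b in auto)
      finally have "decay_bound L N (A * (K * 2 powr (real l * \<kappa>) * b powr \<kappa>)) (\<lambda>z. dilate s \<Phi> (w - z))"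
        using A(1) by (intro decay_bound_mono[OF B order_refl order_refl] mult_left_mono) auto
      then have "norm (f (\<lambda>z. dilate s \<Phi> (w - z))) \<le> C * (A * (K * 2 powr (real l * \<kappa>) * b powr \<kappa>))"
        by (intro fb schwartz_reflect schwartz_dilate \<Phi> s)
      then show ?thesis by (simp add: distr_conv_def s_def b_def mult_ac)
    qed
    then show ?thesis using C A K by (intro exI[of _ "C * A * K"]) auto
  qed
  then show ?thesis using that by blast
qed

text \<open>
  \<open>U\<close> plays the role of \<open>\<psi>\<^sub>0\<^sup>+(f)\<^sup>r\<close>, but only the layers at scales up to \<open>t\<close> matter.
\<close>

definition subscale_majorant :: "real \<Rightarrow> (real^'n \<Rightarrow> complex) \<Rightarrow> ((real^'n \<Rightarrow> complex) \<Rightarrow> complex) \<Rightarrow> real \<Rightarrow> (real^'n \<Rightarrow> ennreal) \<Rightarrow> bool" where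
  "subscale_majorant r \<Phi> f t U \<longleftrightarrow> U \<in> borel_measurable borel \<and>
     (\<forall>l v. ennreal (norm (distr_conv f (dilate (t * (1 / 2) ^ l) \<Phi>) v) powr r) \<le> U v)"

text \<open>
  A Peetre type maximal function of the layers at scales up to \<open>t\<close>, with exponent \<open>\<kappa>\<close>, is at most \<open>S\<close> at \<open>x\<close>.
\<close>

definition peetre_bound :: "real \<Rightarrow> (real^'n \<Rightarrow> complex) \<Rightarrow> ((real^'n \<Rightarrow> complex) \<Rightarrow> complex) \<Rightarrow> real \<Rightarrow> real^'n \<Rightarrow> real \<Rightarrow> bool" where
  "peetre_bound \<kappa> \<Phi> f t x S \<longleftrightarrow>
     (\<forall>l w. norm (distr_conv f (dilate (t * (1 / 2) ^ l) \<Phi>) w) \<le> S * (2 powr (real l * \<kappa>) * weight t x w powr \<kappa>))"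

text \<open>
  The reproducing formula with \<open>\<psi> = \<Phi>\<close> bounds the layer of index \<open>l\<close> at \<open>w\<close> by integrals of \<open>|u\<^sub>l\<^sub>+\<^sub>l\<^sub>'|\<close>.  In
  these, \<open>|u|\<close> is written as \<open>|u|\<^sup>r |u| powr (1 - r)\<close>: the first factor is at most \<open>U\<close>, the second one is
  estimated by the given bound \<open>S\<close>.
\<close>

lemma peetre_improvement:
  fixes \<Phi> :: "real^'n \<Rightarrow> complex"
  assumes \<Phi>: "\<Phi> \<in> schwartz_space" and nz: "(LINT y|lborel. \<Phi> y) \<noteq> 0"
    and r: "0 < r" "r < 1" and \<kappa>: "real \<Lambda> \<le> \<kappa> * r" and \<Lambda>: "CARD('n) \<le> \<Lambda>"
  shows "\<exists>C>0. \<forall>f t x U Y S. f \<in> tempered_distributions \<longrightarrow> t > 0 \<longrightarrow> subscale_majorant r \<Phi> f t U \<longrightarrow>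
      kernel_avg \<Lambda> t U x \<le> ennreal Y \<longrightarrow> 0 \<le> Y \<longrightarrow> 0 \<le> S \<longrightarrow> peetre_bound \<kappa> \<Phi> f t x S \<longrightarrow>
      peetre_bound \<kappa> \<Phi> f t x (C * S powr (1 - r) * Y)"
proof -
  let ?n = "CARD('n)"
  have "0 < real \<Lambda>" using \<Lambda> zero_less_card_finite[where 'a='n] by linarith
  then have "0 < \<kappa> * r" using \<kappa> by linarith
  then have \<kappa>0: "\<kappa> > 0" using r by (simp add: zero_less_mult_iff)
  define N where "N = nat \<lceil>\<kappa>\<rceil>"
  have N: "\<kappa> \<le> real N" using \<kappa>0 by (simp add: N_def)
  then have "\<kappa> < real (Suc N)" by simp
  note rb = reproducing_bound[OF \<Phi> nz this, where N = N]
  obtain C where C: "C > 0" and rep: "\<And>f \<psi> A t x X. f \<in> tempered_distributions \<Longrightarrow> \<psi> \<in> schwartz_space \<Longrightarrow> decay_bound (Suc N) N A \<psi> \<Longrightarrow> t > 0 \<Longrightarrow> X \<ge> 0 \<Longrightarrow>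
      (\<And>l. (\<integral>\<^sup>+w. ennreal (norm (distr_conv f (dilate (t * (1 / 2) ^ l) \<Phi>) (x - t *\<^sub>R w)) / (1 + norm w) ^ N) \<partial>lborel)
         \<le> ennreal (2 powr (\<kappa> * real l) * X)) \<Longrightarrow>
      norm (distr_conv f (dilate t \<psi>) x) \<le> C * A * X"
  proof (rule rb, goal_cases)
    case (1 C)
    show ?case by (rule 1(1)[OF 1(2,3)])
  qed
  obtain A where A: "A > 0" "decay_bound (Suc N) N A \<Phi>" using schwartz_decay[OF \<Phi>] by metis
  have "norm (distr_conv f (dilate (t * (1 / 2) ^ l) \<Phi>) w) \<le> (C * A) * S powr (1 - r) * Y * (2 powr (real l * \<kappa>) * weight t x w powr \<kappa>)"
    if f: "f \<in> tempered_distributions" and t: "t > 0" and maj: "subscale_majorant r \<Phi> f t U"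
      and KY: "kernel_avg \<Lambda> t U x \<le> ennreal Y" and Y: "0 \<le> Y" and S: "0 \<le> S" and pb: "peetre_bound \<kappa> \<Phi> f t x S"
    for f t x U Y S l w
  proof -
    have U: "U \<in> borel_measurable borel"
      and uU: "\<And>l v. ennreal (norm (distr_conv f (dilate (t * (1 / 2) ^ l) \<Phi>) v) powr r) \<le> U v"
      using maj by (auto simp: subscale_majorant_def)
    have apri: "\<And>l w. norm (distr_conv f (dilate (t * (1 / 2) ^ l) \<Phi>) w) \<le> S * (2 powr (real l * \<kappa>) * weight t x w powr \<kappa>)"
      using pb by (simp add: peetre_bound_def)
    define s where "s = t * (1 / 2) ^ l"
    have s: "0 < s" "s \<le> t" using t by (auto simp: s_def power_le_one mult_left_le)
    define b where "b = weight t x w"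
    have b: "b \<ge> 1" unfolding b_def using t by (rule weight_ge_1)
    define X where "X = S powr (1 - r) * Y * (2 powr (real l * \<kappa>) * b powr \<kappa>)"
    have X: "X \<ge> 0" using Y by (simp add: X_def)
    note U [measurable]
    have "norm (distr_conv f (dilate s \<Phi>) w) \<le> C * A * X"
    proof (rule rep[OF f \<Phi> A(2) s(1) X])
      fix l' :: nat
      let ?u = "distr_conv f (dilate (s * (1 / 2) ^ l') \<Phi>)"
      have sc: "s * (1 / 2) ^ l' = t * (1 / 2) ^ (l + l')" by (simp add: s_def power_add)
      have "s * (1 / 2) ^ l' > 0" using s by simp
      then have um [measurable]: "?u \<in> borel_measurable borel"
        by (intro borel_measurable_continuous_onI distr_conv_continuous f schwartz_dilate \<Phi>)
      define c where "c = 2 powr (\<kappa> * real l') * (S powr (1 - r) * (2 powr (real l * \<kappa>) * b powr \<kappa>))"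
      have c: "c \<ge> 0" by (simp add: c_def)
      have "(\<integral>\<^sup>+v. ennreal (norm (?u (w - s *\<^sub>R v)) / (1 + norm v) ^ N) \<partial>lborel) = kernel_avg N s (\<lambda>v. ennreal (norm (?u v))) w"
      proof -
        have "(\<lambda>v. ennreal (norm (?u v))) \<in> borel_measurable borel" by measurable
        then show ?thesis by (subst kernel_avg_affine) (use s in \<open>auto intro!: nn_integral_cong simp flip: ennreal_mult'\<close>)
      qed
      also have "\<dots> \<le> (\<integral>\<^sup>+v. ennreal c * (ennreal (1 / (t ^ ?n * weight t x v ^ \<Lambda>)) * U v) \<partial>lborel)"
        unfolding kernel_avg_def
      proof (rule nn_integral_mono)
        fix v
        define a where "a = weight t x v"
        define e where "e = weight s w v"
        define u where "u = norm (?u v)"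
        have a: "a \<ge> 1" and e: "e \<ge> 1" using weight_ge_1[OF t] weight_ge_1[OF s(1)] by (auto simp: a_def e_def)
        have u: "u \<ge> 0" by (simp add: u_def)
        have E1: "1 / s ^ ?n = 2 powr (real l * real ?n) * (1 / t ^ ?n)"
          by (simp add: s_def power_mult_distrib power_one_over power_divide powr_realpow power_mult flip: of_nat_mult)
        have E2: "1 / e ^ N \<le> b powr \<kappa> * a powr (- \<kappa>)"
        proof -
          have "a powr \<kappa> \<le> (b * e) powr \<kappa>"
            using weight_mult[OF s, of x v w] a \<kappa>0 unfolding a_def b_def e_def by (intro powr_mono2) auto
          also have "\<dots> = b powr \<kappa> * e powr \<kappa>" using b e by (simp add: powr_mult)
          also have "e powr \<kappa> \<le> e powr real N" using e N by (intro powr_mono) auto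
          finally have "a powr \<kappa> \<le> b powr \<kappa> * e ^ N" using e b by (simp add: powr_realpow mult_left_mono)
          moreover have "a powr \<kappa> > 0" "e ^ N > 0" using a e by auto
          ultimately show ?thesis by (simp add: powr_minus_divide divide_simps mult.commute)
        qed
        have E3: "u powr (1 - r) \<le> S powr (1 - r) * 2 powr (real (l + l') * \<kappa> * (1 - r)) * a powr (\<kappa> * (1 - r))"
        proof -
          have "u \<le> S * (2 powr (real (l + l') * \<kappa>) * a powr \<kappa>)" using apri[of "l + l'" v] unfolding u_def a_def sc .
          then have "u powr (1 - r) \<le> (S * (2 powr (real (l + l') * \<kappa>) * a powr \<kappa>)) powr (1 - r)"
            using u r by (intro powr_mono2) auto
          also have "\<dots> = S powr (1 - r) * 2 powr (real (l + l') * \<kappa> * (1 - r)) * a powr (\<kappa> * (1 - r))"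
            using S by (simp add: powr_mult powr_powr mult_ac)
          finally show ?thesis .
        qed
        \<comment> \<open>splitting the power here brings in \<open>U\<close> with exponent \<open>r\<close>; the other factor has been estimated by \<open>S\<close> in \<open>E3\<close>\<close>
    have u_eq: "u = u powr r * u powr (1 - r)" using u by (simp add: powr_add[symmetric])
        have "1 / (s ^ ?n * e ^ N) * u = (1 / s ^ ?n) * (1 / e ^ N) * (u powr r * u powr (1 - r))" using u_eq by simp
        also have "\<dots> \<le> (2 powr (real l * real ?n) * (1 / t ^ ?n)) * (b powr \<kappa> * a powr (- \<kappa>)) * (u powr r * (S powr (1 - r) * 2 powr (real (l + l') * \<kappa> * (1 - r)) * a powr (\<kappa> * (1 - r))))"
          unfolding E1 using E2 E3 t s e by (intro mult_mono order_refl) auto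
        also have "\<dots> = (S powr (1 - r) * b powr \<kappa> * (1 / t ^ ?n) * u powr r) * ((2 powr (real l * real ?n) * 2 powr (real (l + l') * \<kappa> * (1 - r))) * (a powr (- \<kappa>) * a powr (\<kappa> * (1 - r))))"
          by (simp only: mult_ac)
        also have "\<dots> \<le> (S powr (1 - r) * b powr \<kappa> * (1 / t ^ ?n) * u powr r) * ((2 powr (\<kappa> * real l') * 2 powr (real l * \<kappa>)) * (1 / a ^ \<Lambda>))"
        proof (rule mult_left_mono, rule mult_mono)
          have "real l * real ?n + real (l + l') * \<kappa> * (1 - r) \<le> \<kappa> * real l' + real l * \<kappa>"
          proof -
            have "real ?n \<le> \<kappa> * r" using \<Lambda> \<kappa> by linarith
            then have "real l * real ?n \<le> real l * (\<kappa> * r)" by (rule mult_left_mono) simp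
            moreover have "0 \<le> real l' * (\<kappa> * r)" using \<kappa>0 r by simp
            ultimately show ?thesis by (simp add: algebra_simps)
          qed
          then show "2 powr (real l * real ?n) * 2 powr (real (l + l') * \<kappa> * (1 - r)) \<le> 2 powr (\<kappa> * real l') * 2 powr (real l * \<kappa>)"
            by (simp flip: powr_add)
          have "a powr (- \<kappa>) * a powr (\<kappa> * (1 - r)) = a powr (- (\<kappa> * r))" by (simp add: powr_add[symmetric] algebra_simps)
          also have "\<dots> \<le> a powr (- real \<Lambda>)" using a \<kappa> by (intro powr_mono) auto
          also have "\<dots> = 1 / a ^ \<Lambda>" using a by (simp add: powr_minus_divide powr_realpow)
          finally show "a powr (- \<kappa>) * a powr (\<kappa> * (1 - r)) \<le> 1 / a ^ \<Lambda>" .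
        qed (use t in auto)
        also have "\<dots> = (c * (1 / (t ^ ?n * a ^ \<Lambda>))) * u powr r" by (simp add: c_def mult_ac)
        finally have real: "1 / (s ^ ?n * e ^ N) * u \<le> (c * (1 / (t ^ ?n * a ^ \<Lambda>))) * u powr r" .
        have nn: "0 \<le> 1 / (s ^ ?n * e ^ N)" "0 \<le> 1 / (t ^ ?n * a ^ \<Lambda>)" using s e t a by auto
        have "ennreal (1 / (s ^ ?n * e ^ N)) * ennreal u = ennreal (1 / (s ^ ?n * e ^ N) * u)" by (rule ennreal_mult'[OF nn(1), symmetric])
        also have "\<dots> \<le> ennreal ((c * (1 / (t ^ ?n * a ^ \<Lambda>))) * u powr r)" by (rule ennreal_leI[OF real])
        also have "\<dots> = ennreal c * (ennreal (1 / (t ^ ?n * a ^ \<Lambda>)) * ennreal (u powr r))"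
          by (simp only: mult.assoc ennreal_mult'[OF c] ennreal_mult'[OF nn(2)])
        also have "\<dots> \<le> ennreal c * (ennreal (1 / (t ^ ?n * a ^ \<Lambda>)) * U v)"
          using uU[of "l + l'" v] unfolding u_def sc by (intro mult_left_mono) auto
        finally show "ennreal (1 / (s ^ DIM(real^'n) * weight s w v ^ N)) * ennreal (norm (?u v)) \<le> ennreal c * (ennreal (1 / (t ^ ?n * weight t x v ^ \<Lambda>)) * U v)"
          by (simp add: a_def e_def u_def)
      qed
      also have "\<dots> = ennreal c * kernel_avg \<Lambda> t U x" using nn_integral_kernel_cmult[OF U, of "ennreal c" t x \<Lambda>] by simp
      also have "\<dots> \<le> ennreal c * ennreal Y" by (intro mult_left_mono KY) auto
      also have "\<dots> = ennreal (c * Y)" using c by (rule ennreal_mult'[symmetric])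
      also have "c * Y = 2 powr (\<kappa> * real l') * X" by (simp add: c_def X_def mult_ac)
      finally show "(\<integral>\<^sup>+v. ennreal (norm (?u (w - s *\<^sub>R v)) / (1 + norm v) ^ N) \<partial>lborel) \<le> ennreal (2 powr (\<kappa> * real l') * X)" .
    qed
    then show ?thesis by (simp add: X_def s_def b_def mult_ac)
  qed
  then show ?thesis using A C unfolding peetre_bound_def by (intro exI[of _ "C * A"]) auto
qed

text \<open>
  The improvement is applied to the least admissible \<open>S\<close>.  It gives \<open>S \<le> C S powr (1 - r) Y\<close>, and since \<open>S\<close>
  is finite one may divide.
\<close>

lemma peetre_self_bound:
  fixes \<Phi> :: "real^'n \<Rightarrow> complex"
  assumes \<Phi>: "\<Phi> \<in> schwartz_space" and nz: "(LINT y|lborel. \<Phi> y) \<noteq> 0"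
    and r: "0 < r" "r < 1" and \<kappa>: "real \<Lambda> \<le> \<kappa> * r" and \<Lambda>: "CARD('n) \<le> \<Lambda>"
  shows "\<exists>C>0. \<forall>f t x U Y S. f \<in> tempered_distributions \<longrightarrow> t > 0 \<longrightarrow> subscale_majorant r \<Phi> f t U \<longrightarrow>
      kernel_avg \<Lambda> t U x \<le> ennreal Y \<longrightarrow> 0 \<le> Y \<longrightarrow> 0 \<le> S \<longrightarrow> peetre_bound \<kappa> \<Phi> f t x S \<longrightarrow>
      norm (distr_conv f (dilate t \<Phi>) x) powr r \<le> C * Y"
proof -
  obtain C where C: "C > 0" and imp: "\<forall>f t x U Y S. f \<in> tempered_distributions \<longrightarrow> t > 0 \<longrightarrow> subscale_majorant r \<Phi> f t U \<longrightarrow>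
      kernel_avg \<Lambda> t U x \<le> ennreal Y \<longrightarrow> 0 \<le> Y \<longrightarrow> 0 \<le> S \<longrightarrow> peetre_bound \<kappa> \<Phi> f t x S \<longrightarrow>
      peetre_bound \<kappa> \<Phi> f t x (C * S powr (1 - r) * Y)"
    using peetre_improvement[OF \<Phi> nz r \<kappa> \<Lambda>] by (elim exE conjE)
  have "norm (distr_conv f (dilate t \<Phi>) x) powr r \<le> C * Y"
    if f: "f \<in> tempered_distributions" and t: "t > 0" and maj: "subscale_majorant r \<Phi> f t U"
      and KY: "kernel_avg \<Lambda> t U x \<le> ennreal Y" and Y: "0 \<le> Y" and S: "0 \<le> S" and pb: "peetre_bound \<kappa> \<Phi> f t x S"
    for f t x U Y S
  proof -
    define W where "W l w = 2 powr (real l * \<kappa>) * weight t x w powr \<kappa>" for l :: nat and w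
    have W: "W l w > 0" for l w using weight_ge_1[OF t, of x w] by (simp add: W_def)
    define u where "u l w = norm (distr_conv f (dilate (t * (1 / 2) ^ l) \<Phi>) w)" for l w
    have pb_iff: "peetre_bound \<kappa> \<Phi> f t x S \<longleftrightarrow> (\<forall>l w. u l w \<le> S * W l w)" for S
      by (simp add: peetre_bound_def u_def W_def)
    define Q where "Q = (\<lambda>(l, w). u l w / W l w)"
    define s where "s = (SUP p. Q p)"
    have bdd: "bdd_above (range Q)"
    proof (rule bdd_aboveI2)
      fix p show "Q p \<le> S" using pb W by (auto simp: pb_iff Q_def pos_divide_le_eq split: prod.split)
    qed
    have Qs: "u l w / W l w \<le> s" for l w
      unfolding s_def using cSUP_upper[OF _ bdd, of "(l, w)"] by (simp add: Q_def)
    then have us: "u l w \<le> s * W l w" for l w using W by (simp add: pos_divide_le_eq)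
    have s0: "s \<ge> 0"
    proof -
      have "0 \<le> u 0 x / W 0 x" using W[of 0 x] by (simp add: u_def)
      then show ?thesis using Qs[of 0 x] by linarith
    qed
    have "peetre_bound \<kappa> \<Phi> f t x s" using us by (simp add: pb_iff)
    then have "peetre_bound \<kappa> \<Phi> f t x (C * s powr (1 - r) * Y)"
      using imp[rule_format, OF f t maj KY Y s0] by blast
    then have "Q p \<le> C * s powr (1 - r) * Y" for p
      using W by (auto simp: pb_iff Q_def pos_divide_le_eq split: prod.split)
    then have self: "s \<le> C * s powr (1 - r) * Y" unfolding s_def by (intro cSUP_least) auto
    have "s powr r \<le> C * Y"
    proof (cases "s = 0")
      case False
      then have s: "s > 0" using s0 by simp
      have "s powr r * s powr (1 - r) \<le> (C * Y) * s powr (1 - r)"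
        using self s by (simp add: powr_add[symmetric] mult_ac)
      then show ?thesis using s by (simp add: mult_le_cancel_right)
    qed (use C Y in simp)
    moreover have "u 0 x \<le> s" using us[of 0 x] by (simp add: W_def weight_def)
    then have "u 0 x powr r \<le> s powr r" using r by (intro powr_mono2) (auto simp: u_def)
    ultimately show ?thesis by (simp add: u_def)
  qed
  then show ?thesis using C by blast
qed

text \<open>
  The weighted supremum with the exponent \<open>\<kappa> = \<Lambda> / r\<close> might be infinite a priori.  With an exponent \<open>\<kappa>'\<close>
  that depends on \<open>f\<close> it is finite, which yields the assertion with a constant \<open>C'\<close> that depends on \<open>f\<close>, at all
  points \<open>w\<close> and scales up to \<open>t\<close>.  This in turn shows that the supremum with the exponent \<open>\<kappa>\<close> is finite, so the
  constant \<open>C\<close> for \<open>\<kappa>\<close>, which is independent of \<open>f\<close>, is admissible.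
\<close>

lemma pointwise_sub_mean_value:
  fixes \<Phi> :: "real^'n \<Rightarrow> complex"
  assumes \<Phi>: "\<Phi> \<in> schwartz_space" and nz: "(LINT y|lborel. \<Phi> y) \<noteq> 0"
    and r: "0 < r" "r < 1" and \<Lambda>: "CARD('n) \<le> \<Lambda>"
  shows "\<exists>C>0. \<forall>f t x U Y. f \<in> tempered_distributions \<longrightarrow> t > 0 \<longrightarrow> subscale_majorant r \<Phi> f t U \<longrightarrow>
      kernel_avg \<Lambda> t U x \<le> ennreal Y \<longrightarrow> 0 \<le> Y \<longrightarrow> norm (distr_conv f (dilate t \<Phi>) x) powr r \<le> C * Y"
proof -
  let ?n = "CARD('n)"
  define \<kappa> where "\<kappa> = real \<Lambda> / r"
  have \<kappa>: "real \<Lambda> \<le> \<kappa> * r" using r by (simp add: \<kappa>_def)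
  obtain C where C: "C > 0" and bound: "\<forall>f t x U Y S. f \<in> tempered_distributions \<longrightarrow> t > 0 \<longrightarrow> subscale_majorant r \<Phi> f t U \<longrightarrow>
      kernel_avg \<Lambda> t U x \<le> ennreal Y \<longrightarrow> 0 \<le> Y \<longrightarrow> 0 \<le> S \<longrightarrow> peetre_bound \<kappa> \<Phi> f t x S \<longrightarrow>
      norm (distr_conv f (dilate t \<Phi>) x) powr r \<le> C * Y"
    using peetre_self_bound[OF \<Phi> nz r \<kappa> \<Lambda>] by (elim exE conjE)
  have "norm (distr_conv f (dilate t \<Phi>) x) powr r \<le> C * Y"
    if f: "f \<in> tempered_distributions" and t: "t > 0" and maj: "subscale_majorant r \<Phi> f t U"
      and KY: "kernel_avg \<Lambda> t U x \<le> ennreal Y" and Y: "0 \<le> Y"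
    for f t x U Y
  proof -
    have U: "U \<in> borel_measurable borel" using maj by (simp add: subscale_majorant_def)
    obtain \<kappa>0 where growth: "\<And>t x. t > 0 \<Longrightarrow> \<exists>S\<ge>0. \<forall>\<kappa>\<ge>\<kappa>0. \<forall>l w.
      norm (distr_conv f (dilate (t * (1 / 2) ^ l) \<Phi>) w) \<le> S * 2 powr (real l * \<kappa>) * weight t x w powr \<kappa>"
      using tempered_dilate_growth[OF f \<Phi>] by metis
    define \<kappa>' where "\<kappa>' = max \<kappa>0 \<kappa>"
    have "\<kappa> * r \<le> \<kappa>' * r" using r by (intro mult_right_mono) (auto simp: \<kappa>'_def)
    then have \<kappa>': "real \<Lambda> \<le> \<kappa>' * r" using \<kappa> by linarith
    obtain C' where C': "C' > 0" and bound': "\<forall>f t x U Y S. f \<in> tempered_distributions \<longrightarrow> t > 0 \<longrightarrow> subscale_majorant r \<Phi> f t U \<longrightarrow>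
      kernel_avg \<Lambda> t U x \<le> ennreal Y \<longrightarrow> 0 \<le> Y \<longrightarrow> 0 \<le> S \<longrightarrow> peetre_bound \<kappa>' \<Phi> f t x S \<longrightarrow>
      norm (distr_conv f (dilate t \<Phi>) x) powr r \<le> C' * Y"
      using peetre_self_bound[OF \<Phi> nz r \<kappa>' \<Lambda>] by (elim exE conjE)
    define S where "S = (C' * Y) powr (1 / r)"
    have S: "0 \<le> S" by (simp add: S_def)
    have "norm (distr_conv f (dilate (t * (1 / 2) ^ l) \<Phi>) w) \<le> S * (2 powr (real l * \<kappa>) * weight t x w powr \<kappa>)" for l w
    proof -
      define s where "s = t * (1 / 2) ^ l"
      have s: "0 < s" "s \<le> t" using t by (auto simp: s_def power_le_one mult_left_le)
      define b where "b = weight t x w"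
      have b: "b \<ge> 1" unfolding b_def using t by (rule weight_ge_1)
      have sc: "s * (1 / 2) ^ l' = t * (1 / 2) ^ (l + l')" for l' by (simp add: s_def power_add)
      obtain S1 where S1: "S1 \<ge> 0" "\<And>\<kappa> l' v. \<kappa> \<ge> \<kappa>0 \<Longrightarrow>
        norm (distr_conv f (dilate (s * (1 / 2) ^ l') \<Phi>) v) \<le> S1 * 2 powr (real l' * \<kappa>) * weight s w v powr \<kappa>"
        using growth[OF s(1), of w] by blast
      have pb1: "peetre_bound \<kappa>' \<Phi> f s w S1" using S1(2)[of \<kappa>'] by (simp add: peetre_bound_def \<kappa>'_def mult.assoc)
      have maj1: "subscale_majorant r \<Phi> f s U" using maj by (simp add: subscale_majorant_def sc)
      have ts: "(t / s) ^ ?n = 2 powr (real l * real ?n)"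
        using t by (simp add: s_def power_one_over powr_realpow power_mult flip: of_nat_mult)
      have "kernel_avg \<Lambda> s U w \<le> ennreal ((t / s) ^ ?n * b ^ \<Lambda>) * kernel_avg \<Lambda> t U x"
        using kernel_avg_shift_le[OF U s, of \<Lambda> w x] by (simp add: b_def)
      also have "\<dots> \<le> ennreal ((t / s) ^ ?n * b ^ \<Lambda>) * ennreal Y" by (intro mult_left_mono KY) auto
      also have "\<dots> = ennreal (2 powr (real l * real ?n) * b ^ \<Lambda> * Y)" unfolding ts using b by (simp flip: ennreal_mult')
      finally have K: "kernel_avg \<Lambda> s U w \<le> ennreal (2 powr (real l * real ?n) * b ^ \<Lambda> * Y)" .
      have Y1: "0 \<le> 2 powr (real l * real ?n) * b ^ \<Lambda> * Y" using b Y by simp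
      have "norm (distr_conv f (dilate s \<Phi>) w) powr r \<le> C' * (2 powr (real l * real ?n) * b ^ \<Lambda> * Y)"
        by (rule bound'[rule_format, OF f s(1) maj1 K Y1 S1(1) pb1])
      also have "\<dots> \<le> C' * (2 powr (real l * real \<Lambda>) * b ^ \<Lambda> * Y)"
        using C' b Y \<Lambda> by (intro mult_left_mono mult_right_mono powr_mono) auto
      finally have "(norm (distr_conv f (dilate s \<Phi>) w) powr r) powr (1 / r) \<le> ((C' * Y) * (2 powr (real l * real \<Lambda>) * b powr real \<Lambda>)) powr (1 / r)"
        using r b by (intro powr_mono2) (auto simp: powr_realpow mult_ac)
      also have "(norm (distr_conv f (dilate s \<Phi>) w) powr r) powr (1 / r) = norm (distr_conv f (dilate s \<Phi>) w)"
        using r by (simp add: powr_powr)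
      also have "((C' * Y) * (2 powr (real l * real \<Lambda>) * b powr real \<Lambda>)) powr (1 / r) = S * (2 powr (real l * \<kappa>) * b powr \<kappa>)"
        using C' Y r b by (simp add: powr_mult powr_powr S_def \<kappa>_def)
      finally show ?thesis by (simp add: s_def b_def)
    qed
    then have "peetre_bound \<kappa> \<Phi> f t x S" by (simp add: peetre_bound_def)
    then show ?thesis using bound[rule_format, OF f t maj KY Y S] by blast
  qed
  then show ?thesis using C by blast
qed


section \<open>A pointwise bound of the grand maximal function\<close>

lemma dilate_dilate: "dilate t (dilate c \<psi>) = dilate (t * c) \<psi>"
  by (rule ext) (simp add: dilate_def power_mult_distrib mult_ac)

lemma dyadic_dilate_eq_dilate: "dyadic_dilate j \<psi> = dilate (2 powi (- j)) \<psi>"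
  for \<psi> :: "real^'n \<Rightarrow> complex"
proof
  fix x :: "real^'n"
  have "1 / (2 powi (- j)) ^ CARD('n) = (2::real) powi (j * int CARD('n))"
    by (simp add: power_int_minus power_int_mult field_simps)
  then show "dyadic_dilate j \<psi> x = dilate (2 powi (- j)) \<psi> x"
    by (simp add: dyadic_dilate_def dilate_def power_int_minus)
qed

lemma dyadic_scale_subdivide: "2 powi (- j) * (1 / 2) ^ l = (2::real) powi (- (j + int l))"
proof -
  have "(1 / 2 :: real) ^ l = 2 powi (- int l)" by (simp add: power_int_minus power_one_over inverse_eq_divide)
  moreover have "(2::real) powi (- (j + int l)) = 2 powi (- j + - int l)" by simp
  ultimately show ?thesis by (simp only: power_int_add[of "2::real", OF disjI1] zero_neq_numeral)
qed

lemma dyadic_scale_exists: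
  assumes "(\<tau> :: real) > 0"
  shows "\<exists>j. 2 powi (- j) \<le> \<tau> \<and> \<tau> < 2 * 2 powi (- j)"
proof -
  define i where "i = \<lfloor>log 2 \<tau>\<rfloor>"
  have "real_of_int i \<le> log 2 \<tau>" "log 2 \<tau> < real_of_int i + 1" unfolding i_def by linarith+
  then have "2 powr real_of_int i \<le> \<tau>" "\<tau> < 2 powr (real_of_int i + 1)"
    using assms by (simp_all add: le_log_iff log_less_iff)
  then show ?thesis by (intro exI[of _ "- i"]) (simp add: powr_real_of_int' powr_add)
qed

text \<open>
  In the integral of \<open>|u| = |u| powr (1 - r) |u|\<^sup>r\<close> the second factor is at most a constant times a fine
  average \<open>V\<close> of \<open>U\<close>, and the first factor by the trivial estimate of \<open>V\<close> through the coarse average, which costs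
  \<open>2 powr (n l)\<close> and powers of the weight.  The decay \<open>N\<close> compensates the latter, and the coarse average of
  \<open>V\<close> is controlled by the maximal function.
\<close>

lemma layer_integral_le:
  fixes \<Phi> :: "real^'n \<Rightarrow> complex"
  assumes \<Phi>: "\<Phi> \<in> schwartz_space" and nz: "(LINT y|lborel. \<Phi> y) \<noteq> 0"
    and r: "0 < r" "r < 1" and N: "real (CARD('n) + 1) * (1 / r) \<le> real N"
  shows "\<exists>C>0. \<forall>f t x y U M l. f \<in> tempered_distributions \<longrightarrow> t > 0 \<longrightarrow> subscale_majorant r \<Phi> f t U \<longrightarrow>
      norm (x - y) \<le> 2 * t \<longrightarrow> 0 \<le> M \<longrightarrow> maximal_function U x \<le> ennreal M \<longrightarrow>
      (\<integral>\<^sup>+w. ennreal (norm (distr_conv f (dilate (t * (1 / 2) ^ l) \<Phi>) (y - t *\<^sub>R w)) / (1 + norm w) ^ N) \<partial>lborel)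
         \<le> ennreal (2 powr (real CARD('n) * (1 / r - 1) * real l) * (C * M powr (1 / r)))"
proof -
  let ?n = "CARD('n)"
  define \<theta> where "\<theta> = 1 / r - 1"
  have \<theta>: "\<theta> > 0" using r by (simp add: \<theta>_def)
  have nn: "?n \<le> ?n + 1 + (?n + 1)" by simp
  obtain C where C: "C > 0" and smv: "\<forall>f t x U Y. f \<in> tempered_distributions \<longrightarrow> t > 0 \<longrightarrow> subscale_majorant r \<Phi> f t U \<longrightarrow>
      kernel_avg (?n + 1 + (?n + 1)) t U x \<le> ennreal Y \<longrightarrow> 0 \<le> Y \<longrightarrow> norm (distr_conv f (dilate t \<Phi>) x) powr r \<le> C * Y"
    using pointwise_sub_mean_value[OF \<Phi> nz r nn] by (elim exE conjE)
  define K0 where "K0 = 2 ^ (?n + 2) * measure lborel (ball (0 :: real^'n) 1)"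
  have K0: "K0 > 0" by (simp add: K0_def)
  define \<kappa> where "\<kappa> = enn2real (\<integral>\<^sup>+y. ennreal (1 / (1 + norm (y :: real^'n)) ^ (?n + 1)) \<partial>lborel)"
  have \<kappa>: "(\<integral>\<^sup>+y. ennreal (1 / (1 + norm (y :: real^'n)) ^ (?n + 1)) \<partial>lborel) = ennreal \<kappa>" "\<kappa> \<ge> 0"
    using nn_integral_decay_kernel_finite[where 'a = "real^'n"] by (auto simp: \<kappa>_def)
  define D where "D = 3 ^ N * (C powr \<theta> * K0 powr \<theta>) * (C * (\<kappa> * K0)) + 1"
  have D: "D > 0" using C K0 \<kappa> by (simp add: D_def add_nonneg_pos)
  have "(\<integral>\<^sup>+w. ennreal (norm (distr_conv f (dilate (t * (1 / 2) ^ l) \<Phi>) (y - t *\<^sub>R w)) / (1 + norm w) ^ N) \<partial>lborel)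
         \<le> ennreal (2 powr (real ?n * \<theta> * real l) * (D * M powr (1 / r)))"
    if f: "f \<in> tempered_distributions" and t: "t > 0" and maj: "subscale_majorant r \<Phi> f t U" and xy: "norm (x - y) \<le> 2 * t"
      and M: "0 \<le> M" "maximal_function U x \<le> ennreal M" for f t x y U M l
  proof -
    have U: "U \<in> borel_measurable borel" using maj by (simp add: subscale_majorant_def)
    note U [measurable]
    define s where "s = t * (1 / 2) ^ l"
    have s: "0 < s" "s \<le> t" using t by (auto simp: s_def power_le_one mult_left_le)
    let ?u = "distr_conv f (dilate s \<Phi>)"
    have um [measurable]: "?u \<in> borel_measurable borel"
      by (intro borel_measurable_continuous_onI distr_conv_continuous f schwartz_dilate \<Phi> s)
    have sc: "s * (1 / 2) ^ l' = t * (1 / 2) ^ (l + l')" for l' by (simp add: s_def power_add)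
    have maj1: "subscale_majorant r \<Phi> f s U" using maj by (simp add: subscale_majorant_def sc)
    define V where "V = kernel_avg (?n + 1 + (?n + 1)) s U"
    have Vm [measurable]: "V \<in> borel_measurable borel" unfolding V_def by (rule kernel_avg_measurable[OF U])
    define q where "q = K0 * M"
    have q: "q \<ge> 0" using K0 M by (simp add: q_def)
    have Q: "kernel_avg (?n + 1) t U x \<le> ennreal q"
      using kernel_avg_le_maximal_function[OF U t M(2,1)] by (simp add: q_def K0_def mult_ac)
    have ts: "(t / s) ^ ?n = 2 powr (real l * real ?n)"
      using t by (simp add: s_def power_one_over powr_realpow power_mult flip: of_nat_mult)
    have V_le: "V v \<le> ennreal (2 powr (real l * real ?n) * weight t x v ^ (?n + 1) * q)" for v
    proof -
      have b: "weight t x v \<ge> 1" using t by (rule weight_ge_1)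
      have "V v \<le> kernel_avg (?n + 1) s U v" unfolding V_def by (rule kernel_avg_antimono) (use s in auto)
      also have "\<dots> \<le> ennreal ((t / s) ^ ?n * weight t x v ^ (?n + 1)) * kernel_avg (?n + 1) t U x"
        using kernel_avg_shift_le[OF U s, of "?n + 1" v x] by simp
      also have "\<dots> \<le> ennreal ((t / s) ^ ?n * weight t x v ^ (?n + 1)) * ennreal q" by (intro mult_left_mono Q) auto
      also have "\<dots> = ennreal (2 powr (real l * real ?n) * weight t x v ^ (?n + 1) * q)" unfolding ts using b by (simp flip: ennreal_mult')
      finally show ?thesis .
    qed
    define c where "c = 3 ^ N * (C powr \<theta> * 2 powr (real ?n * \<theta> * real l) * q powr \<theta>) * C"
    have c: "c \<ge> 0" using C by (simp add: c_def)
    have "(\<integral>\<^sup>+w. ennreal (norm (?u (y - t *\<^sub>R w)) / (1 + norm w) ^ N) \<partial>lborel) = kernel_avg N t (\<lambda>v. ennreal (norm (?u v))) y"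
    proof -
      have "(\<lambda>v. ennreal (norm (?u v))) \<in> borel_measurable borel" by measurable
      then show ?thesis by (subst kernel_avg_affine) (use t in \<open>auto intro!: nn_integral_cong simp flip: ennreal_mult'\<close>)
    qed
    also have "\<dots> \<le> (\<integral>\<^sup>+v. ennreal c * (ennreal (1 / (t ^ ?n * weight t x v ^ (?n + 1))) * V v) \<partial>lborel)"
      unfolding kernel_avg_def
    proof (rule nn_integral_mono)
      fix v
      define b where "b = weight t x v"
      have b: "b \<ge> 1" unfolding b_def using t by (rule weight_ge_1)
      define e where "e = weight t y v"
      have e: "e \<ge> 1" unfolding e_def using t by (rule weight_ge_1)
      define V' where "V' = enn2real (V v)"
      have V': "V v = ennreal V'" "V' \<ge> 0" "V' \<le> 2 powr (real l * real ?n) * b ^ (?n + 1) * q"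
      proof -
        have "V v < \<infinity>" using V_le[of v] by (simp add: le_less_trans)
        then show "V v = ennreal V'" by (simp add: V'_def)
        show "V' \<ge> 0" by (simp add: V'_def)
        show "V' \<le> 2 powr (real l * real ?n) * b ^ (?n + 1) * q"
          unfolding V'_def b_def by (rule enn2real_leI[OF _ V_le]) (use q weight_ge_1[OF t, of x v] in simp)
      qed
      define u where "u = norm (?u v)"
      have u: "u \<ge> 0" by (simp add: u_def)
      have ur: "u powr r \<le> C * V'"
        unfolding u_def using smv[rule_format, OF f s(1) maj1, of v V'] V' by (simp add: V_def)
      have be: "b \<le> 3 * e"
      proof -
        have "b \<le> weight t x y * e" unfolding b_def e_def using t by (intro weight_mult) auto
        also have "weight t x y \<le> 3" using xy t by (simp add: weight_def divide_le_eq)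
        finally show ?thesis using e by (simp add: mult_right_mono)
      qed
      have E2: "1 / e ^ N \<le> 3 ^ N / b ^ N"
      proof -
        have "b ^ N \<le> 3 ^ N * e ^ N" using power_mono[OF be, of N] b by (simp add: power_mult_distrib)
        then show ?thesis using b e by (simp add: divide_simps mult_ac)
      qed
      have E3: "u powr (1 - r) \<le> C powr \<theta> * 2 powr (real ?n * \<theta> * real l) * q powr \<theta> * b powr (real (?n + 1) * \<theta>)"
      proof -
        have "u powr (1 - r) = (u powr r) powr \<theta>" 
        proof -
          have "r * \<theta> = 1 - r" using r by (simp add: \<theta>_def right_diff_distrib)
          then show ?thesis by (simp only: powr_powr)
        qed
        also have "\<dots> \<le> (C * (2 powr (real l * real ?n) * b ^ (?n + 1) * q)) powr \<theta>"
          using ur V'(3) C \<theta> by (intro powr_mono2 order_trans[OF ur] mult_left_mono) auto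
        also have "\<dots> = C powr \<theta> * 2 powr (real ?n * \<theta> * real l) * q powr \<theta> * b powr (real (?n + 1) * \<theta>)"
        proof -
          have "b ^ (?n + 1) = b powr real (?n + 1)" using b by (simp only: powr_realpow)
          then show ?thesis using C b q by (simp add: powr_mult powr_powr mult_ac)
        qed
        finally show ?thesis .
      qed
      have u_eq: "u = u powr (1 - r) * u powr r" using u by (simp add: powr_add[symmetric])
      have "1 / (t ^ ?n * e ^ N) * u = (1 / t ^ ?n) * (1 / e ^ N) * (u powr (1 - r) * u powr r)" using u_eq by simp
      also have "\<dots> \<le> (1 / t ^ ?n) * (3 ^ N / b ^ N) * ((C powr \<theta> * 2 powr (real ?n * \<theta> * real l) * q powr \<theta> * b powr (real (?n + 1) * \<theta>)) * (C * V'))"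
        using E2 E3 ur t b e by (intro mult_mono order_refl) auto
      also have "\<dots> = (c * (1 / t ^ ?n) * V') * (b powr (real (?n + 1) * \<theta>) * (1 / b ^ N))"
        by (simp add: c_def mult_ac)
      also have "\<dots> \<le> (c * (1 / t ^ ?n) * V') * (1 / b ^ (?n + 1))"
      proof (rule mult_left_mono)
        have "real (?n + 1) * \<theta> - real N \<le> - real (?n + 1)" using N by (simp add: \<theta>_def algebra_simps)
        then have "b powr (real (?n + 1) * \<theta> - real N) \<le> b powr (- real (?n + 1))" using b by (intro powr_mono)
        then show "b powr (real (?n + 1) * \<theta>) * (1 / b ^ N) \<le> 1 / b ^ (?n + 1)"
          using b by (simp only: powr_diff powr_minus_divide powr_realpow[OF less_le_trans[OF zero_less_one b]]) simp
      qed (use c t V' in simp)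
      also have "\<dots> = c * (1 / (t ^ ?n * b ^ (?n + 1)) * V')" by simp
      finally have real: "1 / (t ^ ?n * e ^ N) * u \<le> c * (1 / (t ^ ?n * b ^ (?n + 1)) * V')" .
      have nn: "0 \<le> 1 / (t ^ ?n * e ^ N)" "0 \<le> 1 / (t ^ ?n * b ^ (?n + 1))" using e t b by auto
      have "ennreal (1 / (t ^ ?n * e ^ N)) * ennreal u = ennreal (1 / (t ^ ?n * e ^ N) * u)" by (rule ennreal_mult'[OF nn(1), symmetric])
      also have "\<dots> \<le> ennreal (c * (1 / (t ^ ?n * b ^ (?n + 1)) * V'))" by (rule ennreal_leI[OF real])
      also have "\<dots> = ennreal c * (ennreal (1 / (t ^ ?n * b ^ (?n + 1))) * V v)"
        by (simp only: ennreal_mult'[OF c] ennreal_mult'[OF nn(2)] V'(1))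
      finally show "ennreal (1 / (t ^ DIM(real^'n) * weight t y v ^ N)) * ennreal (norm (?u v)) \<le> ennreal c * (ennreal (1 / (t ^ ?n * weight t x v ^ (?n + 1))) * V v)"
        by (simp add: b_def e_def u_def)
    qed
    also have "\<dots> = ennreal c * kernel_avg (?n + 1) t V x" using nn_integral_kernel_cmult[OF Vm, of "ennreal c" t x "?n + 1"] by simp
    also have "\<dots> \<le> ennreal c * (ennreal \<kappa> * ennreal q)"
    proof (rule mult_left_mono)
      have "kernel_avg (?n + 1) t V x \<le> ennreal \<kappa> * kernel_avg (?n + 1) t U x"
        unfolding V_def using kernel_avg_iterate_le[OF U s, of "?n + 1" "?n + 1" x] by (simp only: \<kappa>(1))
      also have "\<dots> \<le> ennreal \<kappa> * ennreal q" by (intro mult_left_mono Q) auto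
      finally show "kernel_avg (?n + 1) t V x \<le> ennreal \<kappa> * ennreal q" .
    qed simp
    also have "\<dots> = ennreal (c * (\<kappa> * q))" using c \<kappa> by (simp flip: ennreal_mult')
    also have "\<dots> \<le> ennreal (2 powr (real ?n * \<theta> * real l) * (D * M powr (1 / r)))"
    proof (rule ennreal_leI)
      have "M powr \<theta> * M = M powr (1 / r)"
      proof -
        have "M powr (1 / r) = M powr (\<theta> + 1)" by (simp add: \<theta>_def)
        also have "\<dots> = M powr \<theta> * M powr 1" by (rule powr_add)
        finally show ?thesis using M by simp
      qed
      moreover have "q powr \<theta> = K0 powr \<theta> * M powr \<theta>" using K0 M by (simp add: q_def powr_mult)
      ultimately have "c * (\<kappa> * q) = 2 powr (real ?n * \<theta> * real l) * ((D - 1) * M powr (1 / r))"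
        by (simp add: c_def D_def q_def mult_ac)
      also have "\<dots> \<le> 2 powr (real ?n * \<theta> * real l) * (D * M powr (1 / r))"
        by (intro mult_left_mono mult_right_mono) auto
      finally show "c * (\<kappa> * q) \<le> 2 powr (real ?n * \<theta> * real l) * (D * M powr (1 / r))" .
    qed
    finally show ?thesis unfolding s_def .
  qed
  then show ?thesis using D unfolding \<theta>_def by blast
qed

text \<open>
  A test function at scale \<open>\<tau>\<close> is one at the dyadic scale \<open>t \<le> \<tau> < 2 t\<close>, dilated by a factor \<open>c\<close> in \<open>[1, 2)\<close>,
  which changes its seminorms by a bounded factor.  The hypothesis on \<open>m\<close> makes the growth of the layer
  integrals slower than the decay in the reproducing formula, and it implies that the order of decay
  \<open>(m + 2) (n + 1)\<close> of the test functions is large enough.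
\<close>

lemma grand_max_le_maximal_function:
  fixes \<Phi> :: "real^'n \<Rightarrow> complex"
  assumes \<Phi>: "\<Phi> \<in> schwartz_space" and nz: "(LINT y|lborel. \<Phi> y) \<noteq> 0"
    and r: "0 < r" "r < 1" and m: "real CARD('n) / r < real m + 1 + real CARD('n)"
  shows "\<exists>C\<ge>1. \<forall>f U x M. f \<in> tempered_distributions \<longrightarrow> U \<in> borel_measurable borel \<longrightarrow>
      (\<forall>j v. ennreal (norm (distr_conv f (dyadic_dilate j \<Phi>) v) powr r) \<le> U v) \<longrightarrow>
      0 \<le> M \<longrightarrow> maximal_function U x \<le> ennreal M \<longrightarrow> grand_max m f x \<le> ennreal (C * M powr (1 / r))"
proof -
  let ?n = "CARD('n)"
  define N where "N = (m + 2) * (?n + 1)"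
  have n: "real ?n \<ge> 1" using zero_less_card_finite[where 'a='n] by linarith
  have \<delta>: "real ?n * (1 / r - 1) < real (m + 1)" using m by (simp add: right_diff_distrib)
  have N: "real (?n + 1) * (1 / r) \<le> real N"
  proof -
    have "1 / r < (real m + 1 + real ?n) / real ?n" using m n by (simp add: field_simps)
    also have "\<dots> \<le> real m + 2"
    proof -
      have "real m \<le> real m * real ?n" using n by (simp add: mult_le_cancel_left1)
      moreover have "(real m + 2) * real ?n = real m * real ?n + 2 * real ?n" by (rule distrib_right)
      ultimately have "real m + 1 + real ?n \<le> (real m + 2) * real ?n" using n by linarith
      then show ?thesis using n by (simp add: divide_le_eq)
    qed
    finally have "real (?n + 1) * (1 / r) \<le> real (?n + 1) * (real m + 2)" by (intro mult_left_mono) auto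
    moreover have "real N = real (?n + 1) * (real m + 2)" by (simp add: N_def algebra_simps)
    ultimately show ?thesis by simp
  qed
  note rb = reproducing_bound[OF \<Phi> nz \<delta>, where N = N]
  obtain C where C: "C > 0" and rep: "\<And>f \<psi> A t x X. f \<in> tempered_distributions \<Longrightarrow> \<psi> \<in> schwartz_space \<Longrightarrow> decay_bound (m + 1) N A \<psi> \<Longrightarrow> t > 0 \<Longrightarrow> X \<ge> 0 \<Longrightarrow>
      (\<And>l. (\<integral>\<^sup>+w. ennreal (norm (distr_conv f (dilate (t * (1 / 2) ^ l) \<Phi>) (x - t *\<^sub>R w)) / (1 + norm w) ^ N) \<partial>lborel)
         \<le> ennreal (2 powr (real ?n * (1 / r - 1) * real l) * X)) \<Longrightarrow>
      norm (distr_conv f (dilate t \<psi>) x) \<le> C * A * X"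
  proof (rule rb, goal_cases)
    case (1 C)
    show ?case by (rule 1(1)[OF 1(2,3)])
  qed
  obtain D where D: "D > 0" and tail: "\<forall>f t x y U M l. f \<in> tempered_distributions \<longrightarrow> t > 0 \<longrightarrow> subscale_majorant r \<Phi> f t U \<longrightarrow>
      norm (x - y) \<le> 2 * t \<longrightarrow> 0 \<le> M \<longrightarrow> maximal_function U x \<le> ennreal M \<longrightarrow>
      (\<integral>\<^sup>+w. ennreal (norm (distr_conv f (dilate (t * (1 / 2) ^ l) \<Phi>) (y - t *\<^sub>R w)) / (1 + norm w) ^ N) \<partial>lborel)
         \<le> ennreal (2 powr (real ?n * (1 / r - 1) * real l) * (D * M powr (1 / r)))"
    using layer_integral_le[OF \<Phi> nz r N] by (elim exE conjE)
  define A where "A = (2::real) ^ (m + 1) * 3 ^ N"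
  have A: "A > 0" by (simp add: A_def)
  define C' where "C' = max 1 (C * A * D)"
  have "grand_max m f x \<le> ennreal (C' * M powr (1 / r))"
    if f: "f \<in> tempered_distributions" and U: "U \<in> borel_measurable borel"
      and uU: "\<And>j v. ennreal (norm (distr_conv f (dyadic_dilate j \<Phi>) v) powr r) \<le> U v"
      and M: "0 \<le> M" "maximal_function U x \<le> ennreal M" for f U x M
    unfolding grand_max_def nontangential_max_def
  proof (intro SUP_least, clarsimp simp del: ennreal_le_iff)
    fix \<psi> :: "real^'n \<Rightarrow> complex" and y :: "real^'n" and \<tau> :: real
    assume \<psi>: "\<psi> \<in> normalized_schwartz m" and \<tau>: "0 < \<tau>" "dist x y < \<tau>"
    have S: "\<psi> \<in> schwartz_space" and d: "decay_bound (m + 1) N 1 \<psi>"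
      using \<psi> by (auto simp: normalized_schwartz_iff N_def)
    obtain j where j: "2 powi (- j) \<le> \<tau>" "\<tau> < 2 * 2 powi (- j)" using dyadic_scale_exists[OF \<tau>(1)] by blast
    define t :: real where "t = 2 powi (- j)"
    have t: "t > 0" by (simp add: t_def)
    define c where "c = \<tau> / t"
    have c: "1 \<le> c" "c < 2" "t * c = \<tau>" using j t by (auto simp: c_def t_def[symmetric] field_simps)
    have d1: "decay_bound (m + 1) N (1 * (norm (complex_of_real (1 / c ^ ?n)) * (1 + \<bar>1 / c\<bar>) ^ (m + 1) * ((1 + 1 / \<bar>1 / c\<bar>) * (1 + norm (0 :: real^'n))) ^ N)) (dilate c \<psi>)"
      unfolding dilate_eq_affine by (rule decay_bound_affine[OF schwartz_smooth[OF S] d]) (use c in auto)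
    have le: "norm (complex_of_real (1 / c ^ ?n)) * (1 + \<bar>1 / c\<bar>) ^ (m + 1) * ((1 + 1 / \<bar>1 / c\<bar>) * (1 + norm (0 :: real^'n))) ^ N \<le> 1 * 2 ^ (m + 1) * 3 ^ N"
    proof (intro mult_mono power_mono)
      have "1 / c ^ ?n \<le> 1" using c by simp
      moreover have "norm (complex_of_real (1 / c ^ ?n)) = \<bar>1 / c ^ ?n\<bar>" by (rule norm_of_real)
      ultimately show "norm (complex_of_real (1 / c ^ ?n)) \<le> 1" using c by simp
    qed (use c in auto)
    have dc: "decay_bound (m + 1) N A (dilate c \<psi>)"
      by (rule decay_bound_mono[OF d1 order_refl order_refl]) (use le in \<open>simp only: A_def mult_1_left\<close>)
    have maj: "subscale_majorant r \<Phi> f t U"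
    proof -
      have "dilate (2 powi (- (j + int l))) \<Phi> = dyadic_dilate (j + int l) \<Phi>" for l
        by (simp only: dyadic_dilate_eq_dilate)
      then show ?thesis
        unfolding subscale_majorant_def t_def dyadic_scale_subdivide using uU U by (simp only: simp_thms)
    qed
    have xy: "norm (x - y) \<le> 2 * t" using \<tau> j by (simp add: dist_norm t_def)
    have X: "0 \<le> D * M powr (1 / r)" using D by simp
    have "norm (distr_conv f (dilate t (dilate c \<psi>)) y) \<le> C * A * (D * M powr (1 / r))"
      by (rule rep[OF f schwartz_dilate[OF S] dc t X]) (use c in simp, rule tail[rule_format, OF f t maj xy M])
    also have "\<dots> \<le> C' * M powr (1 / r)" unfolding mult.assoc[symmetric] C'_def by (intro mult_right_mono) auto
    finally show "ennreal (norm (distr_conv f (dilate \<tau> \<psi>) y)) \<le> ennreal (C' * M powr (1 / r))"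
      unfolding dilate_dilate c(3) by (rule ennreal_leI)
  qed
  then show ?thesis by (intro exI[of _ C']) (auto simp: C'_def)
qed


section \<open>Comparison of the maximal functions\<close>

lemma borel_measurable_of_open_superlevel:
  fixes g :: "real^'n \<Rightarrow> ennreal"
  assumes "\<And>a. open {x. a < g x}" shows "g \<in> borel_measurable borel"
  by (rule borel_measurableI_greater) (use assms in simp)

text \<open>
  If a cone over \<open>x\<close> contains a point with a large value, then so do the cones over all nearby points.
\<close>

lemma open_less_nontangential_max: "open {x. a < nontangential_max \<psi> f x}"
proof -
  have "{x. a < nontangential_max \<psi> f x} =
    (\<Union>y. \<Union>t\<in>{t. 0 < t \<and> a < ennreal (norm (distr_conv f (dilate t \<psi>) y))}. ball y t)"
    unfolding nontangential_max_def less_SUP_iff by (auto simp: dist_commute) blast+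
  then show ?thesis by (simp add: open_UN)
qed

lemma nontangential_max_measurable: "nontangential_max \<psi> f \<in> borel_measurable borel"
  by (intro borel_measurable_of_open_superlevel open_less_nontangential_max)

lemma grand_max_measurable: "grand_max m f \<in> borel_measurable borel"
proof (rule borel_measurable_of_open_superlevel)
  fix a
  have "{x. a < grand_max m f x} = (\<Union>\<psi>\<in>normalized_schwartz m. {x. a < nontangential_max \<psi> f x})"
    unfolding grand_max_def less_SUP_iff by auto
  then show "open {x. a < grand_max m f x}" by (simp add: open_UN open_less_nontangential_max)
qed

lemma dyadic_convolution_measurable:
  fixes \<Phi> :: "real^'n \<Rightarrow> complex"
  assumes "f \<in> tempered_distributions" "\<Phi> \<in> schwartz_space"
  shows "distr_conv f (dyadic_dilate j \<Phi>) \<in> borel_measurable borel"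
  unfolding dyadic_dilate_eq_dilate
  by (intro borel_measurable_continuous_onI distr_conv_continuous assms schwartz_dilate) simp

lemma dyadic_radial_max_measurable:
  assumes f: "f \<in> tempered_distributions" and \<Phi>: "\<Phi> \<in> schwartz_space"
  shows "dyadic_radial_max \<Phi> f \<in> borel_measurable borel"
proof -
  note dyadic_convolution_measurable[OF f \<Phi>, measurable]
  have "(\<lambda>x. SUP j. ennreal (norm (distr_conv f (dyadic_dilate j \<Phi>) x))) \<in> borel_measurable borel"
    by (rule borel_measurable_SUP) auto
  then show ?thesis unfolding dyadic_radial_max_def[abs_def] .
qed

lemma dyadic_radial_max_le_nontangential_max: "dyadic_radial_max \<psi> f x \<le> nontangential_max \<psi> f x"
  unfolding dyadic_radial_max_def
proof (rule SUP_least)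
  fix j
  have "(x, 2 powi (- j)) \<in> {(y, t). 0 < t \<and> dist x y < t}" by simp
  then show "ennreal (norm (distr_conv f (dyadic_dilate j \<psi>) x)) \<le> nontangential_max \<psi> f x"
    unfolding nontangential_max_def dyadic_dilate_eq_dilate by (rule SUP_upper2) simp
qed

lemma nontangential_max_le_grand_max:
  fixes \<psi> :: "real^'n \<Rightarrow> complex"
  assumes \<psi>: "\<psi> \<in> schwartz_space"
  obtains C where "C \<ge> 1" "\<And>f x. f \<in> tempered_distributions \<Longrightarrow> nontangential_max \<psi> f x \<le> ennreal C * grand_max m f x"
proof -
  let ?N = "(m + 2) * (CARD('n) + 1)"
  obtain A0 where A0: "A0 > 0" "decay_bound (m + 1) ?N A0 \<psi>" using schwartz_decay[OF \<psi>] by metis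
  define A where "A = max 1 A0"
  have A: "A \<ge> 1" "decay_bound (m + 1) ?N A \<psi>" using decay_bound_mono[OF A0(2) order_refl order_refl, of A] by (auto simp: A_def)
  define \<eta> where "\<eta> = (\<lambda>z. complex_of_real (1 / A) * \<psi> z)"
  have "decay_bound (m + 1) ?N (norm (complex_of_real (1 / A)) * A + norm (0::complex) * A) (\<lambda>z. complex_of_real (1 / A) * \<psi> z + 0 * \<psi> z)"
    by (intro decay_bound_lincomb schwartz_smooth \<psi> A(2))
  moreover have "norm (complex_of_real (1 / A)) * A + norm (0::complex) * A = 1"
  proof -
    have "norm (complex_of_real (1 / A)) = 1 / A" using A(1) by (simp only: norm_of_real) simp
    then show ?thesis using A(1) by simp
  qed
  ultimately have "decay_bound (m + 1) ?N 1 \<eta>" by (simp add: \<eta>_def)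
  moreover have "\<eta> \<in> schwartz_space" using schwartz_lincomb[OF \<psi> \<psi>, of "complex_of_real (1 / A)" 0] by (simp add: \<eta>_def)
  ultimately have \<eta>: "\<eta> \<in> normalized_schwartz m" by (simp add: normalized_schwartz_iff)
  have "nontangential_max \<psi> f x \<le> ennreal A * grand_max m f x" if f: "f \<in> tempered_distributions" for f x
    unfolding nontangential_max_def
  proof (rule SUP_least, clarify)
    fix y t assume t: "0 < t" "dist x y < t"
    have S: "(\<lambda>z. dilate t \<eta> (y - z)) \<in> schwartz_space"
      using \<eta> t by (intro schwartz_reflect schwartz_dilate) (auto simp: normalized_schwartz_iff)
    have "(\<lambda>z. dilate t \<psi> (y - z)) = (\<lambda>z. complex_of_real A * dilate t \<eta> (y - z))"
      using A(1) by (auto simp: dilate_def \<eta>_def)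
    then have "distr_conv f (dilate t \<psi>) y = complex_of_real A * distr_conv f (dilate t \<eta>) y"
      unfolding distr_conv_def using tempered_scale[OF f S, of "complex_of_real A"] by simp
    then have "ennreal (norm (distr_conv f (dilate t \<psi>) y)) = ennreal A * ennreal (norm (distr_conv f (dilate t \<eta>) y))"
      using A(1) by (simp add: norm_mult ennreal_mult')
    also have "ennreal (norm (distr_conv f (dilate t \<eta>) y)) \<le> nontangential_max \<eta> f x"
      unfolding nontangential_max_def by (rule SUP_upper2[of "(y, t)"]) (use t in auto)
    also have "\<dots> \<le> grand_max m f x" unfolding grand_max_def by (rule SUP_upper[OF \<eta>])
    finally show "ennreal (norm (distr_conv f (dilate t \<psi>) y)) \<le> ennreal A * grand_max m f x" by (simp add: mult_left_mono)
  qed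
  then show ?thesis using A(1) that by blast
qed

lemma extended_value_mono:
  assumes "orlicz_function \<Phi>" "a \<le> b" shows "extended_value \<Phi> a \<le> extended_value \<Phi> b"
proof (cases "b = \<infinity>")
  case False
  then have "a \<noteq> \<infinity>" "enn2real a \<le> enn2real b" using assms(2) by (auto simp: top_unique less_top intro: enn2real_mono)
  moreover have "mono_on {0..} \<Phi>" using assms(1) by (simp add: orlicz_function_def)
  ultimately show ?thesis using False by (auto simp: extended_value_def intro!: ennreal_leI elim: mono_onD)
qed (simp add: extended_value_def)

lemma extended_value_scale_le:
  assumes le: "\<And>t. t \<ge> 0 \<Longrightarrow> \<Phi> (c * t) \<le> K * \<Phi> t" and c: "c > 0" and K: "K > 0"
  shows "extended_value \<Phi> (ennreal c * a) \<le> ennreal K * extended_value \<Phi> a"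
proof (cases "a = \<infinity>")
  case True
  then show ?thesis using K by (simp add: extended_value_def ennreal_mult_top)
next
  case False
  then have "ennreal c * a \<noteq> \<infinity>" by (simp add: ennreal_mult_eq_top_iff)
  moreover have "enn2real (ennreal c * a) = c * enn2real a" using c by (simp add: enn2real_mult)
  ultimately show ?thesis using False le[of "enn2real a"] K by (simp add: extended_value_def ennreal_leI flip: ennreal_mult')
qed

lemma musielak_modular_mono:
  assumes "growth_function \<phi>" "\<And>x. g x \<le> h x" shows "musielak_modular \<phi> g \<le> musielak_modular \<phi> h"
  unfolding musielak_modular_eq
  by (intro nn_integral_mono extended_value_mono assms) (use assms(1) in \<open>simp add: growth_function_def\<close>)

lemma musielak_modular_scale_le:
  fixes \<phi> :: "real^'n \<Rightarrow> real \<Rightarrow> real"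
  assumes le: "\<And>x t. t \<ge> 0 \<Longrightarrow> \<phi> x (c * t) \<le> K * \<phi> x t" and c: "c > 0" and K: "K > 0"
  shows "musielak_modular \<phi> (\<lambda>x. ennreal c * g x) \<le> ennreal K * musielak_modular \<phi> g"
proof -
  have "musielak_modular \<phi> (\<lambda>x. ennreal c * g x) \<le> (\<integral>\<^sup>+x. ennreal K * extended_value (\<phi> x) (g x) \<partial>lebesgue)"
    unfolding musielak_modular_eq by (intro nn_integral_mono extended_value_scale_le le c K)
  also have "\<dots> \<le> ennreal K * musielak_modular \<phi> g"
    unfolding musielak_modular_eq by (rule nn_integral_cmult_le[OF K])
  finally show ?thesis .
qed

lemma AE_finite_of_musielak_modular_finite:
  assumes g: "g \<in> borel_measurable lebesgue" and fin: "musielak_modular \<phi> g < \<infinity>"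
  shows "AE x in lebesgue. g x \<noteq> \<infinity>"
proof -
  let ?A = "{x. g x = \<infinity>}"
  have A: "?A \<in> sets lebesgue" using measurable_sets[OF g, of "{\<infinity>}"] by (simp add: vimage_def)
  have "\<infinity> * emeasure lebesgue ?A = (\<integral>\<^sup>+x. \<infinity> * indicator ?A x \<partial>lebesgue)"
    using A by (simp add: nn_integral_cmult_indicator)
  also have "\<dots> \<le> musielak_modular \<phi> g"
    unfolding musielak_modular_def by (intro nn_integral_mono) (auto simp: indicator_def)
  finally have "\<infinity> * emeasure lebesgue ?A < \<infinity>" using fin by (rule le_less_trans)
  then have "emeasure lebesgue ?A = 0" by (auto simp: ennreal_mult_less_top)
  then show ?thesis using A by (subst AE_iff_measurable[of ?A]) auto
qed

lemma maximal_function_mono_AE: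
  assumes "AE y in lborel. U y \<le> V y" shows "maximal_function U x \<le> maximal_function V x"
  unfolding maximal_function_def
proof (intro SUP_mono)
  fix p assume "p \<in> {(c, r). x \<in> ball c r}"
  moreover have "(\<integral>\<^sup>+y\<in>ball c r. U y \<partial>lborel) \<le> (\<integral>\<^sup>+y\<in>ball c r. V y \<partial>lborel)" for c r
    using assms by (intro nn_integral_mono_AE) (auto elim!: eventually_mono intro: mult_right_mono)
  ultimately show "\<exists>q\<in>{(c, r). x \<in> ball c r}. (case p of (c, r) \<Rightarrow> (\<integral>\<^sup>+y\<in>ball c r. U y \<partial>lborel) / ennreal (measure lborel (ball c r)))
     \<le> (case q of (c, r) \<Rightarrow> (\<integral>\<^sup>+y\<in>ball c r. V y \<partial>lborel) / ennreal (measure lborel (ball c r)))"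
    by (intro bexI[of _ p]) (auto intro: divide_right_mono_ennreal)
qed

text \<open>
  A lower type \<open>p > 1\<close> would make \<open>\<phi>(x, \<cdot>)\<close> grow faster than the upper type 1 permits.
\<close>

lemma lower_type_le_1:
  fixes \<phi> :: "real^'n \<Rightarrow> real \<Rightarrow> real"
  assumes gr: "growth_function \<phi>" and low: "uniformly_lower_type p \<phi>"
  shows "p \<le> 1"
proof (rule ccontr)
  assume "\<not> p \<le> 1"
  have posphi: "\<phi> x t > 0" if "t > 0" for x t using gr that by (auto simp: growth_function_def orlicz_function_def)
  obtain C1 where C1: "C1 > 0" "\<And>x t s. t \<ge> 0 \<Longrightarrow> s \<in> {0..1} \<Longrightarrow> \<phi> x (s * t) \<le> C1 * s powr p * \<phi> x t"
    using low by (auto simp: uniformly_lower_type_def)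
  obtain C2 where C2: "C2 > 0" "\<forall>x. \<forall>t\<ge>0. \<forall>s\<ge>1. \<phi> x (s * t) \<le> C2 * s powr 1 * \<phi> x t"
    using gr by (auto simp: growth_function_def uniformly_upper_type_def)
  have le: "s powr (p - 1) \<le> C1 * C2" if s: "s \<ge> 1" for s
  proof -
    define x0 :: "real^'n" where "x0 = 0"
    have "\<phi> x0 1 = \<phi> x0 ((1 / s) * s)" using s by simp
    also have "\<dots> \<le> C1 * (1 / s) powr p * \<phi> x0 s" using s by (intro C1(2)) auto
    also have "\<dots> \<le> C1 * (1 / s) powr p * (C2 * s powr 1 * \<phi> x0 1)"
      using C2(2)[rule_format, of 1 s x0] C1(1) s by (intro mult_left_mono) auto
    also have "\<dots> = (C1 * C2 * ((1 / s) powr p * s powr 1)) * \<phi> x0 1" by simp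
    also have "(1 / s) powr p * s powr 1 = 1 / s powr (p - 1)"
      using s by (simp add: powr_divide powr_diff)
    finally have "1 * \<phi> x0 1 \<le> (C1 * C2 * (1 / s powr (p - 1))) * \<phi> x0 1" by simp
    then have "1 \<le> C1 * C2 * (1 / s powr (p - 1))" using posphi[of 1 x0] by (simp only: mult_le_cancel_right_pos zero_less_one)
    then show ?thesis using s by (simp add: pos_le_divide_eq)
  qed
  define s where "s = max 1 ((C1 * C2 + 1) powr (1 / (p - 1)))"
  have "(C1 * C2 + 1) powr (1 / (p - 1)) \<le> s" by (simp add: s_def)
  then have "((C1 * C2 + 1) powr (1 / (p - 1))) powr (p - 1) \<le> s powr (p - 1)"
    using \<open>\<not> p \<le> 1\<close> by (intro powr_mono2) auto
  moreover have "((C1 * C2 + 1) powr (1 / (p - 1))) powr (p - 1) = C1 * C2 + 1"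
    using \<open>\<not> p \<le> 1\<close> C1(1) C2(1) by (simp add: powr_powr add_pos_pos)
  ultimately show False using le[of s] by (simp add: s_def)
qed

text \<open>
  The definition of the critical order gives \<open>n k / i < n + m + 1\<close> for the critical indices \<open>k\<close> and \<open>i\<close>.  They
  may fail to be attained, but by strictness suitable \<open>q\<close> and \<open>p\<close> exist close to them, and \<open>r\<close> is chosen
  between \<open>n / (n + m + 1)\<close> and \<open>p / q\<close>.
\<close>

lemma growth_function_exponents:
  fixes \<phi> :: "real^'n \<Rightarrow> real \<Rightarrow> real"
  assumes gr: "growth_function \<phi>"
  obtains p q r where "0 < p" "uniformly_lower_type p \<phi>" "muckenhoupt q \<phi>" "0 < r" "r < 1" "r * q < p"
    "real CARD('n) / r < real (critical_order \<phi>) + 1 + real CARD('n)"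
proof -
  let ?n = "real CARD('n)"
  have n: "?n > 0" by simp
  define P where "P = {p. 0 < p \<and> uniformly_lower_type p \<phi>}"
  define Q where "Q = {q. 1 \<le> q \<and> muckenhoupt q \<phi>}"
  define i where "i = critical_lower_type \<phi>"
  define k where "k = critical_weight_index \<phi>"
  define m where "m = critical_order \<phi>"
  have i_eq: "i = Sup P" and k_eq: "k = Inf Q" by (simp_all add: i_def k_def P_def Q_def critical_lower_type_def critical_weight_index_def)
  have P1: "p \<le> 1" if "p \<in> P" for p
    using that lower_type_le_1[OF gr] by (simp add: P_def)
  obtain p0 where p0: "p0 \<in> P" using gr by (auto simp: growth_function_def P_def)
  obtain q0 where q0: "q0 \<in> Q" using gr by (auto simp: growth_function_def Q_def)
  have bddP: "bdd_above P" using P1 by (auto simp: bdd_above_def)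
  have "p0 \<le> i" unfolding i_eq using p0 bddP by (rule cSup_upper)
  then have i: "0 < i" "i \<le> 1" using p0 P1 unfolding i_eq by (auto simp: P_def intro!: cSup_least)
  have k: "1 \<le> k" unfolding k_eq using q0 by (intro cInf_greatest) (auto simp: Q_def)
  define M where "M = real m + 1 + ?n"
  have M: "M > 0" by (simp add: M_def add_nonneg_pos)
  \<comment> \<open>strictness comes from the floor in the definition of the critical order\<close>
  have "?n * (k / i - 1) < real m + 1"
  proof -
    have "?n * (k / i - 1) < real_of_int \<lfloor>?n * (k / i - 1)\<rfloor> + 1" by linarith
    also have "real_of_int \<lfloor>?n * (k / i - 1)\<rfloor> \<le> real m" unfolding m_def critical_order_def i_def k_def by linarith
    finally show ?thesis by simp
  qed
  then have "?n * (k / i) < M" by (simp add: M_def algebra_simps)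
  then have ki: "k < i * M / ?n" using i n by (simp add: field_simps)
  have "Inf Q < i * M / ?n" using ki by (simp add: k_eq)
  then obtain q where q: "q \<in> Q" "q < i * M / ?n" using cInf_lessD[of Q "i * M / ?n"] q0 by blast
  have "q * ?n / M < Sup P" using q n M by (simp add: i_eq[symmetric] field_simps)
  then obtain p where p: "p \<in> P" "q * ?n / M < p" using less_cSupD[of P "q * ?n / M"] p0 by blast
  have q1: "q \<ge> 1" using q by (simp add: Q_def)
  have "?n / M < p / q" using p q1 M by (simp add: field_simps)
  then obtain r where r: "?n / M < r" "r < p / q" using dense by blast
  have "?n / M > 0" using n M by simp
  then have r0: "r > 0" using r by linarith
  have "p / q \<le> 1" using P1[OF p(1)] p q1 by (simp add: P_def divide_le_eq)
  then have "r < 1" using r by linarith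
  moreover have "r * q < p" using r q1 by (simp add: field_simps)
  moreover have "?n / r < M" using r r0 M by (simp add: field_simps)
  ultimately show ?thesis using p q r0 by (intro that[of p q r]) (auto simp: P_def Q_def M_def m_def)
qed

lemma tempered_rescale:
  assumes f: "f \<in> tempered_distributions"
  shows "(\<lambda>\<psi>. complex_of_real c * f \<psi>) \<in> tempered_distributions"
proof -
  have "continuous_map schwartz_topology euclidean f" using f by (simp add: tempered_distributions_def)
  moreover have "continuous_map euclidean euclidean (\<lambda>z. complex_of_real c * z)"
    by (simp add: continuous_map_iff_continuous2 continuous_intros)
  ultimately have "continuous_map schwartz_topology euclidean ((\<lambda>z. complex_of_real c * z) \<circ> f)"
    by (rule continuous_map_compose)
  then show ?thesis using f by (simp add: tempered_distributions_def o_def algebra_simps)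
qed

text \<open>
  The modular inequality needs a finite function \<open>g\<close>, whereas the pointwise bound needs a majorant everywhere.  If
  the modular of \<open>g\<close> is finite, then \<open>g\<close> is finite almost everywhere, and the maximal function does not see
  the difference.
\<close>

lemma musielak_modular_grand_max_le:
  fixes \<phi> :: "real^'n \<Rightarrow> real \<Rightarrow> real" and \<Phi> :: "real^'n \<Rightarrow> complex"
  assumes gr: "growth_function \<phi>" and \<Phi>: "\<Phi> \<in> schwartz_space" and nz: "(LINT y|lborel. \<Phi> y) \<noteq> 0"
  obtains K where "K > 0" "\<And>f. f \<in> tempered_distributions \<Longrightarrow>
     musielak_modular \<phi> (grand_max (critical_order \<phi>) f) \<le> ennreal K * musielak_modular \<phi> (dyadic_radial_max \<Phi> f)"
proof -
  let ?m = "critical_order \<phi>"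
  obtain p q r where e: "0 < p" "uniformly_lower_type p \<phi>" "muckenhoupt q \<phi>" "0 < r" "r < 1" "r * q < p"
    "real CARD('n) / r < real ?m + 1 + real CARD('n)"
    using growth_function_exponents[OF gr] by metis
  obtain C where C: "C \<ge> 1" and gm: "\<forall>f U x M. f \<in> tempered_distributions \<longrightarrow> U \<in> borel_measurable borel \<longrightarrow>
      (\<forall>j v. ennreal (norm (distr_conv f (dyadic_dilate j \<Phi>) v) powr r) \<le> U v) \<longrightarrow>
      0 \<le> M \<longrightarrow> maximal_function U x \<le> ennreal M \<longrightarrow> grand_max ?m f x \<le> ennreal (C * M powr (1 / r))"
    using grand_max_le_maximal_function[OF \<Phi> nz e(4,5,7)] by (elim exE conjE)
  obtain K where K: "K > 0" and mm: "\<forall>g G. g \<in> borel_measurable lebesgue \<longrightarrow>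
     (\<forall>x M. 0 \<le> M \<longrightarrow> maximal_function (\<lambda>y. ennreal (enn2real (g y) powr r)) x \<le> ennreal M \<longrightarrow>
        G x \<le> ennreal (C * M powr (1 / r))) \<longrightarrow>
     musielak_modular \<phi> G \<le> ennreal K * musielak_modular \<phi> g"
    using musielak_modular_le_of_maximal[OF gr e(2,3,4,6) C] by (elim exE conjE)
  have "musielak_modular \<phi> (grand_max ?m f) \<le> ennreal K * musielak_modular \<phi> (dyadic_radial_max \<Phi> f)"
    if f: "f \<in> tempered_distributions" for f
  proof (cases "musielak_modular \<phi> (dyadic_radial_max \<Phi> f) = \<infinity>")
    case True
    then show ?thesis using K by (simp add: ennreal_mult_top)
  next
    case False
    define g where "g = dyadic_radial_max \<Phi> f"
    have gb: "g \<in> borel_measurable borel" unfolding g_def by (rule dyadic_radial_max_measurable[OF f \<Phi>])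
    then have gl: "g \<in> borel_measurable lebesgue" by (intro measurable_completion) simp
    note dyadic_convolution_measurable[OF f \<Phi>, measurable]
    define U where "U v = (SUP j. ennreal (norm (distr_conv f (dyadic_dilate j \<Phi>) v) powr r))" for v
    have U: "U \<in> borel_measurable borel" unfolding U_def[abs_def] by (rule borel_measurable_SUP) auto
    have uU: "\<forall>j v. ennreal (norm (distr_conv f (dyadic_dilate j \<Phi>) v) powr r) \<le> U v"
      unfolding U_def by (auto intro: SUP_upper)
    have "AE x in lebesgue. g x \<noteq> \<infinity>"
      using AE_finite_of_musielak_modular_finite[OF gl, of \<phi>] False by (simp add: g_def less_top)
    then have "AE x in lborel. g x \<noteq> \<infinity>" using gb by (simp add: AE_completion_iff)
    then have AE: "AE y in lborel. U y \<le> ennreal (enn2real (g y) powr r)"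
    proof eventually_elim
      case (elim y)
      show ?case unfolding U_def
      proof (rule SUP_least)
        fix j
        have "ennreal (norm (distr_conv f (dyadic_dilate j \<Phi>) y)) \<le> g y"
          unfolding g_def dyadic_radial_max_def by (rule SUP_upper) simp
        then have "norm (distr_conv f (dyadic_dilate j \<Phi>) y) \<le> enn2real (g y)"
          using elim by (metis enn2real_ennreal enn2real_mono ennreal_less_top infinity_ennreal_def less_top norm_ge_zero)
        then show "ennreal (norm (distr_conv f (dyadic_dilate j \<Phi>) y) powr r) \<le> ennreal (enn2real (g y) powr r)"
          using e(4) by (intro ennreal_leI powr_mono2) auto
      qed
    qed
    have "grand_max ?m f x \<le> ennreal (C * M powr (1 / r))"
      if M: "0 \<le> M" "maximal_function (\<lambda>y. ennreal (enn2real (g y) powr r)) x \<le> ennreal M" for x M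
    proof -
      have "maximal_function U x \<le> ennreal M"
        using maximal_function_mono_AE[OF AE, of x] M(2) by order
      then show ?thesis using gm f U uU M(1) by blast
    qed
    then show ?thesis using mm gl unfolding g_def by blast
  qed
  then show ?thesis using K that by blast
qed

text \<open>
  By the lower type \<open>p\<close>, division by \<open>\<kappa>\<close> reduces the modular by the factor \<open>C1 / \<kappa>\<^sup>p\<close>, which outweighs \<open>K\<close> for
  large \<open>\<kappa>\<close>.
\<close>

lemma musielak_norm_le_of_modular:
  fixes \<phi> :: "real^'n \<Rightarrow> real \<Rightarrow> real"
  assumes gr: "growth_function \<phi>" and K: "K > 0"
  obtains \<kappa> where "\<kappa> > 0"
    "\<And>G g. (\<And>l. l > 0 \<Longrightarrow> musielak_modular \<phi> (\<lambda>x. G x / ennreal l) \<le> ennreal K * musielak_modular \<phi> (\<lambda>x. g x / ennreal l)) \<Longrightarrow>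
      musielak_norm \<phi> G \<le> ennreal \<kappa> * musielak_norm \<phi> g"
proof -
  obtain p C1 where p: "0 < p" and C1: "C1 > 0" "\<And>x t s. t \<ge> 0 \<Longrightarrow> s \<in> {0..1} \<Longrightarrow> \<phi> x (s * t) \<le> C1 * s powr p * \<phi> x t"
    using gr by (auto simp: growth_function_def uniformly_lower_type_def)
  define \<kappa> where "\<kappa> = max 1 ((C1 * K) powr (1 / p))"
  have \<kappa>: "\<kappa> \<ge> 1" by (simp add: \<kappa>_def)
  have small: "C1 * (1 / \<kappa>) powr p * K \<le> 1"
  proof -
    have "((C1 * K) powr (1 / p)) powr p \<le> \<kappa> powr p" using p by (intro powr_mono2) (auto simp: \<kappa>_def)
    then have "C1 * K \<le> \<kappa> powr p" using p C1 K by (simp add: powr_powr)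
    moreover have "\<kappa> powr p > 0" using \<kappa> by simp
    ultimately show ?thesis using \<kappa> by (simp add: powr_divide field_simps)
  qed
  have "musielak_norm \<phi> G \<le> ennreal \<kappa> * musielak_norm \<phi> g"
    if le: "\<And>l. l > 0 \<Longrightarrow> musielak_modular \<phi> (\<lambda>x. G x / ennreal l) \<le> ennreal K * musielak_modular \<phi> (\<lambda>x. g x / ennreal l)" for G g
  proof -
    have k1: "ennreal \<kappa> * ennreal (1 / \<kappa>) = 1" using \<kappa> by (simp flip: ennreal_mult')
    have "ennreal (1 / \<kappa>) * musielak_norm \<phi> G \<le> musielak_norm \<phi> g"
      unfolding musielak_norm_def[of \<phi> g]
    proof (rule Inf_greatest, clarify)
      fix l :: real assume l: "0 < l" "musielak_modular \<phi> (\<lambda>x. g x / ennreal l) \<le> 1"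
      have "musielak_modular \<phi> (\<lambda>x. G x / ennreal (\<kappa> * l)) = musielak_modular \<phi> (\<lambda>x. ennreal (1 / \<kappa>) * (G x / ennreal l))"
      proof -
        have "G x / ennreal (\<kappa> * l) = ennreal (1 / \<kappa>) * (G x / ennreal l)" for x
          using \<kappa> l by (simp add: divide_ennreal_def inverse_ennreal ennreal_mult' inverse_eq_divide mult_ac flip: ennreal_mult')
        then show ?thesis by simp
      qed
      also have "\<dots> \<le> ennreal (C1 * (1 / \<kappa>) powr p) * musielak_modular \<phi> (\<lambda>x. G x / ennreal l)"
        using \<kappa> C1 by (intro musielak_modular_scale_le C1(2)) auto
      also have "\<dots> \<le> ennreal (C1 * (1 / \<kappa>) powr p) * (ennreal K * 1)"
        by (intro mult_left_mono order_trans[OF le[OF l(1)]] l) auto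
      also have "\<dots> = ennreal (C1 * (1 / \<kappa>) powr p * K)" using C1 by (simp flip: ennreal_mult')
      also have "\<dots> \<le> 1" using small by simp
      finally have "musielak_norm \<phi> G \<le> ennreal (\<kappa> * l)"
        unfolding musielak_norm_def using \<kappa> l by (intro Inf_lower) auto
      then have "ennreal (1 / \<kappa>) * musielak_norm \<phi> G \<le> ennreal (1 / \<kappa>) * ennreal (\<kappa> * l)" by (rule mult_left_mono) simp
      also have "\<dots> = ennreal l" using \<kappa> by (simp flip: ennreal_mult')
      finally show "ennreal (1 / \<kappa>) * musielak_norm \<phi> G \<le> ennreal l" .
    qed
    then have "ennreal \<kappa> * (ennreal (1 / \<kappa>) * musielak_norm \<phi> G) \<le> ennreal \<kappa> * musielak_norm \<phi> g" by (rule mult_left_mono) simp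
    then show ?thesis by (simp add: mult.assoc[symmetric] k1)
  qed
  then show ?thesis using \<kappa> by (intro that[of \<kappa>]) auto
qed


lemma norm_distr_conv_rescale:
  assumes "l > 0"
  shows "ennreal (norm (distr_conv (\<lambda>\<psi>. complex_of_real (1 / l) * f \<psi>) \<eta> y)) = ennreal (1 / l) * ennreal (norm (distr_conv f \<eta> y))"
proof -
  have "norm (complex_of_real (1 / l)) = 1 / l" using assms by (simp only: norm_of_real) simp
  then have "norm (distr_conv (\<lambda>\<psi>. complex_of_real (1 / l) * f \<psi>) \<eta> y) = 1 / l * norm (distr_conv f \<eta> y)"
    by (simp only: distr_conv_def norm_mult)
  then show ?thesis using assms by (simp only: ennreal_mult' divide_nonneg_pos zero_le_one)
qed

lemma divide_ennreal_eq_mult: "l > 0 \<Longrightarrow> x / ennreal l = ennreal (1 / l) * x"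
  by (simp add: divide_ennreal_def inverse_ennreal inverse_eq_divide mult.commute)

text \<open>
  The modular inequalities hold for every distribution, so they may be applied to \<open>f / l\<close>; this turns them
  into the hypothesis of \<open>musielak_norm_le_of_modular\<close>.
\<close>

lemma maximal_functions_rescale:
  fixes f :: "(real^'n \<Rightarrow> complex) \<Rightarrow> complex"
  assumes l: "l > 0"
  defines "f' \<equiv> \<lambda>\<psi>. complex_of_real (1 / l) * f \<psi>"
  shows "nontangential_max \<Phi> f' x = nontangential_max \<Phi> f x / ennreal l"
    and "dyadic_radial_max \<Phi> f' x = dyadic_radial_max \<Phi> f x / ennreal l"
    and "grand_max m f' x = grand_max m f x / ennreal l"
proof -
  note n = norm_distr_conv_rescale[OF l, of f, folded f'_def]
  show nt: "nontangential_max \<Phi> f' x = nontangential_max \<Phi> f x / ennreal l" for \<Phi>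
    unfolding nontangential_max_def divide_ennreal_eq_mult[OF l] n by (simp add: SUP_mult_left_ennreal case_prod_unfold)
  show "dyadic_radial_max \<Phi> f' x = dyadic_radial_max \<Phi> f x / ennreal l"
    unfolding dyadic_radial_max_def divide_ennreal_eq_mult[OF l] n by (simp add: SUP_mult_left_ennreal)
  show "grand_max m f' x = grand_max m f x / ennreal l"
    unfolding grand_max_def nt divide_ennreal_eq_mult[OF l] by (simp add: SUP_mult_left_ennreal)
qed

theorem theorem3p7:
  fixes \<phi> :: "real^'n \<Rightarrow> real \<Rightarrow> real" and \<psi>\<^sub>0 :: "real^'n \<Rightarrow> complex"
  assumes "growth_function \<phi>"
    and "\<psi>\<^sub>0 \<in> test_functions"
    and "(LINT x|lebesgue. \<psi>\<^sub>0 x) \<noteq> 0"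
  shows "(\<forall>f. f \<in> musielak_hardy \<phi> \<longleftrightarrow>
              f \<in> tempered_distributions \<and> dyadic_radial_max \<psi>\<^sub>0 f \<in> musielak_space \<phi>) \<and>
         (\<forall>f. f \<in> musielak_hardy \<phi> \<longleftrightarrow>
              f \<in> tempered_distributions \<and> nontangential_max \<psi>\<^sub>0 f \<in> musielak_space \<phi>) \<and>
         comparable_on (musielak_hardy \<phi>) (musielak_hardy_norm \<phi>)
           (\<lambda>f. musielak_norm \<phi> (dyadic_radial_max \<psi>\<^sub>0 f)) \<and>
         comparable_on (musielak_hardy \<phi>)
           (\<lambda>f. musielak_norm \<phi> (dyadic_radial_max \<psi>\<^sub>0 f))
           (\<lambda>f. musielak_norm \<phi> (nontangential_max \<psi>\<^sub>0 f))"
proof -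
  let ?T = "tempered_distributions :: ((real^'n \<Rightarrow> complex) \<Rightarrow> complex) set"
  let ?m = "critical_order \<phi>"
  define G :: "((real^'n \<Rightarrow> complex) \<Rightarrow> complex) \<Rightarrow> real^'n \<Rightarrow> ennreal" where "G f = grand_max ?m f" for f
  define R :: "((real^'n \<Rightarrow> complex) \<Rightarrow> complex) \<Rightarrow> real^'n \<Rightarrow> ennreal" where "R f = dyadic_radial_max \<psi>\<^sub>0 f" for f
  define N :: "((real^'n \<Rightarrow> complex) \<Rightarrow> complex) \<Rightarrow> real^'n \<Rightarrow> ennreal" where "N f = nontangential_max \<psi>\<^sub>0 f" for f
  have S: "\<psi>\<^sub>0 \<in> schwartz_space" using assms(2) by (rule test_functions_schwartz)
  have nz: "(LINT y|lborel. \<psi>\<^sub>0 y) \<noteq> 0"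
    using assms(3) schwartz_borel_measurable[OF S] by (simp add: integral_completion)
  obtain K1 where K1: "K1 > 0" "\<And>f. f \<in> ?T \<Longrightarrow> musielak_modular \<phi> (G f) \<le> ennreal K1 * musielak_modular \<phi> (R f)"
    using musielak_modular_grand_max_le[OF assms(1) S nz] unfolding G_def R_def by metis
  have RN: "musielak_modular \<phi> (R f) \<le> ennreal 1 * musielak_modular \<phi> (N f)" for f
    unfolding R_def N_def using musielak_modular_mono[OF assms(1) dyadic_radial_max_le_nontangential_max] by simp
  obtain C where C: "C \<ge> 1" "\<And>f x. f \<in> ?T \<Longrightarrow> N f x \<le> ennreal C * G f x"
    using nontangential_max_le_grand_max[OF S, of ?m] unfolding G_def N_def by metis
  obtain C2 where C2: "C2 > 0" "\<forall>x. \<forall>t\<ge>0. \<forall>s\<ge>1. \<phi> x (s * t) \<le> C2 * s powr 1 * \<phi> x t"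
    using assms(1) by (auto simp: growth_function_def uniformly_upper_type_def)
  define K3 where "K3 = C2 * C"
  have K3: "K3 > 0" using C C2 by (simp add: K3_def)
  have NG: "musielak_modular \<phi> (N f) \<le> ennreal K3 * musielak_modular \<phi> (G f)" if f: "f \<in> ?T" for f
  proof -
    have "musielak_modular \<phi> (N f) \<le> musielak_modular \<phi> (\<lambda>x. ennreal C * G f x)"
      by (intro musielak_modular_mono assms(1) C(2) f)
    also have "\<dots> \<le> ennreal K3 * musielak_modular \<phi> (G f)"
    proof (rule musielak_modular_scale_le)
      fix x and t :: real assume "0 \<le> t"
      then show "\<phi> x (C * t) \<le> K3 * \<phi> x t" using C2(2)[rule_format, of t C x] C(1) by (simp add: K3_def)
    qed (use C K3 in auto)
    finally show ?thesis .
  qed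
  have meas: "G f \<in> borel_measurable lebesgue" "R f \<in> borel_measurable lebesgue" "N f \<in> borel_measurable lebesgue" if "f \<in> ?T" for f
    unfolding G_def R_def N_def
    by (rule measurable_completion,
        simp add: grand_max_measurable nontangential_max_measurable dyadic_radial_max_measurable[OF that S])+
  have fin: "ennreal K * a < \<infinity>" if "a < \<infinity>" for K and a :: ennreal using that by (simp add: ennreal_mult_less_top)
  have GR: "G f \<in> musielak_space \<phi> \<longleftrightarrow> R f \<in> musielak_space \<phi>" and GN: "G f \<in> musielak_space \<phi> \<longleftrightarrow> N f \<in> musielak_space \<phi>"
    if f: "f \<in> ?T" for f
  proof -
    have "musielak_modular \<phi> (R f) < \<infinity> \<Longrightarrow> musielak_modular \<phi> (G f) < \<infinity>"
      by (rule le_less_trans[OF K1(2)[OF f] fin])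
    moreover have "musielak_modular \<phi> (N f) < \<infinity> \<Longrightarrow> musielak_modular \<phi> (R f) < \<infinity>"
      by (rule le_less_trans[OF RN fin])
    moreover have "musielak_modular \<phi> (G f) < \<infinity> \<Longrightarrow> musielak_modular \<phi> (N f) < \<infinity>"
      by (rule le_less_trans[OF NG[OF f] fin])
    ultimately show "G f \<in> musielak_space \<phi> \<longleftrightarrow> R f \<in> musielak_space \<phi>" "G f \<in> musielak_space \<phi> \<longleftrightarrow> N f \<in> musielak_space \<phi>"
      unfolding musielak_space_def using meas[OF f] by blast+
  qed
  have resc: "(\<lambda>x. G f x / ennreal l) = G (\<lambda>\<psi>. complex_of_real (1 / l) * f \<psi>)"
      "(\<lambda>x. R f x / ennreal l) = R (\<lambda>\<psi>. complex_of_real (1 / l) * f \<psi>)"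
      "(\<lambda>x. N f x / ennreal l) = N (\<lambda>\<psi>. complex_of_real (1 / l) * f \<psi>)" if "l > 0" for f l
    using maximal_functions_rescale[OF that, of _ f] by (auto simp: G_def R_def N_def)
  obtain k1 where k1: "k1 > 0" "\<And>f. f \<in> ?T \<Longrightarrow> musielak_norm \<phi> (G f) \<le> ennreal k1 * musielak_norm \<phi> (R f)"
  proof -
    obtain k where k: "k > 0" "\<And>G g. (\<And>l. l > 0 \<Longrightarrow> musielak_modular \<phi> (\<lambda>x. G x / ennreal l) \<le> ennreal K1 * musielak_modular \<phi> (\<lambda>x. g x / ennreal l)) \<Longrightarrow>
      musielak_norm \<phi> G \<le> ennreal k * musielak_norm \<phi> g" using musielak_norm_le_of_modular[OF assms(1) K1(1)] by metis
    show ?thesis using k(1) by (rule that) (intro k(2), simp only: resc K1(2) tempered_rescale)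
  qed
  obtain k2 where k2: "k2 > 0" "\<And>f. f \<in> ?T \<Longrightarrow> musielak_norm \<phi> (R f) \<le> ennreal k2 * musielak_norm \<phi> (N f)"
  proof -
    obtain k where k: "k > 0" "\<And>G g. (\<And>l. l > 0 \<Longrightarrow> musielak_modular \<phi> (\<lambda>x. G x / ennreal l) \<le> ennreal 1 * musielak_modular \<phi> (\<lambda>x. g x / ennreal l)) \<Longrightarrow>
      musielak_norm \<phi> G \<le> ennreal k * musielak_norm \<phi> g" using musielak_norm_le_of_modular[OF assms(1) zero_less_one] by metis
    show ?thesis using k(1) by (rule that) (intro k(2), simp only: resc RN)
  qed
  obtain k3 where k3: "k3 > 0" "\<And>f. f \<in> ?T \<Longrightarrow> musielak_norm \<phi> (N f) \<le> ennreal k3 * musielak_norm \<phi> (G f)"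
  proof -
    obtain k where k: "k > 0" "\<And>G g. (\<And>l. l > 0 \<Longrightarrow> musielak_modular \<phi> (\<lambda>x. G x / ennreal l) \<le> ennreal K3 * musielak_modular \<phi> (\<lambda>x. g x / ennreal l)) \<Longrightarrow>
      musielak_norm \<phi> G \<le> ennreal k * musielak_norm \<phi> g" using musielak_norm_le_of_modular[OF assms(1) K3] by metis
    show ?thesis using k(1) by (rule that) (intro k(2), simp only: resc NG tempered_rescale)
  qed
  have trans: "a \<le> ennreal (k * k') * c" if "a \<le> ennreal k * b" "b \<le> ennreal k' * c" "k > 0" for a b c k k'
  proof -
    have "a \<le> ennreal k * (ennreal k' * c)" using that by (meson mult_left_mono order_trans zero_le)
    then show ?thesis using that(3) by (simp add: ennreal_mult' mult.assoc)
  qed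
  have incr: "a \<le> ennreal k' * b" if "a \<le> ennreal k * b" "k \<le> k'" for a b k k'
    using that by (meson ennreal_leI mult_right_mono order_trans zero_le)
  have RG: "musielak_norm \<phi> (R f) \<le> ennreal (k2 * k3) * musielak_norm \<phi> (G f)" if "f \<in> ?T" for f
    using k2(2)[OF that] k3(2)[OF that] k2(1) by (rule trans)
  have NR: "musielak_norm \<phi> (N f) \<le> ennreal (k3 * k1) * musielak_norm \<phi> (R f)" if "f \<in> ?T" for f
    using k3(2)[OF that] k1(2)[OF that] k3(1) by (rule trans)
  have hardy: "f \<in> musielak_hardy \<phi> \<longleftrightarrow> f \<in> ?T \<and> G f \<in> musielak_space \<phi>" for f
    by (simp add: musielak_hardy_def G_def)
  have "comparable_on (musielak_hardy \<phi>) (musielak_hardy_norm \<phi>) (\<lambda>f. musielak_norm \<phi> (R f))"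
    unfolding comparable_on_def musielak_hardy_norm_def G_def[symmetric]
    using k1(1) incr[OF k1(2) max.cobounded1[of k1 "k2 * k3"]] incr[OF RG max.cobounded2[of "k2 * k3" k1]]
    by (intro exI[of _ "max k1 (k2 * k3)"]) (auto simp: hardy)
  moreover have "comparable_on (musielak_hardy \<phi>) (\<lambda>f. musielak_norm \<phi> (R f)) (\<lambda>f. musielak_norm \<phi> (N f))"
    unfolding comparable_on_def
    using k2(1) incr[OF k2(2) max.cobounded1[of k2 "k3 * k1"]] incr[OF NR max.cobounded2[of "k3 * k1" k2]]
    by (intro exI[of _ "max k2 (k3 * k1)"]) (auto simp: hardy)
  ultimately show ?thesis using GR GN hardy unfolding R_def N_def by blast
qed

end
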